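(* Let $\mathcal W$ be the even part of the generalized Witt Lie superalgebra $W=W(m,n;\underline t)$ over a field $\mathbb F$ of characteristic $p>3$, with $m,n\ge 3$ and $\underline t=(t_1,\dots,t_m)\in\mathbb N^m$. Then $$\mathrm{Der}(\mathcal W)=\mathrm{ad}\,\mathcal W\oplus \mathrm{span}_{\mathbb F}\{(\mathrm{ad}\,D_i)^{p^{r_i}}\mid i\in Y_0,\ 1\le r_i<t_i\}.$$
   Context: $\mathbb F$ is a field of characteristic $p>3$; $m,n\ge 3$ are integers; $\underline t=(t_1,\dots,t_m)$ are positive integers and $\pi_i=p^{t_i}-1$. Let $Y_0=\{1,\dots,m\}$, $Y_1=\{m+1,\dots,m+n\}$, $Y=Y_0\cup Y_1$, and $\tau(r)=\bar 0$ for $r\in Y_0$, $\tau(r)=\bar1$ for $r\in Y_1$. Let $\mathfrak A=\mathfrak A(m,n;\underline t)$ be the supercommutative associative superalgebra with $\mathbb F$-basis $x^{(\alpha)}x^u$, where $\alpha\in\mathbb A=\{\alpha\in\mathbb N_0^m:\alpha_i\le\pi_i\}$ and $u=\langle i_1<\dots<i_k\rangle$ runs over increasing sequences in $Y_1$ ($x^u=x_{i_1}\cdots x_{i_k}$, $|u|=k$), with $x^{(\alpha)}x^{(\beta)}=\prod_i\binom{\alpha_i+\beta_i}{\alpha_i}x^{(\alpha+\beta)}$ ($x^{(\gamma)}:=0$ if $\gamma\notin\mathbb A$), $x_kx_l=-x_lx_k$ for $k,l\in Y_1$, the $x^{(\alpha)}$ commuting with the $x_k$; the parity of $x^{(\alpha)}x^u$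 is $|u|\bmod 2$. Write $x_i=x^{(\varepsilon_i)}$ for $i\in Y_0$. The superderivations $D_r$ ($r\in Y$) of $\mathfrak A$ are given by $D_i(x^{(\alpha)}x^u)=x^{(\alpha-\varepsilon_i)}x^u$ for $i\in Y_0$ and $D_k(x^{(\alpha)}x^u)=x^{(\alpha)}\partial x^u/\partial x_k$ for $k\in Y_1$; $D_r$ has parity $\tau(r)$. $W=W(m,n;\underline t)=\{\sum_{r\in Y}f_rD_r: f_r\in\mathfrak A\}$ with bracket $[fD_r,gD_s]=fD_r(g)D_s-(-1)^{\mathrm p(fD_r)\mathrm p(gD_s)}gD_s(f)D_r$; it has basis $x^{(\alpha)}x^uD_r$ of $\mathbb Z$-degree $|\alpha|+|u|-1$ and parity $|u|+\tau(r)$. $\mathcal W=W_{\bar0}$ is its even part, a Lie algebra. $\mathrm{Der}(\mathcal W)$ is the Lie algebra of derivations of $\mathcal W$ and $\mathrm{ad}\,E$ denotes the inner derivation $X\mapsto[E,X]$. *)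

theory Defs
  imports Main "HOL-Computational_Algebra.Primes"
begin

(* Basis indices.  A monomial x^(alpha) x^u of the divided power superalgebra A(m,n;t)
   is encoded by (alpha, u) with alpha :: nat => nat vanishing outside {1..m},
   alpha i <= p^(t i) - 1, and u a subset of Y1 = {m+1..m+n} (the increasing
   sequence u is identified with its underlying set).  A basis element
   x^(alpha) x^u D_r of W is encoded by (alpha, u, r). *)

type_synonym amon = "(nat \<Rightarrow> nat) \<times> nat set"
type_synonym wmon = "(nat \<Rightarrow> nat) \<times> nat set \<times> nat"

definition Y0 :: "nat \<Rightarrow> nat set" where "Y0 m = {1..m}"
definition Y1 :: "nat \<Rightarrow> nat \<Rightarrow> nat set" where "Y1 m n = {m+1..m+n}"
definition Yall :: "nat \<Rightarrow> nat \<Rightarrow> nat set" where "Yall m n = Y0 m \<union> Y1 m n"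

definition tau :: "nat \<Rightarrow> nat \<Rightarrow> nat" where "tau m r = (if r \<in> Y0 m then 0 else 1)"

definition Aidx :: "nat \<Rightarrow> nat \<Rightarrow> (nat \<Rightarrow> nat) \<Rightarrow> (nat \<Rightarrow> nat) set" where
  "Aidx p m t = {\<alpha>. (\<forall>i. i \<notin> Y0 m \<longrightarrow> \<alpha> i = 0) \<and> (\<forall>i\<in>Y0 m. \<alpha> i \<le> p ^ t i - 1)}"

definition Abasis :: "nat \<Rightarrow> nat \<Rightarrow> nat \<Rightarrow> (nat \<Rightarrow> nat) \<Rightarrow> amon set" where
  "Abasis p m n t = {(\<alpha>, u). \<alpha> \<in> Aidx p m t \<and> u \<subseteq> Y1 m n}"

definition Wbasis :: "nat \<Rightarrow> nat \<Rightarrow> nat \<Rightarrow> (nat \<Rightarrow> nat) \<Rightarrow> wmon set" where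
  "Wbasis p m n t = {(\<alpha>, u, r). \<alpha> \<in> Aidx p m t \<and> u \<subseteq> Y1 m n \<and> r \<in> Yall m n}"

definition wpar :: "nat \<Rightarrow> wmon \<Rightarrow> nat" where
  "wpar m b = (case b of (\<alpha>, u, r) \<Rightarrow> (card u + tau m r) mod 2)"

(* Elements of A resp. W are coordinate functions with support in the basis. *)

definition unitv :: "'b \<Rightarrow> 'b \<Rightarrow> 'a::field" where
  "unitv a = (\<lambda>c. if c = a then 1 else 0)"

(* coefficient at x^(gamma) x^w of the product (x^(alpha) x^u)(x^(beta) x^v) *)
definition amul_mon :: "nat \<Rightarrow> nat \<Rightarrow> (nat \<Rightarrow> nat) \<Rightarrow> amon \<Rightarrow> amon \<Rightarrow> amon \<Rightarrow> 'a::field" where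
  "amul_mon p m t a b c =
     (case a of (\<alpha>, u) \<Rightarrow> case b of (\<beta>, v) \<Rightarrow> case c of (\<gamma>, w) \<Rightarrow>
       (if \<gamma> = (\<lambda>i. \<alpha> i + \<beta> i) \<and> \<gamma> \<in> Aidx p m t \<and> u \<inter> v = {} \<and> w = u \<union> v
        then (\<Prod>i\<in>Y0 m. of_nat ((\<alpha> i + \<beta> i) choose \<alpha> i))
             * (-1) ^ card {(i, j). i \<in> u \<and> j \<in> v \<and> j < i}
        else 0))"

definition amul :: "nat \<Rightarrow> nat \<Rightarrow> nat \<Rightarrow> (nat \<Rightarrow> nat) \<Rightarrow> (amon \<Rightarrow> 'a::field) \<Rightarrow> (amon \<Rightarrow> 'a) \<Rightarrow> amon \<Rightarrow> 'a" where
  "amul p m n t f g = (\<lambda>c. \<Sum>a\<in>Abasis p m n t. \<Sum>b\<in>Abasis p m n t. f a * g b * amul_mon p m t a b c)"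

(* coefficient at x^(gamma) x^w of D_r (x^(alpha) x^u) *)
definition Dmon :: "nat \<Rightarrow> nat \<Rightarrow> amon \<Rightarrow> amon \<Rightarrow> 'a::field" where
  "Dmon m r a c =
     (case a of (\<alpha>, u) \<Rightarrow> case c of (\<gamma>, w) \<Rightarrow>
       (if r \<in> Y0 m then
          (if 1 \<le> \<alpha> r \<and> \<gamma> = \<alpha>(r := \<alpha> r - 1) \<and> w = u then 1 else 0)
        else
          (if r \<in> u \<and> \<gamma> = \<alpha> \<and> w = u - {r} then (-1) ^ card {j \<in> u. j < r} else 0)))"

definition dapply :: "nat \<Rightarrow> nat \<Rightarrow> nat \<Rightarrow> (nat \<Rightarrow> nat) \<Rightarrow> nat \<Rightarrow> (amon \<Rightarrow> 'a::field) \<Rightarrow> amon \<Rightarrow> 'a" where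
  "dapply p m n t r f = (\<lambda>c. \<Sum>a\<in>Abasis p m n t. f a * Dmon m r a c)"

(* bracket of basis elements b = x^(alpha)x^u D_r, c = x^(beta)x^v D_s of W:
   [fD_r, gD_s] = f D_r(g) D_s - (-1)^(p(fD_r) p(gD_s)) g D_s(f) D_r,
   coefficient at d = (gamma, w, q) *)
definition bbr :: "nat \<Rightarrow> nat \<Rightarrow> nat \<Rightarrow> (nat \<Rightarrow> nat) \<Rightarrow> wmon \<Rightarrow> wmon \<Rightarrow> wmon \<Rightarrow> 'a::field" where
  "bbr p m n t b c d =
     (case b of (\<alpha>, u, r) \<Rightarrow> case c of (\<beta>, v, s) \<Rightarrow> case d of (\<gamma>, w, q) \<Rightarrow>
        (if q = s then amul p m n t (unitv (\<alpha>, u)) (dapply p m n t r (unitv (\<beta>, v))) (\<gamma>, w) else 0)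
      - (-1) ^ (wpar m b * wpar m c)
        * (if q = r then amul p m n t (unitv (\<beta>, v)) (dapply p m n t s (unitv (\<alpha>, u))) (\<gamma>, w) else 0))"

definition Wbr :: "nat \<Rightarrow> nat \<Rightarrow> nat \<Rightarrow> (nat \<Rightarrow> nat) \<Rightarrow> (wmon \<Rightarrow> 'a::field) \<Rightarrow> (wmon \<Rightarrow> 'a) \<Rightarrow> wmon \<Rightarrow> 'a" where
  "Wbr p m n t X Y = (\<lambda>d. \<Sum>b\<in>Wbasis p m n t. \<Sum>c\<in>Wbasis p m n t. X b * Y c * bbr p m n t b c d)"

definition Weven :: "nat \<Rightarrow> nat \<Rightarrow> nat \<Rightarrow> (nat \<Rightarrow> nat) \<Rightarrow> (wmon \<Rightarrow> 'a::field) set" where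
  "Weven p m n t = {X. \<forall>b. X b \<noteq> 0 \<longrightarrow> b \<in> Wbasis p m n t \<and> wpar m b = 0}"

(* Der(\<W>): F-linear maps \<W> \<rightarrow> \<W> satisfying the Leibniz rule
   (represented extensionally: zero outside \<W>) *)
definition DerW :: "nat \<Rightarrow> nat \<Rightarrow> nat \<Rightarrow> (nat \<Rightarrow> nat) \<Rightarrow> ((wmon \<Rightarrow> 'a::field) \<Rightarrow> (wmon \<Rightarrow> 'a)) set" where
  "DerW p m n t =
     {\<phi>. (\<forall>X\<in>Weven p m n t. \<phi> X \<in> Weven p m n t)
        \<and> (\<forall>X\<in>Weven p m n t. \<forall>Y\<in>Weven p m n t. \<forall>a b.
              \<phi> (\<lambda>d. a * X d + b * Y d) = (\<lambda>d. a * \<phi> X d + b * \<phi> Y d))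
        \<and> (\<forall>X\<in>Weven p m n t. \<forall>Y\<in>Weven p m n t.
              \<phi> (Wbr p m n t X Y) = (\<lambda>d. Wbr p m n t (\<phi> X) Y d + Wbr p m n t X (\<phi> Y) d))
        \<and> (\<forall>X. X \<notin> Weven p m n t \<longrightarrow> \<phi> X = (\<lambda>_. 0))}"

definition Dvec :: "nat \<Rightarrow> wmon \<Rightarrow> 'a::field" where
  "Dvec i = unitv ((\<lambda>_. 0), {}, i)"

definition Jset :: "nat \<Rightarrow> (nat \<Rightarrow> nat) \<Rightarrow> (nat \<times> nat) set" where
  "Jset m t = {(i, r). i \<in> Y0 m \<and> 1 \<le> r \<and> r < t i}"

definition adDpow :: "nat \<Rightarrow> nat \<Rightarrow> nat \<Rightarrow> (nat \<Rightarrow> nat) \<Rightarrow> nat \<Rightarrow> nat \<Rightarrow> (wmon \<Rightarrow> 'a::field) \<Rightarrow> (wmon \<Rightarrow> 'a)" where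
  "adDpow p m n t i r = (Wbr p m n t (Dvec i)) ^^ (p ^ r)"

definition spanop :: "nat \<Rightarrow> nat \<Rightarrow> nat \<Rightarrow> (nat \<Rightarrow> nat) \<Rightarrow> (nat \<times> nat \<Rightarrow> 'a::field) \<Rightarrow> (wmon \<Rightarrow> 'a) \<Rightarrow> (wmon \<Rightarrow> 'a)" where
  "spanop p m n t c X = (\<lambda>d. \<Sum>(i, r)\<in>Jset m t. c (i, r) * adDpow p m n t i r X d)"

definition combo :: "nat \<Rightarrow> nat \<Rightarrow> nat \<Rightarrow> (nat \<Rightarrow> nat) \<Rightarrow> (wmon \<Rightarrow> 'a::field) \<Rightarrow> (nat \<times> nat \<Rightarrow> 'a) \<Rightarrow> (wmon \<Rightarrow> 'a) \<Rightarrow> (wmon \<Rightarrow> 'a)" where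
  "combo p m n t E c = (\<lambda>X. if X \<in> Weven p m n t
        then (\<lambda>d. Wbr p m n t E X d + spanop p m n t c X d) else (\<lambda>_. 0))"

end

theory Submission
  imports Defs "HOL-Algebra.Exponent"
begin

text \<open>Write \<open>D_i\<close> for the partial derivatives, \<open>h_s = x_s D_s\<close> for the torus and let \<open>\<phi>\<close> be a derivation.
  Subtracting derivations of the allowed form, one makes \<open>\<phi>\<close> vanish on larger and larger sets.
  (1) The torus acts diagonally, so an inner derivation kills the part of \<open>\<phi>(h_s)\<close> of nonzero weight; the
  remainder is central, hence zero, and from then on \<open>\<phi>\<close> preserves weights modulo \<open>p\<close>.
  (2) The \<open>\<phi>(D_i)\<close> form a closed system. The only obstruction to integrating it, top powers of \<open>x_i\<close>,
  is excluded by weights and by \<open>[D_i, x_k x_l D_j] = 0\<close>.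
  (3) Now \<open>\<phi>\<close> commutes with all \<open>D_i\<close>. By induction on the degree, \<open>\<phi>(x^(\<alpha>) D_j)\<close> has constant
  coefficients, and weights leave only few candidates. They vanish unless \<open>\<alpha> = p^r \<epsilon>_i\<close>, where a multiple
  of \<open>(ad D_i)^(p^r)\<close> removes them.
  (4) An element of the odd torus corrects \<open>\<phi>\<close> on \<open>x_k D_l\<close> and \<open>x_k x_l D_i\<close>.
  (5) The elements killed so far generate the Lie algebra.\<close>

section \<open>Binomial coefficients and signs\<close>

text \<open>The odd derivatives D_k are missing from the even part, so nothing can be integrated
  along odd directions: commuting with all D_i frees the coefficients of the x_i but still allows
  any exterior factor x^u. Odd weights have to pin that factor down, and the even elements x_k x_l
  D_j act as substitutes for odd derivatives. A torus element, the sum of the z_r h_r over odd r,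
  acts on them only through z_k + z_l; three odd indices and p > 2 recover the single z_k. Even
  weights are known only modulo p, so x^(\<alpha>) D_j with all \<alpha>_s divisible by p looks like
  D_j. Such a field is a bracket of fields of lower degree as soon as \<alpha> is a sum of two
  nonzero p-divisible exponents whose binomial coefficient is nonzero in the field. This fails
  exactly for \<alpha> = p^r \<epsilon>_i, and there the outer derivations live. In coordinates, ad
  D_i is an index shift and ad h_s is diagonal, so most steps compare single coefficients.\<close>

lemma prime_dvd_prime_power_choose:
  fixes p :: nat
  assumes "prime p" "0 < j" "j < p ^ t"
  shows "p dvd (p ^ t choose j)"
proof (rule ccontr)
  assume "\<not> p dvd (p ^ t choose j)"
  then have "coprime (p ^ t) (p ^ t choose j)"
    using assms(1) by (simp add: prime_imp_coprime)
  moreover have "j * (p ^ t choose j) = p ^ t * ((p ^ t - 1) choose (j - 1))"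
    using binomial_absorption[of "j - 1" "p ^ t"] assms by simp
  then have "p ^ t dvd j * (p ^ t choose j)" by simp
  ultimately have "p ^ t dvd j"
    by (simp add: coprime_dvd_mult_left_iff)
  then show False using assms by (simp add: nat_dvd_not_less)
qed

text \<open>Vandermonde for p^t + c with c < a: the summand k = 0 contains c choose a = 0, every
  other one a factor p^t choose k with 0 < k < p^t. So a product of divided powers that leaves the
  truncated range has coefficient 0 in the field anyway, and the truncation respects associativity
  and the Leibniz rule.\<close>

lemma prime_dvd_choose_overflow:
  fixes p :: nat
  assumes p: "prime p" and a: "a < p ^ t" and b: "b < p ^ t" and ab: "p ^ t \<le> a + b"
  shows "p dvd ((a + b) choose a)"
proof -
  define c where "c = a + b - p ^ t"
  have c: "a + b = p ^ t + c" "c < a" using assms by (auto simp: c_def)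
  have "(a + b) choose a = (\<Sum>k\<le>a. (p ^ t choose k) * (c choose (a - k)))"
    unfolding c vandermonde ..
  moreover have "p dvd (p ^ t choose k) * (c choose (a - k))" if "k \<le> a" for k
  proof (cases "k = 0")
    case True then show ?thesis using c by (simp add: binomial_eq_0)
  next
    case False
    then show ?thesis using that a prime_dvd_prime_power_choose[OF p, of k t] by simp
  qed
  ultimately show ?thesis by (metis (no_types, lifting) atMost_iff dvd_sum)
qed

text \<open>The sign in x^u x^v = sg u v x^(u \<union> v) for disjoint u and v. As a double product,
  instead of a power counting inversions, it is multiplicative in both arguments by the standard
  rules for \<open>prod\<close>.\<close>

definition sg :: "nat set \<Rightarrow> nat set \<Rightarrow> 'a::comm_ring_1" where
  "sg u v = (\<Prod>i\<in>u. \<Prod>j\<in>v. if j < i then -1 else 1)"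

lemma minus_one_power_inversions:
  assumes "finite u" "finite v"
  shows "(-1) ^ card {(i, j). i \<in> u \<and> j \<in> v \<and> j < i} = (sg u v :: 'a::comm_ring_1)"
proof -
  have "(sg u v :: 'a) = (\<Prod>x\<in>u \<times> v. if snd x < fst x then -1 else 1)"
    unfolding sg_def by (simp add: prod.cartesian_product case_prod_unfold)
  also have "\<dots> = (\<Prod>x\<in>{x \<in> u \<times> v. snd x < fst x}. -1)"
    using assms prod.inter_filter[of "u \<times> v" "\<lambda>_. -1 :: 'a" "\<lambda>x. snd x < fst x"] by (simp del: prod_constant)
  also have "{x \<in> u \<times> v. snd x < fst x} = {(i, j). i \<in> u \<and> j \<in> v \<and> j < i}" by auto
  finally show ?thesis by simp
qed

lemma sg_empty [simp]: "sg {} v = 1" "sg u {} = 1"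
  by (simp_all add: sg_def)

lemma sg_Un_left:
  assumes "finite u" "finite v" "u \<inter> v = {}"
  shows "sg (u \<union> v) w = sg u w * sg v w"
  using assms by (simp add: sg_def prod.union_disjoint)

lemma sg_Un_right:
  assumes "finite v" "finite w" "v \<inter> w = {}"
  shows "sg u (v \<union> w) = sg u v * sg u w"
  using assms by (simp add: sg_def prod.union_disjoint prod.distrib)

lemma sg_square: "sg u v * sg u v = 1"
  by (simp add: sg_def prod.distrib[symmetric] if_distrib cong: if_cong)

lemma sg_nonzero [simp]: "(sg u v :: 'a::field) \<noteq> 0"
  using sg_square[of u v] by (metis mult_zero_left zero_neq_one)

text \<open>For disjoint sets each pair is an inversion in exactly one of the two orders, so the two
  signs multiply to (-1)^(|u||v|); as signs square to 1, one of them can be moved across.\<close>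

lemma sg_flip:
  assumes "finite u" "finite v" "u \<inter> v = {}"
  shows "sg v u = (-1) ^ (card u * card v) * (sg u v :: 'a::comm_ring_1)"
proof -
  have "sg v u * sg u v = (\<Prod>i\<in>u. \<Prod>j\<in>v. -1 :: 'a)"
    unfolding sg_def by (subst prod.swap, unfold prod.distrib[symmetric], intro prod.cong refl)
      (use assms in \<open>auto simp: not_less\<close>)
  also have "\<dots> = (-1) ^ (card u * card v)"
    by (simp add: power_mult mult.commute[of "card u"])
  finally have "sg v u * sg u v * sg u v = (-1) ^ (card u * card v) * (sg u v :: 'a)" by simp
  then show ?thesis by (simp add: mult.assoc sg_square)
qed

lemma sg_insert_left: "finite u \<Longrightarrow> r \<notin> u \<Longrightarrow> sg (insert r u) v = sg {r} v * (sg u v :: 'a::comm_ring_1)"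
  by (simp add: sg_def)

lemma sg_insert_right: "finite v \<Longrightarrow> r \<notin> v \<Longrightarrow> sg u (insert r v) = sg u {r} * (sg u v :: 'a::comm_ring_1)"
  by (simp add: sg_def prod.distrib)

lemma unitv_apply: "unitv a c = (if c = a then 1 else 0)"
  by (simp add: unitv_def)

section \<open>The divided power superalgebra in coordinates\<close>

locale even_witt =
  fixes p m n :: nat and t :: "nat \<Rightarrow> nat" and F :: "'a::field itself"
  assumes prime_p: "prime p" and p_gt: "p > 3" and char_p: "CHAR('a) = p"
    and m_ge: "m \<ge> 3" and n_ge: "n \<ge> 3" and t_ge: "i \<in> Y0 m \<Longrightarrow> t i \<ge> 1"
begin

abbreviation A where "A \<equiv> Abasis p m n t"
abbreviation AI where "AI \<equiv> Aidx p m t"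

abbreviation mul :: "(amon \<Rightarrow> 'a) \<Rightarrow> (amon \<Rightarrow> 'a) \<Rightarrow> amon \<Rightarrow> 'a" (infixl "\<star>" 70) where
  "f \<star> g \<equiv> amul p m n t f g"

abbreviation D :: "nat \<Rightarrow> (amon \<Rightarrow> 'a) \<Rightarrow> amon \<Rightarrow> 'a" where
  "D \<equiv> dapply p m n t"

definition inA :: "(amon \<Rightarrow> 'a) \<Rightarrow> bool" where
  "inA f \<longleftrightarrow> (\<forall>c. c \<notin> A \<longrightarrow> f c = 0)"

definition bin :: "(nat \<Rightarrow> nat) \<Rightarrow> (nat \<Rightarrow> nat) \<Rightarrow> 'a" where
  "bin \<alpha> \<beta> = (\<Prod>i\<in>Y0 m. of_nat ((\<alpha> i + \<beta> i) choose \<alpha> i))"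

lemma of_nat_eq_0_iff_p: "(of_nat k :: 'a) = 0 \<longleftrightarrow> p dvd k"
  using char_p of_nat_eq_0_iff_char_dvd by metis

lemma finite_Y [simp]: "finite (Y0 m)" "finite (Y1 m n)" "finite (Yall m n)"
  by (auto simp: Y0_def Y1_def Yall_def)

lemma Y0_Y1_disj: "r \<in> Y0 m \<Longrightarrow> r \<in> Y1 m n \<Longrightarrow> False"
  by (auto simp: Y0_def Y1_def)

lemma Yall_iff: "r \<in> Yall m n \<longleftrightarrow> r \<in> Y0 m \<or> r \<in> Y1 m n"
  by (auto simp: Yall_def)

lemma finite_AI [simp]: "finite AI"
proof -
  have "AI \<subseteq> {f. \<forall>x. (x \<in> Y0 m \<longrightarrow> f x \<in> {0..Max ((\<lambda>i. p ^ t i) ` Y0 m)}) \<and> (x \<notin> Y0 m \<longrightarrow> f x = 0)}"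
  proof (clarsimp simp: Aidx_def)
    fix f x assume *: "\<forall>i\<in>Y0 m. f i \<le> p ^ t i - Suc 0" "x \<in> Y0 m"
    then have "f x \<le> p ^ t x" by (meson diff_le_self le_trans)
    also have "\<dots> \<le> Max ((\<lambda>i. p ^ t i) ` Y0 m)" using *(2) by (intro Max_ge) auto
    finally show "f x \<le> Max ((\<lambda>i. p ^ t i) ` Y0 m)" .
  qed
  then show ?thesis
    by (rule finite_subset) (rule finite_set_of_finite_funs, auto)
qed

lemma finite_A [simp]: "finite A"
proof -
  have "A \<subseteq> AI \<times> Pow (Y1 m n)" by (auto simp: Abasis_def)
  then show ?thesis by (rule finite_subset) auto
qed

lemma A_iff: "(\<alpha>, u) \<in> A \<longleftrightarrow> \<alpha> \<in> AI \<and> u \<subseteq> Y1 m n"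
  by (simp add: Abasis_def)

lemma finite_sub_Y1: "u \<subseteq> Y1 m n \<Longrightarrow> finite u"
  using finite_Y finite_subset by blast

lemma AI_less: "\<alpha> \<in> AI \<Longrightarrow> i \<in> Y0 m \<Longrightarrow> \<alpha> i < p ^ t i"
  using prime_gt_0_nat[OF prime_p] by (auto simp: Aidx_def intro: le_less_trans[of _ "p ^ t i - 1"])

lemma AI_I: "(\<And>i. i \<notin> Y0 m \<Longrightarrow> \<alpha> i = 0) \<Longrightarrow> (\<And>i. i \<in> Y0 m \<Longrightarrow> \<alpha> i < p ^ t i) \<Longrightarrow> \<alpha> \<in> AI"
  by (fastforce simp: Aidx_def)

lemma AI_iff: "\<alpha> \<in> AI \<longleftrightarrow> (\<forall>i. i \<notin> Y0 m \<longrightarrow> \<alpha> i = 0) \<and> (\<forall>i\<in>Y0 m. \<alpha> i < p ^ t i)"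
  using AI_I AI_less by (auto simp: Aidx_def)

lemma AI_mono: "\<alpha> \<in> AI \<Longrightarrow> (\<And>i. \<beta> i \<le> \<alpha> i) \<Longrightarrow> \<beta> \<in> AI"
  unfolding AI_iff by (metis le_zero_eq order_le_less_trans)

lemma zero_AI [simp]: "(\<lambda>_. 0) \<in> AI"
  using prime_p by (auto simp: AI_iff prime_gt_0_nat)

lemma bin_overflow:
  assumes "\<alpha> \<in> AI" "\<beta> \<in> AI" "(\<lambda>i. \<alpha> i + \<beta> i) \<notin> AI"
  shows "bin \<alpha> \<beta> = 0"
proof -
  obtain i where i: "i \<in> Y0 m" "\<alpha> i + \<beta> i \<ge> p ^ t i"
    using assms by (auto simp: AI_iff not_less)
  then have "p dvd ((\<alpha> i + \<beta> i) choose \<alpha> i)"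
    using assms AI_less prime_p by (intro prime_dvd_choose_overflow) auto
  then show ?thesis
    unfolding bin_def using i of_nat_eq_0_iff_p by (intro prod_zero) auto
qed

lemma amul_mon_eq:
  assumes "(\<alpha>, u) \<in> A" "(\<beta>, v) \<in> A"
  shows "(amul_mon p m t (\<alpha>, u) (\<beta>, v) c :: 'a) =
    (if u \<inter> v = {} then bin \<alpha> \<beta> * sg u v * unitv (\<lambda>i. \<alpha> i + \<beta> i, u \<union> v) c else 0)"
proof -
  obtain \<gamma> w where c: "c = (\<gamma>, w)" by (cases c)
  have "finite u" "finite v" using assms A_iff finite_sub_Y1 by auto
  from minus_one_power_inversions[OF this] show ?thesis
    using bin_overflow[of \<alpha> \<beta>] assms by (auto simp: c amul_mon_def unitv_apply bin_def[symmetric] A_iff)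
qed

lemma amul_expand_left: "f \<star> g = (\<lambda>c. \<Sum>a\<in>A. f a * (unitv a \<star> g) c)"
proof
  fix c
  have "(unitv a \<star> g) c = (\<Sum>b\<in>A. g b * amul_mon p m t a b c)" if "a \<in> A" for a
  proof -
    have "(unitv a \<star> g) c = (\<Sum>a'\<in>A. if a' = a then (\<Sum>b\<in>A. g b * amul_mon p m t a' b c) else 0)"
      unfolding amul_def by (rule sum.cong) (auto simp: unitv_apply)
    then show ?thesis using that by simp
  qed
  then show "(f \<star> g) c = (\<Sum>a\<in>A. f a * (unitv a \<star> g) c)"
    by (auto simp: amul_def sum_distrib_left mult.assoc intro!: sum.cong)
qed

lemma amul_expand_right: "f \<star> g = (\<lambda>c. \<Sum>b\<in>A. g b * (f \<star> unitv b) c)"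
proof
  fix c
  have "(f \<star> unitv b) c = (\<Sum>a\<in>A. f a * amul_mon p m t a b c)" if "b \<in> A" for b
  proof -
    have "(f \<star> unitv b) c = (\<Sum>a\<in>A. \<Sum>b'\<in>A. if b' = b then f a * amul_mon p m t a b' c else 0)"
      unfolding amul_def by (intro sum.cong refl) (auto simp: unitv_apply)
    then show ?thesis using that by simp
  qed
  then have "(\<Sum>b\<in>A. g b * (f \<star> unitv b) c) = (\<Sum>b\<in>A. \<Sum>a\<in>A. f a * g b * amul_mon p m t a b c)"
    by (auto simp: sum_distrib_left mult_ac intro!: sum.cong)
  also have "\<dots> = (f \<star> g) c" unfolding amul_def by (rule sum.swap)
  finally show "(f \<star> g) c = (\<Sum>b\<in>A. g b * (f \<star> unitv b) c)" by simp
qed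

lemma dapply_expand: "D r f = (\<lambda>c. \<Sum>a\<in>A. f a * D r (unitv a) c)"
proof
  fix c
  have "D r (unitv a) c = Dmon m r a c" if "a \<in> A" for a
  proof -
    have "D r (unitv a) c = (\<Sum>a'\<in>A. if a' = a then Dmon m r a' c else 0)"
      unfolding dapply_def by (rule sum.cong) (auto simp: unitv_apply)
    then show ?thesis using that by simp
  qed
  then show "D r f c = (\<Sum>a\<in>A. f a * D r (unitv a) c)"
    by (auto simp: dapply_def intro!: sum.cong)
qed

lemma amul_lin_left:
  "(\<lambda>c. \<Sum>i\<in>I. k i * h i c) \<star> g = (\<lambda>c. \<Sum>i\<in>I. k i * (h i \<star> g) c)"
proof
  fix c
  have "((\<lambda>c. \<Sum>i\<in>I. k i * h i c) \<star> g) c = (\<Sum>a\<in>A. \<Sum>b\<in>A. \<Sum>i\<in>I. k i * h i a * g b * amul_mon p m t a b c)"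
    by (simp add: amul_def sum_distrib_right)
  also have "\<dots> = (\<Sum>a\<in>A. \<Sum>i\<in>I. \<Sum>b\<in>A. k i * h i a * g b * amul_mon p m t a b c)"
    by (rule sum.cong[OF refl], rule sum.swap)
  also have "\<dots> = (\<Sum>i\<in>I. \<Sum>a\<in>A. \<Sum>b\<in>A. k i * h i a * g b * amul_mon p m t a b c)"
    by (rule sum.swap)
  finally show "((\<lambda>c. \<Sum>i\<in>I. k i * h i c) \<star> g) c = (\<Sum>i\<in>I. k i * (h i \<star> g) c)"
    by (simp add: amul_def sum_distrib_left mult.assoc)
qed

lemma amul_lin_right:
  "f \<star> (\<lambda>c. \<Sum>i\<in>I. k i * h i c) = (\<lambda>c. \<Sum>i\<in>I. k i * (f \<star> h i) c)"
proof
  fix c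
  have "(f \<star> (\<lambda>c. \<Sum>i\<in>I. k i * h i c)) c = (\<Sum>a\<in>A. \<Sum>b\<in>A. \<Sum>i\<in>I. f a * (k i * h i b) * amul_mon p m t a b c)"
    by (simp add: amul_def sum_distrib_right sum_distrib_left)
  also have "\<dots> = (\<Sum>a\<in>A. \<Sum>i\<in>I. \<Sum>b\<in>A. f a * (k i * h i b) * amul_mon p m t a b c)"
    by (rule sum.cong[OF refl], rule sum.swap)
  also have "\<dots> = (\<Sum>i\<in>I. \<Sum>a\<in>A. \<Sum>b\<in>A. f a * (k i * h i b) * amul_mon p m t a b c)"
    by (rule sum.swap)
  finally show "(f \<star> (\<lambda>c. \<Sum>i\<in>I. k i * h i c)) c = (\<Sum>i\<in>I. k i * (f \<star> h i) c)"
    by (simp add: amul_def sum_distrib_left mult_ac)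
qed

lemma dapply_lin:
  "D r (\<lambda>c. \<Sum>i\<in>I. k i * h i c) = (\<lambda>c. \<Sum>i\<in>I. k i * D r (h i) c)"
proof
  fix c
  have "D r (\<lambda>c. \<Sum>i\<in>I. k i * h i c) c = (\<Sum>a\<in>A. \<Sum>i\<in>I. k i * h i a * Dmon m r a c)"
    by (simp add: dapply_def sum_distrib_right)
  also have "\<dots> = (\<Sum>i\<in>I. \<Sum>a\<in>A. k i * h i a * Dmon m r a c)"
    by (rule sum.swap)
  finally show "D r (\<lambda>c. \<Sum>i\<in>I. k i * h i c) c = (\<Sum>i\<in>I. k i * D r (h i) c)"
    by (simp add: dapply_def sum_distrib_left mult.assoc)
qed

lemma amul_scale_left [simp]: "(\<lambda>c. k * f c) \<star> g = (\<lambda>c. k * (f \<star> g) c)"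
  using amul_lin_left[of "\<lambda>_. k" "\<lambda>_. f" "{()}" g] by simp

lemma amul_scale_right [simp]: "f \<star> (\<lambda>c. k * g c) = (\<lambda>c. k * (f \<star> g) c)"
  using amul_lin_right[of f "\<lambda>_. k" "\<lambda>_. g" "{()}"] by simp

lemma dapply_scale [simp]: "D r (\<lambda>c. k * f c) = (\<lambda>c. k * D r f c)"
  using dapply_lin[of r "\<lambda>_. k" "\<lambda>_. f" "{()}"] by simp

lemma amul_zero [simp]: "(\<lambda>c. 0) \<star> g = (\<lambda>c. 0)" "f \<star> (\<lambda>c. 0) = (\<lambda>c. 0)"
  by (simp_all add: amul_def)

lemma dapply_zero [simp]: "D r (\<lambda>c. 0) = (\<lambda>c. 0)"
  by (simp add: dapply_def)

lemma amul_diff: 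
  "(\<lambda>c. f c - f' c) \<star> g = (\<lambda>c. (f \<star> g) c - (f' \<star> g) c)"
  "f \<star> (\<lambda>c. g c - g' c) = (\<lambda>c. (f \<star> g) c - (f \<star> g') c)"
  by (simp_all add: amul_def algebra_simps sum_subtractf)

lemma dapply_diff: "D r (\<lambda>c. g c - g' c) = (\<lambda>c. D r g c - D r g' c)"
  by (simp add: dapply_def algebra_simps sum_subtractf)

lemma inA_expand: "inA f \<Longrightarrow> f = (\<lambda>c. \<Sum>a\<in>A. f a * unitv a c)"
proof
  fix c assume f: "inA f"
  have "(\<Sum>a\<in>A. f a * unitv a c) = (\<Sum>a\<in>A. if a = c then f a else 0)"
    by (intro sum.cong refl) (auto simp: unitv_apply)
  then show "f c = (\<Sum>a\<in>A. f a * unitv a c)" using f unfolding inA_def by (cases "c \<in> A") (simp_all del: split_paired_All)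
qed

lemma mul_unitv:
  assumes "(\<alpha>, u) \<in> A" "(\<beta>, v) \<in> A"
  shows "unitv (\<alpha>, u) \<star> unitv (\<beta>, v) = (\<lambda>c. (if u \<inter> v = {} then bin \<alpha> \<beta> * sg u v else 0)
     * unitv (\<lambda>i. \<alpha> i + \<beta> i, u \<union> v) c)"
proof
  fix c
  have "(unitv (\<alpha>, u) \<star> unitv (\<beta>, v)) c
     = (\<Sum>a\<in>A. \<Sum>b\<in>A. if b = (\<beta>, v) then (if a = (\<alpha>, u) then amul_mon p m t a b c else 0) else 0)"
    unfolding amul_def by (intro sum.cong refl) (auto simp: unitv_apply)
  also have "\<dots> = amul_mon p m t (\<alpha>, u) (\<beta>, v) c" using assms by simp
  finally show "(unitv (\<alpha>, u) \<star> unitv (\<beta>, v)) c = (if u \<inter> v = {} then bin \<alpha> \<beta> * sg u v else 0)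
     * unitv (\<lambda>i. \<alpha> i + \<beta> i, u \<union> v) c"
    using amul_mon_eq[OF assms, of c] by simp
qed

text \<open>Divided powers make D_r an index shift without any scalar. When the raised index leaves
  the basis, \<open>inA\<close> supplies the value 0, so no case distinction is needed.\<close>

lemma D_Y0:
  assumes "inA f" "r \<in> Y0 m"
  shows "D r f (\<gamma>, w) = f (\<gamma>(r := Suc (\<gamma> r)), w)"
proof -
  have "D r f (\<gamma>, w) = (\<Sum>a\<in>A. if a = (\<gamma>(r := Suc (\<gamma> r)), w) then f a else 0)"
    unfolding dapply_def
  proof (rule sum.cong[OF refl])
    fix a assume "a \<in> A"
    obtain \<alpha> u where a: "a = (\<alpha>, u)" by (cases a)
    have e: "(1 \<le> \<alpha> r \<and> \<gamma> = \<alpha>(r := \<alpha> r - 1)) \<longleftrightarrow> \<alpha> = \<gamma>(r := Suc (\<gamma> r))"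
    proof
      assume "1 \<le> \<alpha> r \<and> \<gamma> = \<alpha>(r := \<alpha> r - 1)"
      then show "\<alpha> = \<gamma>(r := Suc (\<gamma> r))" by (intro ext) simp
    next
      assume "\<alpha> = \<gamma>(r := Suc (\<gamma> r))"
      then show "1 \<le> \<alpha> r \<and> \<gamma> = \<alpha>(r := \<alpha> r - 1)" by simp
    qed
    have "Dmon m r a (\<gamma>, w) = (if \<alpha> = \<gamma>(r := Suc (\<gamma> r)) \<and> w = u then 1 else (0::'a))"
      unfolding a Dmon_def e[symmetric] using assms(2) by (simp add: conj_assoc)
    then show "f a * Dmon m r a (\<gamma>, w) = (if a = (\<gamma>(r := Suc (\<gamma> r)), w) then f a else 0)"
      by (simp add: a)
  qed
  then show ?thesis using assms(1) by (simp add: inA_def)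
qed

text \<open>The power of -1 counting the elements of u below r is the sign
  \<open>sg {r} (u - {r})\<close> of moving x_r to the front.\<close>

lemma D_Y1:
  assumes "inA f" "r \<in> Y1 m n"
  shows "D r f (\<gamma>, w) = (if r \<notin> w then sg {r} w * f (\<gamma>, insert r w) else 0)"
proof -
  have "D r f (\<gamma>, w) = (\<Sum>a\<in>A. if a = (\<gamma>, insert r w) then (if r \<notin> w then sg {r} w * f a else 0) else 0)"
    unfolding dapply_def
  proof (rule sum.cong[OF refl])
    fix a assume aA: "a \<in> A"
    obtain \<alpha> u where a: "a = (\<alpha>, u)" by (cases a)
    have fu: "finite u" using aA a A_iff finite_sub_Y1 by auto
    have sg: "(-1) ^ card {j \<in> u. j < r} = (sg {r} (u - {r}) :: 'a)"
    proof -
      have e: "{j \<in> u. j < r} = {j \<in> u - {r}. j < r}" by auto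
      show ?thesis using fu prod.inter_filter[of "u - {r}" "\<lambda>_. - 1 :: 'a" "\<lambda>j. j < r"]
        unfolding sg_def e by simp
    qed
    have e: "r \<in> u \<and> w = u - {r} \<longleftrightarrow> u = insert r w \<and> r \<notin> w" by blast
    have "Dmon m r a (\<gamma>, w) = (if (r \<in> u \<and> w = u - {r}) \<and> \<gamma> = \<alpha> then (-1) ^ card {j \<in> u. j < r} else (0::'a))"
      unfolding a Dmon_def using assms(2) Y0_Y1_disj by auto
    also have "\<dots> = (if (u = insert r w \<and> r \<notin> w) \<and> \<gamma> = \<alpha> then sg {r} w else 0)"
      unfolding e sg by (intro if_cong refl) simp
    finally show "f a * Dmon m r a (\<gamma>, w) = (if a = (\<gamma>, insert r w) then (if r \<notin> w then sg {r} w * f a else 0) else 0)"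
      by (auto simp: a)
  qed
  then show ?thesis using assms(1) by (simp add: inA_def)
qed

lemma inA_zero [simp]: "inA (\<lambda>c. 0)"
  by (simp add: inA_def)

lemma inA_unitv: "a \<in> A \<Longrightarrow> inA (unitv a)"
  by (auto simp: inA_def unitv_apply)

lemma inA_scale: "inA f \<Longrightarrow> inA (\<lambda>c. k * f c)"
  by (simp add: inA_def)

lemma inA_sum: "(\<And>i. i \<in> I \<Longrightarrow> inA (h i)) \<Longrightarrow> inA (\<lambda>c. \<Sum>i\<in>I. k i * h i c)"
  by (simp add: inA_def)

text \<open>\<open>of_bool\<close> guards the truncated subtraction: for \<alpha> r = 0 the updated
  exponent would be \<alpha> again.\<close>

lemma D_unitv_Y0:
  assumes "(\<alpha>, u) \<in> A" "r \<in> Y0 m"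
  shows "D r (unitv (\<alpha>, u)) = (\<lambda>c. of_bool (\<alpha> r \<noteq> 0) * unitv (\<alpha>(r := \<alpha> r - 1), u) c)"
proof
  fix c show "D r (unitv (\<alpha>, u)) c = of_bool (\<alpha> r \<noteq> 0) * unitv (\<alpha>(r := \<alpha> r - 1), u) c"
    using assms D_Y0[OF inA_unitv[OF assms(1)] assms(2), of "fst c" "snd c"]
    by (cases c) (auto simp: unitv_apply fun_eq_iff)
qed

lemma D_unitv_Y1:
  assumes "(\<alpha>, u) \<in> A" "r \<in> Y1 m n"
  shows "D r (unitv (\<alpha>, u)) = (\<lambda>c. of_bool (r \<in> u) * sg {r} (u - {r}) * unitv (\<alpha>, u - {r}) c)"
proof
  fix c show "D r (unitv (\<alpha>, u)) c = of_bool (r \<in> u) * sg {r} (u - {r}) * unitv (\<alpha>, u - {r}) c"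
    using assms D_Y1[OF inA_unitv[OF assms(1)] assms(2), of "fst c" "snd c"]
    by (cases c) (auto simp: unitv_apply)
qed

lemma sub_A: "(\<alpha>, u) \<in> A \<Longrightarrow> (\<alpha>(r := \<alpha> r - k), u) \<in> A"
  unfolding A_iff using AI_mono[of \<alpha> "\<alpha>(r := \<alpha> r - k)"] by auto

lemma inA_D: assumes "r \<in> Yall m n" shows "inA (D r f)"
proof -
  have "inA (D r (unitv a))" if "a \<in> A" for a
  proof -
    obtain \<alpha> u where a: "a = (\<alpha>, u)" by (cases a)
    show ?thesis
    proof (cases "r \<in> Y0 m")
      case True
      then show ?thesis using that sub_A[of \<alpha> u r 1] unfolding a
        by (subst D_unitv_Y0) (auto intro!: inA_scale inA_unitv)
    next
      case False
      then have "r \<in> Y1 m n" using assms by (simp add: Yall_iff)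
      moreover have "(\<alpha>, u - {r}) \<in> A" using that by (auto simp: a A_iff)
      ultimately show ?thesis using that unfolding a
        by (subst D_unitv_Y1) (auto intro!: inA_scale inA_unitv)
    qed
  qed
  then show ?thesis by (subst dapply_expand) (rule inA_sum)
qed

text \<open>Lets a product be multiplied or differentiated once more: the rules for
  \<open>unitv\<close> demand basis monomials, and where the product is none, its coefficient is
  already 0.\<close>

lemma add_A: "(\<alpha>, u) \<in> A \<Longrightarrow> (\<beta>, v) \<in> A \<Longrightarrow> (\<lambda>i. \<alpha> i + \<beta> i, u \<union> v) \<in> A \<or> bin \<alpha> \<beta> = 0"
  using bin_overflow by (auto simp: A_iff)

lemma inA_mul: "inA (f \<star> g)"
proof -
  have "inA (unitv a \<star> unitv b)" if "a \<in> A" "b \<in> A" for a b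
  proof -
    obtain \<alpha> u \<beta> v where ab: "a = (\<alpha>, u)" "b = (\<beta>, v)" by (cases a, cases b)
    show ?thesis
      using that add_A[of \<alpha> u \<beta> v] mul_unitv[of \<alpha> u \<beta> v]
      by (auto simp: ab inA_def unitv_apply)
  qed
  then have "inA (unitv a \<star> g)" if "a \<in> A" for a
    by (subst amul_expand_right) (rule inA_sum, use that in blast)
  then show ?thesis
    by (subst amul_expand_left) (rule inA_sum, blast)
qed

section \<open>Multiplication and partial derivatives\<close>

text \<open>Coordinate by coordinate both sides are the trinomial coefficient (a+b+c)! / (a! b!
  c!).\<close>

lemma bin_assoc: "bin \<alpha> \<beta> * bin (\<lambda>i. \<alpha> i + \<beta> i) \<gamma> = bin \<beta> \<gamma> * bin \<alpha> (\<lambda>i. \<beta> i + \<gamma> i)"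
proof -
  have "((a + b) choose a) * ((a + b + c) choose (a + b)) = ((b + c) choose b) * ((a + (b + c)) choose a)" for a b c :: nat
    using choose_mult[of a "a + b" "a + b + c"] by (simp add: mult.commute add.assoc)
  then have "of_nat ((a + b) choose a) * of_nat ((a + b + c) choose (a + b))
      = (of_nat ((b + c) choose b) * of_nat ((a + (b + c)) choose a) :: 'a)" for a b c :: nat
    by (metis of_nat_mult)
  then show ?thesis unfolding bin_def prod.distrib[symmetric] by (intro prod.cong refl)
qed

lemma bin_commute: "bin \<alpha> \<beta> = bin \<beta> \<alpha>"
  unfolding bin_def by (intro prod.cong refl) (metis add.commute binomial_symmetric add_diff_cancel_left' le_add1)

lemma mul_assoc_unitv:
  assumes "a \<in> A" "b \<in> A" "c \<in> A"
  shows "(unitv a \<star> unitv b) \<star> unitv c = unitv a \<star> (unitv b \<star> unitv c)"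
proof -
  obtain \<alpha> u \<beta> v \<gamma> w where abc: "a = (\<alpha>, u)" "b = (\<beta>, v)" "c = (\<gamma>, w)" by (cases a, cases b, cases c)
  note A = assms[unfolded abc]
  have fin: "finite u" "finite v" "finite w" using A by (auto simp: A_iff finite_sub_Y1)
  have L: "(unitv a \<star> unitv b) \<star> unitv c = (\<lambda>d. (if u \<inter> v = {} \<and> (u \<union> v) \<inter> w = {} then
      bin \<alpha> \<beta> * bin (\<lambda>i. \<alpha> i + \<beta> i) \<gamma> * (sg u v * sg u w * sg v w) else 0) * unitv (\<lambda>i. \<alpha> i + \<beta> i + \<gamma> i, u \<union> v \<union> w) d)"
  proof (cases "bin \<alpha> \<beta> = 0")
    case True
    then show ?thesis unfolding abc mul_unitv[OF A(1,2)] by (auto simp: fun_eq_iff)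
  next
    case False
    then have "(\<lambda>i. \<alpha> i + \<beta> i, u \<union> v) \<in> A" using add_A[OF A(1,2)] by simp
    from mul_unitv[OF this A(3)] show ?thesis
      unfolding abc mul_unitv[OF A(1,2)] by (auto simp: fun_eq_iff sg_Un_left fin)
  qed
  have R: "unitv a \<star> (unitv b \<star> unitv c) = (\<lambda>d. (if v \<inter> w = {} \<and> u \<inter> (v \<union> w) = {} then
      bin \<beta> \<gamma> * bin \<alpha> (\<lambda>i. \<beta> i + \<gamma> i) * (sg u v * sg u w * sg v w) else 0) * unitv (\<lambda>i. \<alpha> i + (\<beta> i + \<gamma> i), u \<union> (v \<union> w)) d)"
  proof (cases "bin \<beta> \<gamma> = 0")
    case True
    then show ?thesis unfolding abc mul_unitv[OF A(2,3)] by (auto simp: fun_eq_iff)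
  next
    case False
    then have "(\<lambda>i. \<beta> i + \<gamma> i, v \<union> w) \<in> A" using add_A[OF A(2,3)] by simp
    from mul_unitv[OF A(1) this] show ?thesis
      unfolding abc mul_unitv[OF A(2,3)] by (auto simp: fun_eq_iff sg_Un_right fin)
  qed
  have "(u \<inter> v = {} \<and> (u \<union> v) \<inter> w = {}) = (v \<inter> w = {} \<and> u \<inter> (v \<union> w) = {})" by blast
  then show ?thesis unfolding L R bin_assoc by (simp add: Un_assoc add.assoc)
qed

lemma mul_assoc: "(f \<star> g) \<star> h = f \<star> (g \<star> h)"
proof -
  have 1: "(unitv a \<star> unitv b) \<star> h = unitv a \<star> (unitv b \<star> h)" if "a \<in> A" "b \<in> A" for a b h
    using that by (simp add: amul_expand_right[of _ h] amul_lin_right mul_assoc_unitv cong: sum.cong)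
  have 2: "(unitv a \<star> g) \<star> h = unitv a \<star> (g \<star> h)" if "a \<in> A" for a g h
  proof -
    have "(unitv a \<star> g) \<star> h = (\<lambda>c. \<Sum>b\<in>A. g b * ((unitv a \<star> unitv b) \<star> h) c)"
      unfolding amul_expand_right[of "unitv a" g] amul_lin_left ..
    also have "\<dots> = (\<lambda>c. \<Sum>b\<in>A. g b * (unitv a \<star> (unitv b \<star> h)) c)"
      using 1 that by (simp cong: sum.cong)
    also have "\<dots> = unitv a \<star> (g \<star> h)"
      unfolding amul_expand_left[of g h] amul_lin_right ..
    finally show ?thesis .
  qed
  have "(f \<star> g) \<star> h = (\<lambda>c. \<Sum>a\<in>A. f a * ((unitv a \<star> g) \<star> h) c)"
    unfolding amul_expand_left[of f g] amul_lin_left ..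
  also have "\<dots> = (\<lambda>c. \<Sum>a\<in>A. f a * (unitv a \<star> (g \<star> h)) c)"
    using 2 by (simp cong: sum.cong)
  also have "\<dots> = f \<star> (g \<star> h)"
    unfolding amul_expand_left[of f "g \<star> h"] ..
  finally show ?thesis .
qed

text \<open>The twist records the sign picked up when an element of parity \<open>\<tau> r\<close> is moved past \<open>f\<close>;
  with it neither the commutation rule nor the Leibniz rule needs homogeneous elements.\<close>

definition tw :: "nat \<Rightarrow> (amon \<Rightarrow> 'a) \<Rightarrow> amon \<Rightarrow> 'a" where
  "tw r f = (\<lambda>c. (-1) ^ (tau m r * card (snd c)) * f c)"

lemma tw_lin: "tw r (\<lambda>c. \<Sum>i\<in>I. k i * h i c) = (\<lambda>c. \<Sum>i\<in>I. k i * tw r (h i) c)"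
  by (auto simp: tw_def fun_eq_iff sum_distrib_left intro!: sum.cong)

lemma tw_unitv: "tw r (unitv a) = (\<lambda>c. (-1) ^ (tau m r * card (snd a)) * unitv a c)"
  by (auto simp: tw_def unitv_apply fun_eq_iff)

lemma tw_Y0 [simp]: "r \<in> Y0 m \<Longrightarrow> tw r f = f"
  by (simp add: tw_def tau_def)

text \<open>Stated as evenness of a sum, so that k may be any natural number, such as
  \<open>k + l\<close> for a product, without reduction modulo 2. The zero function has every
  parity.\<close>

definition parity :: "nat \<Rightarrow> (amon \<Rightarrow> 'a) \<Rightarrow> bool" where
  "parity k f \<longleftrightarrow> (\<forall>c. f c \<noteq> 0 \<longrightarrow> (card (snd c) + k) mod 2 = 0)"

lemma tau_simps: "r \<in> Y0 m \<Longrightarrow> tau m r = 0" "r \<in> Y1 m n \<Longrightarrow> tau m r = 1"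
  using Y0_Y1_disj by (auto simp: tau_def)

lemma minus_one_power_parity: "(card u + k) mod 2 = 0 \<Longrightarrow> (-1 :: 'a) ^ (card u * l) = (-1) ^ (k * l)"
  by (metis even_add even_iff_mod_2_eq_zero even_mult_iff neg_one_even_power neg_one_odd_power)

text \<open>Supercommutativity: exchanging x^u and x^v costs (-1)^(|u||v|), and |u| may be replaced
  by \<open>tau m r\<close> because f has that parity. The sign then depends only on r and the
  monomial of g, as in \<open>tw\<close>.\<close>

lemma mul_tw:
  assumes "parity (tau m r) f"
  shows "f \<star> tw r g = g \<star> f"
proof -
  have 1: "unitv a \<star> tw r (unitv b) = unitv b \<star> unitv a"
    if "a \<in> A" "b \<in> A" "(card (snd a) + tau m r) mod 2 = 0" for a b
  proof -
    obtain \<alpha> u \<beta> v where ab: "a = (\<alpha>, u)" "b = (\<beta>, v)" by (cases a, cases b)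
    have fin: "finite u" "finite v" using that ab by (auto simp: A_iff finite_sub_Y1)
    have s: "(-1 :: 'a) ^ (tau m r * card v) * sg u v = sg v u" if "u \<inter> v = {}"
      using sg_flip[OF fin that, where ?'a = 'a] minus_one_power_parity[of u "tau m r" "card v"] \<open>(card (snd a) + _) mod 2 = 0\<close> ab
      by simp
    have e: "(\<lambda>i. \<beta> i + \<alpha> i) = (\<lambda>i. \<alpha> i + \<beta> i)" "v \<union> u = u \<union> v" "v \<inter> u = u \<inter> v" by auto
    have A: "(\<alpha>, u) \<in> A" "(\<beta>, v) \<in> A" using that ab by auto
    show ?thesis
      unfolding tw_unitv ab amul_scale_right mul_unitv[OF A] mul_unitv[OF A(2,1)] e bin_commute[of \<beta>]
      using s by (auto simp: fun_eq_iff)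
  qed
  have 2: "f \<star> tw r (unitv b) = unitv b \<star> f" if "b \<in> A" for b
    unfolding amul_expand_left[of f] amul_expand_right[of _ f]
  proof (intro ext sum.cong refl)
    fix c a assume "a \<in> A"
    then show "f a * (unitv a \<star> tw r (unitv b)) c = f a * (unitv b \<star> unitv a) c"
      using 1[of a b] that assms[unfolded parity_def, rule_format, of a] by (cases "f a = 0") simp_all
  qed
  \<comment> \<open>g need not vanish off the basis, but \<open>amul\<close> reads its arguments on
    the basis only, so g may be replaced by its expansion there.\<close>
  have "f \<star> tw r g = f \<star> tw r (\<lambda>c. \<Sum>b\<in>A. g b * unitv b c)"
  proof -
    have "tw r g b = tw r (\<lambda>c. \<Sum>b\<in>A. g b * unitv b c) b" if "b \<in> A" for b
    proof -
      have "(\<Sum>a\<in>A. g a * unitv a b) = (\<Sum>a\<in>A. if a = b then g a else 0)"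
        by (intro sum.cong refl) (auto simp: unitv_apply)
      then show ?thesis using that by (simp add: tw_def)
    qed
    then show ?thesis unfolding amul_def by (simp cong: sum.cong)
  qed
  also have "\<dots> = (\<lambda>c. \<Sum>b\<in>A. g b * (f \<star> tw r (unitv b)) c)"
    unfolding tw_lin amul_lin_right ..
  also have "\<dots> = (\<lambda>c. \<Sum>b\<in>A. g b * (unitv b \<star> f) c)"
    using 2 by (simp cong: sum.cong)
  also have "\<dots> = g \<star> f" unfolding amul_expand_left[of g] ..
  finally show ?thesis .
qed

text \<open>Pascal's rule in coordinate r, the other coordinates forming the common factor P. It is
  the Leibniz rule of D_r on divided powers.\<close>

lemma bin_pascal:
  assumes "r \<in> Y0 m"
  shows "of_bool (\<alpha> r + \<beta> r \<noteq> 0) * bin \<alpha> \<beta>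
    = of_bool (\<alpha> r \<noteq> 0) * bin (\<alpha>(r := \<alpha> r - 1)) \<beta> + of_bool (\<beta> r \<noteq> 0) * bin \<alpha> (\<beta>(r := \<beta> r - 1))"
proof -
  define P :: 'a where "P = (\<Prod>i\<in>Y0 m - {r}. of_nat ((\<alpha> i + \<beta> i) choose \<alpha> i))"
  have b: "bin \<alpha>' \<beta>' = of_nat ((\<alpha>' r + \<beta>' r) choose \<alpha>' r) * P"
    if "\<And>i. i \<noteq> r \<Longrightarrow> \<alpha>' i = \<alpha> i" "\<And>i. i \<noteq> r \<Longrightarrow> \<beta>' i = \<beta> i" for \<alpha>' \<beta>'
    using that assms by (auto simp: bin_def P_def prod.remove[of _ r] intro!: prod.cong)
  have "of_bool (\<alpha> r + \<beta> r \<noteq> 0) * of_nat ((\<alpha> r + \<beta> r) choose \<alpha> r)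
      = of_bool (\<alpha> r \<noteq> 0) * of_nat ((\<alpha> r - 1 + \<beta> r) choose (\<alpha> r - 1)) + of_bool (\<beta> r \<noteq> 0) * (of_nat ((\<alpha> r + (\<beta> r - 1)) choose \<alpha> r) :: 'a)"
    by (cases "\<alpha> r"; cases "\<beta> r") (simp_all flip: of_nat_add)
  then show ?thesis by (simp add: b algebra_simps flip: distrib_right)
qed

lemma sg_swap_single:
  assumes "finite u" "r \<notin> u"
  shows "sg u {r} = (-1) ^ card u * (sg {r} u :: 'a)"
  using sg_flip[of "{r}" u] assms by simp

lemma leibniz_unitv:
  assumes r: "r \<in> Yall m n" and "a \<in> A" "b \<in> A"
  shows "D r (unitv a \<star> unitv b) = (\<lambda>c. (D r (unitv a) \<star> unitv b) c + (tw r (unitv a) \<star> D r (unitv b)) c)"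
proof -
  obtain \<alpha> u \<beta> v where ab: "a = (\<alpha>, u)" "b = (\<beta>, v)" by (cases a, cases b)
  note A = assms(2,3)[unfolded ab]
  let ?ab = "\<lambda>i. \<alpha> i + \<beta> i"
  have fin: "finite u" "finite v" using A by (auto simp: A_iff finite_sub_Y1)
  show ?thesis
  proof (cases "r \<in> Y0 m")
    case True
    have L: "D r (unitv a \<star> unitv b) = (\<lambda>c. (if u \<inter> v = {} then of_bool (\<alpha> r + \<beta> r \<noteq> 0) * bin \<alpha> \<beta> * sg u v else 0)
       * unitv (?ab(r := \<alpha> r + \<beta> r - 1), u \<union> v) c)"
    proof (cases "bin \<alpha> \<beta> = 0")
      case True
      then show ?thesis unfolding ab mul_unitv[OF A] by (auto simp: fun_eq_iff)
    next
      case False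
      then have "(?ab, u \<union> v) \<in> A" using add_A[OF A] by simp
      from D_unitv_Y0[OF this True] show ?thesis
        unfolding ab mul_unitv[OF A] by (auto simp: fun_eq_iff)
    qed
    have R1: "D r (unitv a) \<star> unitv b = (\<lambda>c. (if u \<inter> v = {} then of_bool (\<alpha> r \<noteq> 0) * bin (\<alpha>(r := \<alpha> r - 1)) \<beta> * sg u v else 0)
       * unitv (?ab(r := \<alpha> r + \<beta> r - 1), u \<union> v) c)"
    proof (cases "\<alpha> r = 0")
      case False
      then have e: "(\<lambda>i. (\<alpha>(r := \<alpha> r - 1)) i + \<beta> i) = ?ab(r := \<alpha> r + \<beta> r - 1)" by auto
      show ?thesis using False mul_unitv[OF sub_A[OF A(1)] A(2), of r 1] unfolding e
        by (simp add: ab D_unitv_Y0[OF A(1) True] fun_eq_iff)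
    qed (simp add: ab D_unitv_Y0[OF A(1) True])
    have R2: "unitv a \<star> D r (unitv b) = (\<lambda>c. (if u \<inter> v = {} then of_bool (\<beta> r \<noteq> 0) * bin \<alpha> (\<beta>(r := \<beta> r - 1)) * sg u v else 0)
       * unitv (?ab(r := \<alpha> r + \<beta> r - 1), u \<union> v) c)"
    proof (cases "\<beta> r = 0")
      case False
      then have e: "(\<lambda>i. \<alpha> i + (\<beta>(r := \<beta> r - 1)) i) = ?ab(r := \<alpha> r + \<beta> r - 1)" by auto
      show ?thesis using False mul_unitv[OF A(1) sub_A[OF A(2)], of r 1] unfolding e
        by (simp add: ab D_unitv_Y0[OF A(2) True] fun_eq_iff)
    qed (simp add: ab D_unitv_Y0[OF A(2) True])
    show ?thesis unfolding L R1 tw_Y0[OF True] R2 bin_pascal[OF True] 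
      by (auto simp: fun_eq_iff algebra_simps)
  next
    case False
    then have r1: "r \<in> Y1 m n" using r by (simp add: Yall_iff)
    have Au: "(\<alpha>, u - {r}) \<in> A" "(\<beta>, v - {r}) \<in> A" using A by (auto simp: A_iff)
    have L: "D r (unitv a \<star> unitv b) = (\<lambda>c. (if u \<inter> v = {} \<and> r \<in> u \<union> v then bin \<alpha> \<beta> * sg u v * sg {r} (u \<union> v - {r}) else 0)
       * unitv (?ab, u \<union> v - {r}) c)"
    proof (cases "bin \<alpha> \<beta> = 0")
      case True
      then show ?thesis unfolding ab mul_unitv[OF A] by (auto simp: fun_eq_iff)
    next
      case False
      then have "(?ab, u \<union> v) \<in> A" using add_A[OF A] by simp
      from D_unitv_Y1[OF this r1] show ?thesis
        unfolding ab mul_unitv[OF A] by (auto simp: fun_eq_iff)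
    qed
    have R1: "D r (unitv a) \<star> unitv b = (\<lambda>c. (if (u - {r}) \<inter> v = {} \<and> r \<in> u then bin \<alpha> \<beta> * sg {r} (u - {r}) * sg (u - {r}) v else 0)
       * unitv (?ab, (u - {r}) \<union> v) c)"
      using mul_unitv[OF Au(1) A(2)] by (auto simp: ab D_unitv_Y1[OF A(1) r1] fun_eq_iff)
    have R2: "tw r (unitv a) \<star> D r (unitv b) = (\<lambda>c. (if u \<inter> (v - {r}) = {} \<and> r \<in> v then (-1) ^ card u * bin \<alpha> \<beta> * sg {r} (v - {r}) * sg u (v - {r}) else 0)
       * unitv (?ab, u \<union> (v - {r})) c)"
      using mul_unitv[OF A(1) Au(2)] by (auto simp: ab D_unitv_Y1[OF A(2) r1] fun_eq_iff tw_unitv tau_simps r1)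
    consider (no) "r \<notin> u" "r \<notin> v" | (l) u' where "u = insert r u'" "r \<notin> u'" "r \<notin> v" "finite u'"
      | (rr) v' where "r \<notin> u" "v = insert r v'" "r \<notin> v'" "finite v'"
      | (both) u' v' where "u = insert r u'" "r \<notin> u'" "v = insert r v'" "r \<notin> v'" "finite u'" "finite v'"
    proof -
      have fin': "finite (u - {r})" "finite (v - {r})" using fin by auto
      show thesis
        using that(1) that(2)[OF _ _ _ fin'(1)] that(3)[OF _ _ _ fin'(2)] that(4)[OF _ _ _ _ fin']
        by (cases "r \<in> u"; cases "r \<in> v") (simp_all add: insert_absorb)
    qed
    then show ?thesis
    proof cases
      case no then show ?thesis unfolding L R1 R2 by simp
    next
      case l
      have 1: "sg {r} (u' \<union> v) = sg {r} u' * (sg {r} v :: 'a)" if "u' \<inter> v = {}"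
        using l fin that by (intro sg_Un_right) auto
      have e: "u - {r} = u'" "u \<union> v - {r} = u' \<union> v" "(u \<inter> v = {}) = (u' \<inter> v = {})" "r \<in> u" "r \<in> u \<union> v"
        using l by auto
      have "sg u v * sg {r} (u' \<union> v) = sg {r} u' * (sg u' v :: 'a) * (sg {r} v * sg {r} v)" if "u' \<inter> v = {}"
        unfolding 1[OF that] l(1) sg_insert_left[OF l(4,2)] by (simp only: mult_ac)
      then have 2: "sg u v * sg {r} (u' \<union> v) = sg {r} u' * (sg u' v :: 'a)" if "u' \<inter> v = {}"
        using that by (simp only: sg_square mult_1_right)
      have 3: "bin \<alpha> \<beta> * sg u v * sg {r} (u' \<union> v) = bin \<alpha> \<beta> * sg {r} u' * (sg u' v :: 'a)" if "u' \<inter> v = {}"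
        using 2[OF that] by (simp add: mult.assoc)
      show ?thesis unfolding L R1 R2 e by (simp add: 3 l(3))
    next
      case rr
      have 1: "sg {r} (u \<union> v') = sg {r} u * (sg {r} v' :: 'a)" if "u \<inter> v' = {}"
        using rr fin that by (intro sg_Un_right) auto
      have e: "v - {r} = v'" "u \<union> v - {r} = u \<union> v'" "(u \<inter> v = {}) = (u \<inter> v' = {})" "r \<in> v" "r \<in> u \<union> v"
        using rr by auto
      have "sg u v * sg {r} (u \<union> v') = (-1) ^ card u * sg {r} v' * (sg u v' :: 'a) * (sg {r} u * sg {r} u)" if "u \<inter> v' = {}"
        unfolding 1[OF that] rr(2) sg_insert_right[OF rr(4,3)] sg_swap_single[OF fin(1) rr(1)] by (simp only: mult_ac)
      then have 2: "sg u v * sg {r} (u \<union> v') = (-1) ^ card u * sg {r} v' * (sg u v' :: 'a)" if "u \<inter> v' = {}"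
        using that by (simp only: sg_square mult_1_right)
      have 3: "bin \<alpha> \<beta> * sg u v * sg {r} (u \<union> v') = (-1) ^ card u * bin \<alpha> \<beta> * sg {r} v' * (sg u v' :: 'a)" if "u \<inter> v' = {}"
        using 2[OF that] by (simp add: mult_ac)
      show ?thesis unfolding L R1 R2 e by (simp add: 3 rr(1))
    next
      \<comment> \<open>Here x^u x^v = 0 because both factors contain x_r, so the two summands on
        the right must cancel; their signs differ since |u| = |u'| + 1.\<close>
      case both
      have s1: "sg u' v = (sg u' {r} * sg u' v' :: 'a)" unfolding both(3) by (rule sg_insert_right[OF both(6,4)])
      have s2: "sg u v' = (sg {r} v' * sg u' v' :: 'a)" unfolding both(1) by (rule sg_insert_left[OF both(5,2)])
      have c: "card u = Suc (card u')" unfolding both(1) using both(5,2) by simp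
      have "sg {r} u' * sg u' v = (-1) ^ card u' * (sg {r} u' * sg {r} u') * (sg u' v' :: 'a)"
        unfolding s1 sg_swap_single[OF both(5,2)] by (simp only: mult_ac)
      moreover have "(-1) ^ card u * sg {r} v' * sg u v' = (-1) ^ card u * (sg {r} v' * sg {r} v') * (sg u' v' :: 'a)"
        unfolding s2 by (simp only: mult_ac)
      ultimately have "sg {r} u' * sg u' v = - ((-1) ^ card u * sg {r} v' * sg u v' :: 'a)"
        unfolding sg_square c by simp
      then have "bin \<alpha> \<beta> * (sg {r} u' * sg u' v) = bin \<alpha> \<beta> * - ((-1) ^ card u * sg {r} v' * sg u v' :: 'a)"
        by (simp only:)
      then have 3: "bin \<alpha> \<beta> * sg {r} u' * sg u' v = - ((-1) ^ card u * bin \<alpha> \<beta> * sg {r} v' * sg u v' :: 'a)"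
        by (simp only: mult_minus_right mult_ac)
      have e: "u - {r} = u'" "v - {r} = v'" "u' \<union> v = u \<union> v'" "(u' \<inter> v = {}) = (u' \<inter> v' = {})" "(u \<inter> v' = {}) = (u' \<inter> v' = {})" "u \<inter> v \<noteq> {}" "r \<in> u" "r \<in> v"
        using both by auto
      show ?thesis unfolding L R1 R2 e(1-5) by (simp add: 3 e(6-8))
    qed
  qed
qed

lemma amul_add:
  "(\<lambda>c. f c + f' c) \<star> g = (\<lambda>c. (f \<star> g) c + (f' \<star> g) c)"
  "f \<star> (\<lambda>c. g c + g' c) = (\<lambda>c. (f \<star> g) c + (f \<star> g') c)"
  by (simp_all add: amul_def algebra_simps sum.distrib)

lemma tw_expand: "inA f \<Longrightarrow> tw r f = (\<lambda>c. \<Sum>a\<in>A. f a * tw r (unitv a) c)"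
  using inA_expand[of f] tw_lin[of r f unitv A] by simp

lemma leibniz:
  assumes r: "r \<in> Yall m n" and f: "inA f"
  shows "D r (f \<star> g) = (\<lambda>c. (D r f \<star> g) c + (tw r f \<star> D r g) c)"
proof -
  have 1: "D r (unitv a \<star> g) = (\<lambda>c. (D r (unitv a) \<star> g) c + (tw r (unitv a) \<star> D r g) c)" if "a \<in> A" for a
    unfolding amul_expand_right[of _ g] dapply_expand[of r g] dapply_lin amul_lin_right
    by (simp add: leibniz_unitv[OF r that] distrib_left sum.distrib cong: sum.cong)
  show ?thesis
    unfolding amul_expand_left[of f g] dapply_expand[of r f] tw_expand[OF f] dapply_lin amul_lin_left
    by (simp add: 1 distrib_left sum.distrib cong: sum.cong)
qed

lemma D_commute:
  assumes r: "r \<in> Yall m n" and s: "s \<in> Yall m n" and f: "inA f"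
  shows "D r (D s f) = (\<lambda>c. (-1) ^ (tau m r * tau m s) * D s (D r f) c)"
proof
  fix c :: amon
  obtain \<gamma> w where c: "c = (\<gamma>, w)" by (cases c)
  have i: "inA (D r f)" "inA (D s f)" using inA_D r s by auto
  show "D r (D s f) c = (-1) ^ (tau m r * tau m s) * D s (D r f) c"
  proof (cases "r \<in> Y0 m"; cases "s \<in> Y0 m")
    assume *: "r \<in> Y0 m" "s \<in> Y0 m"
    then show ?thesis using f i by (cases "r = s") (simp_all add: c D_Y0 tau_def fun_upd_twist)
  next
    assume *: "r \<in> Y0 m" "s \<notin> Y0 m"
    then show ?thesis using f i s by (simp add: c D_Y0 D_Y1 Yall_iff tau_def)
  next
    assume *: "r \<notin> Y0 m" "s \<in> Y0 m"
    then show ?thesis using f i r by (simp add: c D_Y0 D_Y1 Yall_iff tau_def)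
  next
    assume *: "r \<notin> Y0 m" "s \<notin> Y0 m"
    then have rs: "r \<in> Y1 m n" "s \<in> Y1 m n" using r s by (auto simp: Yall_iff)
    have **: "D r (D s f) c = - D s (D r f) c" if "finite w"
    proof (cases "r = s")
      case True then show ?thesis using rs f i by (simp add: c D_Y1)
    next
      case False
      \<comment> \<open>For distinct odd indices exactly one of the two orders picks up the extra
        -1; this is the anticommutation.\<close>
      have ne: "sg {r} (insert s w) = (if s < r then -1 else 1) * (sg {r} w :: 'a)" if "s \<notin> w" for r s
        using that \<open>finite w\<close> by (simp add: sg_def)
      show ?thesis using False rs f i by (auto simp: c D_Y1 ne insert_commute)
    qed
    show ?thesis
    proof (cases "finite w")
      case True then show ?thesis using ** * by (simp add: tau_def)
    next
      case False
      \<comment> \<open>An infinite w carries no meaningful sign, but it indexes no basis monomial,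
        so both sides are 0.\<close>
      then have "(\<gamma>, w) \<notin> A" by (auto simp: A_iff finite_sub_Y1)
      then show ?thesis using inA_D[OF r] inA_D[OF s] unfolding c by (metis inA_def mult_zero_right)
    qed
  qed
qed

section \<open>The bracket of the even part\<close>

abbreviation B where "B \<equiv> Wbasis p m n t"
abbreviation G :: "(wmon \<Rightarrow> 'a) set" where "G \<equiv> Weven p m n t"
abbreviation Ya where "Ya \<equiv> Yall m n"
abbreviation br :: "(wmon \<Rightarrow> 'a) \<Rightarrow> (wmon \<Rightarrow> 'a) \<Rightarrow> wmon \<Rightarrow> 'a" where "br \<equiv> Wbr p m n t"

definition cf :: "(wmon \<Rightarrow> 'a) \<Rightarrow> nat \<Rightarrow> amon \<Rightarrow> 'a" where
  "cf X r = (\<lambda>a. X (fst a, snd a, r))"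

text \<open>X as an operator on the superalgebra. On \<open>G\<close> the bracket has the components
  \<open>act X (cf Y q)\<close> minus \<open>act Y (cf X q)\<close>, without signs, so Lie algebra
  identities reduce to identities between such operators.\<close>

definition act :: "(wmon \<Rightarrow> 'a) \<Rightarrow> (amon \<Rightarrow> 'a) \<Rightarrow> amon \<Rightarrow> 'a" where
  "act X f = (\<lambda>c. \<Sum>r\<in>Ya. (cf X r \<star> D r f) c)"

lemma cf_eqI: "(\<And>q. cf X q = cf Y q) \<Longrightarrow> X = Y"
proof
  fix d assume *: "\<And>q. cf X q = cf Y q"
  show "X d = Y d"
    using fun_cong[OF *[of "snd (snd d)"], of "(fst d, fst (snd d))"] by (simp add: cf_def)
qed

lemma mem_B: "(\<alpha>, u, r) \<in> B \<longleftrightarrow> (\<alpha>, u) \<in> A \<and> r \<in> Ya"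
  by (auto simp: Wbasis_def Abasis_def)

lemma G_iff: "X \<in> G \<longleftrightarrow> (\<forall>r\<in>Ya. inA (cf X r) \<and> parity (tau m r) (cf X r)) \<and> (\<forall>r. r \<notin> Ya \<longrightarrow> cf X r = (\<lambda>c. 0))"
  unfolding Weven_def inA_def parity_def cf_def wpar_def
  by (auto simp: mem_B fun_eq_iff) blast+

lemma G_cfD:
  assumes "X \<in> G"
  shows "inA (cf X r)" "parity (tau m r) (cf X r)" "r \<notin> Ya \<Longrightarrow> cf X r = (\<lambda>c. 0)"
  using assms unfolding G_iff by (cases "r \<in> Ya"; auto simp: parity_def)+

lemma finite_B [simp]: "finite B"
proof -
  have "B \<subseteq> AI \<times> (Pow (Y1 m n) \<times> Ya)" by (auto simp: Wbasis_def)
  then show ?thesis by (rule finite_subset) auto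
qed

lemma sum_B: "(\<Sum>b\<in>B. g b) = (\<Sum>r\<in>Ya. \<Sum>a\<in>A. g (fst a, snd a, r))"
proof -
  have "(\<Sum>r\<in>Ya. \<Sum>a\<in>A. g (fst a, snd a, r)) = (\<Sum>(r, a)\<in>Ya \<times> A. g (fst a, snd a, r))"
    by (simp add: sum.cartesian_product)
  also have "\<dots> = (\<Sum>b\<in>B. g b)"
    by (rule sum.reindex_bij_witness[of _ "\<lambda>b. (snd (snd b), (fst b, fst (snd b)))" "\<lambda>(r, a). (fst a, snd a, r)"])
      (auto simp: mem_B)
  finally show ?thesis by simp
qed

lemma sum_swap_pairs:
  "(\<Sum>r\<in>I. \<Sum>a\<in>J. \<Sum>s\<in>K. \<Sum>b\<in>L. h r a s b) = (\<Sum>s\<in>K. \<Sum>b\<in>L. \<Sum>r\<in>I. \<Sum>a\<in>J. (h r a s b :: 'a))"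
  using sum.swap[of "\<lambda>x y. h (fst x) (snd x) (fst y) (snd y)" "K \<times> L" "I \<times> J"]
  by (simp add: sum.cartesian_product')

lemma bbr_even:
  assumes "wpar m (fst a, snd a, r) = 0"
  shows "(bbr p m n t (fst a, snd a, r) (fst b, snd b, s) (\<gamma>, w, q) :: 'a) =
    (if q = s then (unitv a \<star> D r (unitv b)) (\<gamma>, w) else 0) - (if q = r then (unitv b \<star> D s (unitv a)) (\<gamma>, w) else 0)"
  using assms by (simp add: bbr_def)

lemma mul_D_expand: "(f \<star> D r g) c = (\<Sum>a\<in>A. \<Sum>b\<in>A. f a * g b * (unitv a \<star> D r (unitv b)) c)"
proof -
  have "(unitv a \<star> D r g) c = (\<Sum>b\<in>A. g b * (unitv a \<star> D r (unitv b)) c)" for a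
    unfolding dapply_expand[of r g] amul_lin_right ..
  then show ?thesis
    unfolding amul_expand_left[of f] by (simp add: sum_distrib_left mult.assoc)
qed

lemma act_cf_expand:
  assumes "Y \<in> G"
  shows "act X (cf Y q) (\<gamma>, w) = (\<Sum>r\<in>Ya. \<Sum>a\<in>A. \<Sum>s\<in>Ya. \<Sum>b\<in>A. X (fst a, snd a, r) * Y (fst b, snd b, s)
     * (if q = s then (unitv a \<star> D r (unitv b)) (\<gamma>, w) else 0))"
proof -
  have "(cf X r \<star> D r (cf Y q)) (\<gamma>, w) = (\<Sum>a\<in>A. \<Sum>s\<in>Ya. \<Sum>b\<in>A. X (fst a, snd a, r) * Y (fst b, snd b, s)
     * (if q = s then (unitv a \<star> D r (unitv b)) (\<gamma>, w) else 0))" for r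
    unfolding mul_D_expand[of "cf X r"]
  proof (rule sum.cong[OF refl])
    fix a assume "a \<in> A"
    have "(\<Sum>s\<in>Ya. \<Sum>b\<in>A. X (fst a, snd a, r) * Y (fst b, snd b, s) * (if q = s then (unitv a \<star> D r (unitv b)) (\<gamma>, w) else 0))
       = (\<Sum>s\<in>Ya. if s = q then \<Sum>b\<in>A. X (fst a, snd a, r) * Y (fst b, snd b, q) * (unitv a \<star> D r (unitv b)) (\<gamma>, w) else 0)"
      by (intro sum.cong[OF refl]) auto
    also have "\<dots> = (\<Sum>b\<in>A. cf X r a * cf Y q b * (unitv a \<star> D r (unitv b)) (\<gamma>, w))"
    proof (cases "q \<in> Ya")
      case True then show ?thesis by (simp add: cf_def)
    next
      case False
      then show ?thesis using G_cfD(3)[OF assms False] by simp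
    qed
    finally show "(\<Sum>b\<in>A. cf X r a * cf Y q b * (unitv a \<star> D r (unitv b)) (\<gamma>, w)) =
      (\<Sum>s\<in>Ya. \<Sum>b\<in>A. X (fst a, snd a, r) * Y (fst b, snd b, s) * (if q = s then (unitv a \<star> D r (unitv b)) (\<gamma>, w) else 0))" ..
  qed
  then show ?thesis by (simp add: act_def)
qed

text \<open>Wherever X has a nonzero coefficient the basis vector is even, so the sign in
  \<open>bbr\<close> is 1. The second half of the sum becomes \<open>act Y\<close> once the two
  pairs of summation indices are exchanged.\<close>

lemma cf_br:
  assumes X: "X \<in> G" and Y: "Y \<in> G"
  shows "cf (br X Y) q = (\<lambda>c. act X (cf Y q) c - act Y (cf X q) c)"
proof
  fix c :: amon
  obtain \<gamma> w where c: "c = (\<gamma>, w)" by (cases c)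
  let ?T = "\<lambda>r a s b. (if q = s then (unitv a \<star> D r (unitv b)) (\<gamma>, w) else 0)"
  have par: "wpar m (fst a, snd a, r) = 0 \<or> X (fst a, snd a, r) = 0" for a r
    using X by (auto simp: Weven_def)
  have e: "X (fst a, snd a, r) * Y (fst b, snd b, s) * bbr p m n t (fst a, snd a, r) (fst b, snd b, s) (\<gamma>, w, q) =
      X (fst a, snd a, r) * Y (fst b, snd b, s) * ?T r a s b - Y (fst b, snd b, s) * X (fst a, snd a, r) * ?T s b r a" for a b r s
  proof (cases "X (fst a, snd a, r) = 0")
    case False
    with par[of a r] have "wpar m (fst a, snd a, r) = 0" by blast
    from bbr_even[OF this, of b s \<gamma> w q] show ?thesis
      by (simp only: right_diff_distrib mult_ac)
  qed simp
  have "cf (br X Y) q c = (\<Sum>r\<in>Ya. \<Sum>a\<in>A. \<Sum>s\<in>Ya. \<Sum>b\<in>A. X (fst a, snd a, r) * Y (fst b, snd b, s) * bbr p m n t (fst a, snd a, r) (fst b, snd b, s) (\<gamma>, w, q))"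
    unfolding cf_def Wbr_def sum_B c by simp
  also have "\<dots> = (\<Sum>r\<in>Ya. \<Sum>a\<in>A. \<Sum>s\<in>Ya. \<Sum>b\<in>A. X (fst a, snd a, r) * Y (fst b, snd b, s) * ?T r a s b)
    - (\<Sum>r\<in>Ya. \<Sum>a\<in>A. \<Sum>s\<in>Ya. \<Sum>b\<in>A. Y (fst b, snd b, s) * X (fst a, snd a, r) * ?T s b r a)"
    unfolding e sum_subtractf ..
  also have "(\<Sum>r\<in>Ya. \<Sum>a\<in>A. \<Sum>s\<in>Ya. \<Sum>b\<in>A. Y (fst b, snd b, s) * X (fst a, snd a, r) * ?T s b r a)
    = (\<Sum>s\<in>Ya. \<Sum>b\<in>A. \<Sum>r\<in>Ya. \<Sum>a\<in>A. Y (fst b, snd b, s) * X (fst a, snd a, r) * ?T s b r a)"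
    by (rule sum_swap_pairs)
  finally show "cf (br X Y) q c = act X (cf Y q) c - act Y (cf X q) c"
    unfolding c act_cf_expand[OF X] act_cf_expand[OF Y] .
qed

lemma parity_mul:
  assumes "parity k f" "parity l g"
  shows "parity (k + l) (f \<star> g)"
  unfolding parity_def
proof (intro allI impI)
  fix c assume "(f \<star> g) c \<noteq> 0"
  then have "(\<Sum>a\<in>A. f a * (unitv a \<star> g) c) \<noteq> 0"
    by (simp add: fun_cong[OF amul_expand_left[of f g]])
  from sum.not_neutral_contains_not_neutral[OF this]
  obtain a where "a \<in> A" "f a * (unitv a \<star> g) c \<noteq> 0" .
  then have a: "a \<in> A" "f a \<noteq> 0" "(unitv a \<star> g) c \<noteq> 0" by simp_all
  from a(3) have "(\<Sum>b\<in>A. g b * (unitv a \<star> unitv b) c) \<noteq> 0"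
    by (simp add: fun_cong[OF amul_expand_right[of "unitv a" g]])
  from sum.not_neutral_contains_not_neutral[OF this]
  obtain b where "b \<in> A" "g b * (unitv a \<star> unitv b) c \<noteq> 0" .
  then have b: "b \<in> A" "g b \<noteq> 0" "(unitv a \<star> unitv b) c \<noteq> 0" by simp_all
  obtain \<alpha> u \<beta> v where ab: "a = (\<alpha>, u)" "b = (\<beta>, v)" by (cases a, cases b)
  have "u \<inter> v = {} \<and> snd c = u \<union> v"
    using b(3) a(1) b(1) unfolding ab by (subst (asm) mul_unitv) (auto simp: unitv_apply split: if_splits)
  moreover have "finite u" "finite v" using a b ab by (auto simp: A_iff finite_sub_Y1)
  ultimately have "card (snd c) = card u + card v" by (simp add: card_Un_disjoint)
  moreover have "(card u + k) mod 2 = 0" "(card v + l) mod 2 = 0" 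
    using assms a(2) b(2) unfolding ab parity_def by fastforce+
  ultimately show "(card (snd c) + (k + l)) mod 2 = 0" by presburger
qed

lemma parity_D:
  assumes g: "inA g" "parity k g" and r: "r \<in> Ya"
  shows "parity (k + tau m r) (D r g)"
  unfolding parity_def
proof (intro allI impI)
  fix c assume c: "D r g c \<noteq> 0"
  obtain \<gamma> w where cw: "c = (\<gamma>, w)" by (cases c)
  show "(card (snd c) + (k + tau m r)) mod 2 = 0"
  proof (cases "r \<in> Y0 m")
    case True
    then show ?thesis using c g cw unfolding parity_def by (auto simp: D_Y0 tau_def)
  next
    case False
    then have r1: "r \<in> Y1 m n" using r by (simp add: Yall_iff)
    then have *: "r \<notin> w" "g (\<gamma>, insert r w) \<noteq> 0" using c D_Y1[OF g(1) r1, of \<gamma> w] cw by (auto split: if_splits)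
    then have "(card (insert r w) + k) mod 2 = 0" using g(2) unfolding parity_def by fastforce
    moreover have "finite w" using * g(1) unfolding inA_def A_iff
      by (metis A_iff finite_insert finite_sub_Y1)
    ultimately show ?thesis using * False by (simp add: cw tau_def)
  qed
qed

lemma parity_sum: "(\<And>i. i \<in> I \<Longrightarrow> parity k (h i)) \<Longrightarrow> parity k (\<lambda>c. \<Sum>i\<in>I. h i c)"
  unfolding parity_def by (metis (mono_tags, lifting) sum.not_neutral_contains_not_neutral)

lemma inA_act: "inA (act X f)"
  unfolding act_def using inA_sum[of Ya "\<lambda>r. cf X r \<star> D r f" "\<lambda>_. 1"] inA_mul by simp

lemma parity_act:
  assumes "X \<in> G" "inA f" "parity k f"
  shows "parity k (act X f)"
  unfolding act_def
proof (rule parity_sum)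
  fix r assume r: "r \<in> Ya"
  have "parity (tau m r + (k + tau m r)) (cf X r \<star> D r f)"
    by (intro parity_mul parity_D assms r G_cfD)
  moreover have "(x + (tau m r + (k + tau m r))) mod 2 = (x + k) mod 2" for x by presburger
  ultimately show "parity k (cf X r \<star> D r f)" unfolding parity_def by simp
qed

lemma act_zero [simp]: "act X (\<lambda>c. 0) = (\<lambda>c. 0)"
  by (simp add: act_def)

lemma br_G:
  assumes "X \<in> G" "Y \<in> G"
  shows "br X Y \<in> G"
  unfolding G_iff cf_br[OF assms]
proof (intro conjI ballI allI impI)
  fix r
  show "inA (\<lambda>c. act X (cf Y r) c - act Y (cf X r) c)"
    using inA_act unfolding inA_def by simp
  have "parity (tau m r) (act X (cf Y r))" "parity (tau m r) (act Y (cf X r))"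
    using assms by (simp_all add: parity_act G_cfD)
  then show "parity (tau m r) (\<lambda>c. act X (cf Y r) c - act Y (cf X r) c)"
    unfolding parity_def by (metis diff_0_right)
  assume "r \<notin> Ya"
  then show "(\<lambda>c. act X (cf Y r) c - act Y (cf X r) c) = (\<lambda>c. 0)"
    using assms by (simp add: G_cfD(3))
qed

lemma act_lin: "act X (\<lambda>c. \<Sum>i\<in>I. k i * h i c) = (\<lambda>c. \<Sum>i\<in>I. k i * act X (h i) c)"
  unfolding act_def dapply_lin amul_lin_right
  by (auto simp: sum_distrib_left fun_eq_iff intro: sum.swap)

lemma act_diff: "act X (\<lambda>c. f c - g c) = (\<lambda>c. act X f c - act X g c)"
  unfolding act_def dapply_diff amul_diff by (simp add: sum_subtractf)

lemma amul_sum_right: "f \<star> (\<lambda>c. \<Sum>i\<in>I. h i c) = (\<lambda>c. \<Sum>i\<in>I. (f \<star> h i) c)"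
  using amul_lin_right[of f "\<lambda>_. 1" h I] by simp

lemma amul_sum_left: "(\<lambda>c. \<Sum>i\<in>I. h i c) \<star> g = (\<lambda>c. \<Sum>i\<in>I. (h i \<star> g) c)"
  using amul_lin_left[of "\<lambda>_. 1" h I g] by simp

text \<open>The Leibniz rule is untwisted here: the twist that D_r leaves on f is undone when f is
  moved past the coefficient \<open>cf X r\<close>, which has parity \<open>tau m r\<close>.\<close>

lemma act_mul:
  assumes X: "X \<in> G" and f: "inA f"
  shows "act X (f \<star> g) = (\<lambda>c. (act X f \<star> g) c + (f \<star> act X g) c)"
proof -
  have "cf X r \<star> D r (f \<star> g) = (\<lambda>c. ((cf X r \<star> D r f) \<star> g) c + (f \<star> (cf X r \<star> D r g)) c)" if "r \<in> Ya" for r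
  proof -
    have "cf X r \<star> D r (f \<star> g) = (\<lambda>c. (cf X r \<star> (D r f \<star> g)) c + (cf X r \<star> (tw r f \<star> D r g)) c)"
      unfolding leibniz[OF that f] amul_add ..
    also have "cf X r \<star> (tw r f \<star> D r g) = f \<star> (cf X r \<star> D r g)"
      using mul_tw[OF G_cfD(2)[OF X], of r f] by (simp flip: mul_assoc)
    finally show ?thesis by (simp add: mul_assoc)
  qed
  then show ?thesis
    unfolding act_def amul_sum_left amul_sum_right by (simp add: sum.distrib cong: sum.cong)
qed

text \<open>The second-order terms of the two compositions agree: exchanging the coefficients and
  exchanging D_r with D_q both cost (-1)^(\<tau>(r) \<tau>(q)), and these signs cancel. What
  survives are the first-order terms, which form the bracket.\<close>

lemma act_br:
  assumes X: "X \<in> G" and Y: "Y \<in> G" and f: "inA f"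
  shows "act (br X Y) f = (\<lambda>c. act X (act Y f) c - act Y (act X f) c)"
proof -
  have 1: "act X (act Y f) = (\<lambda>c. (\<Sum>q\<in>Ya. (act X (cf Y q) \<star> D q f) c)
      + (\<Sum>q\<in>Ya. \<Sum>r\<in>Ya. (cf Y q \<star> (cf X r \<star> D r (D q f))) c))" if "X \<in> G" "Y \<in> G" for X Y
  proof -
    have "act X (act Y f) = (\<lambda>c. \<Sum>q\<in>Ya. act X (cf Y q \<star> D q f) c)"
      unfolding act_def[of Y] using act_lin[of X "\<lambda>_. 1" "\<lambda>q. cf Y q \<star> D q f" Ya] by simp
    also have "\<dots> = (\<lambda>c. \<Sum>q\<in>Ya. (act X (cf Y q) \<star> D q f) c + (cf Y q \<star> act X (D q f)) c)"
      using act_mul[OF that(1) G_cfD(1)[OF that(2)]] by simp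
    finally show ?thesis unfolding sum.distrib act_def[of X "D _ f"] amul_sum_right .
  qed
  have 2: "cf Y q \<star> (cf X r \<star> D r (D q f)) = cf X r \<star> (cf Y q \<star> D q (D r f))" if "q \<in> Ya" "r \<in> Ya" for q r
  proof -
    have "tw r (cf Y q) = (\<lambda>c. (-1) ^ (tau m r * tau m q) * cf Y q c)"
    proof
      fix c
      show "tw r (cf Y q) c = (-1) ^ (tau m r * tau m q) * cf Y q c"
      proof (cases "cf Y q c = 0")
        case False
        then have "(card (snd c) + tau m q) mod 2 = 0" using G_cfD(2)[OF Y, of q] unfolding parity_def by blast
        from minus_one_power_parity[OF this, of "tau m r"] show ?thesis
          by (simp add: tw_def mult.commute)
      qed (simp add: tw_def)
    qed
    then have a: "cf Y q \<star> cf X r = (\<lambda>c. (-1) ^ (tau m r * tau m q) * (cf X r \<star> cf Y q) c)"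
      using mul_tw[OF G_cfD(2)[OF X], of r "cf Y q"] by simp
    have "cf Y q \<star> (cf X r \<star> D r (D q f)) = (\<lambda>c. ((-1) ^ (tau m r * tau m q) * (-1) ^ (tau m r * tau m q)) * ((cf X r \<star> cf Y q) \<star> D q (D r f)) c)"
      unfolding mul_assoc[symmetric] a D_commute[OF that(2,1) f] amul_scale_left amul_scale_right by (simp add: mult.assoc)
    also have "(-1 :: 'a) ^ (tau m r * tau m q) * (-1) ^ (tau m r * tau m q) = 1"
      by (simp flip: power_mult_distrib)
    finally show ?thesis by (simp add: mul_assoc)
  qed
  have 3: "(\<Sum>q\<in>Ya. \<Sum>r\<in>Ya. (cf Y q \<star> (cf X r \<star> D r (D q f))) c) = (\<Sum>q\<in>Ya. \<Sum>r\<in>Ya. (cf X q \<star> (cf Y r \<star> D r (D q f))) c)" for c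
    by (subst sum.swap) (simp add: 2 cong: sum.cong)
  have "act (br X Y) f = (\<lambda>c. (\<Sum>q\<in>Ya. (act X (cf Y q) \<star> D q f) c) - (\<Sum>q\<in>Ya. (act Y (cf X q) \<star> D q f) c))"
    unfolding act_def[of "br X Y"] cf_br[OF X Y] amul_diff by (simp add: sum_subtractf)
  then show ?thesis unfolding 1[OF X Y] 1[OF Y X] 3 by simp
qed

lemma cf_simps [simp]:
  "cf (\<lambda>d. X d + Y d) q = (\<lambda>c. cf X q c + cf Y q c)"
  "cf (\<lambda>d. X d - Y d) q = (\<lambda>c. cf X q c - cf Y q c)"
  "cf (\<lambda>d. k * X d) q = (\<lambda>c. k * cf X q c)"
  "cf (\<lambda>d. - X d) q = (\<lambda>c. - cf X q c)"
  "cf (\<lambda>d. 0) q = (\<lambda>c. 0)"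
  by (simp_all add: cf_def)

text \<open>The Jacobi identity, read off in each component from \<open>act_br\<close>.\<close>

lemma br_derivation:
  assumes E: "E \<in> G" and X: "X \<in> G" and Y: "Y \<in> G"
  shows "br E (br X Y) = (\<lambda>d. br (br E X) Y d + br X (br E Y) d)"
proof (rule cf_eqI)
  fix q
  have i: "inA (cf E q)" "inA (cf X q)" "inA (cf Y q)" using assms G_cfD(1) by auto
  show "cf (br E (br X Y)) q = cf (\<lambda>d. br (br E X) Y d + br X (br E Y) d) q"
    unfolding cf_simps
    by (simp add: cf_br br_G assms act_br i act_diff algebra_simps)
qed

lemma br_skew: "X \<in> G \<Longrightarrow> Y \<in> G \<Longrightarrow> br X Y = (\<lambda>d. - br Y X d)"
  by (rule cf_eqI) (simp add: cf_br)

section \<open>Derivations and the torus\<close>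

definition El :: "(amon \<Rightarrow> 'a) \<Rightarrow> nat \<Rightarrow> wmon \<Rightarrow> 'a" where
  "El f r = (\<lambda>d. if snd (snd d) = r then f (fst d, fst (snd d)) else 0)"

abbreviation e :: "(nat \<Rightarrow> nat) \<Rightarrow> nat set \<Rightarrow> nat \<Rightarrow> wmon \<Rightarrow> 'a" where
  "e \<alpha> u r \<equiv> unitv (\<alpha>, u, r)"

definition ev :: "nat set \<Rightarrow> nat \<Rightarrow> bool" where
  "ev u r \<longleftrightarrow> (card u + tau m r) mod 2 = 0"

lemma cf_El: "cf (El f r) q = (if q = r then f else (\<lambda>c. 0))"
  by (auto simp: cf_def El_def)

lemma El_scale: "El (\<lambda>c. k * f c) r = (\<lambda>d. k * El f r d)"
  by (auto simp: El_def)

lemma El_zero [simp]: "El (\<lambda>c. 0) r = (\<lambda>d. 0)"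
  by (auto simp: El_def)

lemma El_unitv: "El (unitv (\<alpha>, u)) r = e \<alpha> u r"
  by (auto simp: El_def unitv_apply fun_eq_iff)

lemma El_G: "inA f \<Longrightarrow> parity (tau m r) f \<Longrightarrow> r \<in> Ya \<Longrightarrow> El f r \<in> G"
  by (auto simp: G_iff cf_El parity_def inA_def)

lemma act_El: "r \<in> Ya \<Longrightarrow> act (El f r) g = f \<star> D r g"
proof -
  assume r: "r \<in> Ya"
  have "act (El f r) g c = (\<Sum>q\<in>Ya. if q = r then (f \<star> D r g) c else 0)" for c
    unfolding act_def by (intro sum.cong refl) (auto simp: cf_El)
  then show ?thesis using r by (auto simp: fun_eq_iff)
qed

lemma br_El:
  assumes "El f r \<in> G" "El g s \<in> G" "r \<in> Ya" "s \<in> Ya"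
  shows "br (El f r) (El g s) = (\<lambda>d. El (f \<star> D r g) s d - El (g \<star> D s f) r d)"
  using assms by (intro cf_eqI) (auto simp: cf_br act_El cf_El fun_eq_iff)

lemma unitv_G: "(\<alpha>, u) \<in> A \<Longrightarrow> r \<in> Ya \<Longrightarrow> ev u r \<Longrightarrow> e \<alpha> u r \<in> G"
  by (auto simp: Weven_def unitv_apply mem_B wpar_def ev_def)

lemma G_D:
  assumes "X \<in> G" "X (\<alpha>, u, r) \<noteq> 0"
  shows "(\<alpha>, u) \<in> A" "\<alpha> \<in> AI" "u \<subseteq> Y1 m n" "r \<in> Ya" "ev u r"
  using assms by (auto simp: Weven_def mem_B wpar_def ev_def A_iff)

lemma G_lin: "X \<in> G \<Longrightarrow> Y \<in> G \<Longrightarrow> (\<lambda>d. a * X d + b * Y d) \<in> G"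
  unfolding Weven_def mem_Collect_eq by (metis (no_types, lifting) add.left_neutral mult_zero_right)

lemma G_zero [simp]: "(\<lambda>d. 0) \<in> G"
  by (simp add: Weven_def)

lemma G_scale: "X \<in> G \<Longrightarrow> (\<lambda>d. a * X d) \<in> G"
  using G_lin[of X "\<lambda>d. 0" a 0] by simp

lemma G_add: "X \<in> G \<Longrightarrow> Y \<in> G \<Longrightarrow> (\<lambda>d. X d + Y d) \<in> G"
  using G_lin[of X Y 1 1] by simp

lemma G_diff: "X \<in> G \<Longrightarrow> Y \<in> G \<Longrightarrow> (\<lambda>d. X d - Y d) \<in> G"
  using G_lin[of X Y 1 "-1"] by simp

lemma G_sum: "(\<And>i. i \<in> I \<Longrightarrow> h i \<in> G) \<Longrightarrow> (\<lambda>d. \<Sum>i\<in>I. k i * h i d) \<in> G"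
proof (induction I rule: infinite_finite_induct)
  case (insert x I)
  then show ?case using G_add[OF G_scale[of "h x" "k x"], of "\<lambda>d. \<Sum>i\<in>I. k i * h i d"] by simp
qed simp_all

lemma G_expand: "X \<in> G \<Longrightarrow> X = (\<lambda>d. \<Sum>b\<in>{b \<in> B. wpar m b = 0}. X b * unitv b d)"
proof
  fix d assume X: "X \<in> G"
  have "(\<Sum>b\<in>{b \<in> B. wpar m b = 0}. X b * unitv b d) = (\<Sum>b\<in>{b \<in> B. wpar m b = 0}. if b = d then X b else 0)"
    by (intro sum.cong refl) (auto simp: unitv_apply)
  also have "\<dots> = (if d \<in> B \<and> wpar m d = 0 then X d else 0)" by simp
  also have "\<dots> = X d" using spec[OF X[unfolded Weven_def mem_Collect_eq], of d] by auto
  finally show "X d = (\<Sum>b\<in>{b \<in> B. wpar m b = 0}. X b * unitv b d)" ..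
qed

lemma br_lin_left: "br (\<lambda>d. \<Sum>i\<in>I. k i * X i d) Y = (\<lambda>d. \<Sum>i\<in>I. k i * br (X i) Y d)"
proof
  fix d
  have "br (\<lambda>d. \<Sum>i\<in>I. k i * X i d) Y d = (\<Sum>b\<in>B. \<Sum>c\<in>B. \<Sum>i\<in>I. k i * X i b * Y c * bbr p m n t b c d)"
    by (simp add: Wbr_def sum_distrib_right)
  also have "\<dots> = (\<Sum>b\<in>B. \<Sum>i\<in>I. \<Sum>c\<in>B. k i * X i b * Y c * bbr p m n t b c d)"
    by (rule sum.cong[OF refl], rule sum.swap)
  also have "\<dots> = (\<Sum>i\<in>I. \<Sum>b\<in>B. \<Sum>c\<in>B. k i * X i b * Y c * bbr p m n t b c d)"
    by (rule sum.swap)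
  finally show "br (\<lambda>d. \<Sum>i\<in>I. k i * X i d) Y d = (\<Sum>i\<in>I. k i * br (X i) Y d)"
    by (simp add: Wbr_def sum_distrib_left mult.assoc)
qed

lemma br_lin_right: "br Y (\<lambda>d. \<Sum>i\<in>I. k i * X i d) = (\<lambda>d. \<Sum>i\<in>I. k i * br Y (X i) d)"
proof
  fix d
  have "br Y (\<lambda>d. \<Sum>i\<in>I. k i * X i d) d = (\<Sum>b\<in>B. \<Sum>c\<in>B. \<Sum>i\<in>I. Y b * (k i * X i c) * bbr p m n t b c d)"
    by (simp add: Wbr_def sum_distrib_right sum_distrib_left)
  also have "\<dots> = (\<Sum>b\<in>B. \<Sum>i\<in>I. \<Sum>c\<in>B. Y b * (k i * X i c) * bbr p m n t b c d)"
    by (rule sum.cong[OF refl], rule sum.swap)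
  also have "\<dots> = (\<Sum>i\<in>I. \<Sum>b\<in>B. \<Sum>c\<in>B. Y b * (k i * X i c) * bbr p m n t b c d)"
    by (rule sum.swap)
  finally show "br Y (\<lambda>d. \<Sum>i\<in>I. k i * X i d) d = (\<Sum>i\<in>I. k i * br Y (X i) d)"
    by (simp add: Wbr_def sum_distrib_left mult_ac)
qed

lemma br_lin2:
  "br (\<lambda>d. a * X d + b * Y d) Z = (\<lambda>d. a * br X Z d + b * br Y Z d)"
  "br Z (\<lambda>d. a * X d + b * Y d) = (\<lambda>d. a * br Z X d + b * br Z Y d)"
  by (simp_all add: Wbr_def sum_distrib_left sum.distrib algebra_simps)

lemma br_scale: "br (\<lambda>d. a * X d) Z = (\<lambda>d. a * br X Z d)" "br Z (\<lambda>d. a * X d) = (\<lambda>d. a * br Z X d)"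
  by (simp_all add: Wbr_def sum_distrib_left mult_ac)

lemma br_zero [simp]: "br (\<lambda>d. 0) Y = (\<lambda>d. 0)" "br X (\<lambda>d. 0) = (\<lambda>d. 0)"
  by (simp_all add: Wbr_def)

text \<open>The conditions of \<open>DerW\<close> without the convention of vanishing outside
  \<open>G\<close>, which an operator like ad E need not obey.\<close>

definition der :: "((wmon \<Rightarrow> 'a) \<Rightarrow> (wmon \<Rightarrow> 'a)) \<Rightarrow> bool" where
  "der \<phi> \<longleftrightarrow> (\<forall>X\<in>G. \<phi> X \<in> G)
     \<and> (\<forall>X\<in>G. \<forall>Y\<in>G. \<forall>a b. \<phi> (\<lambda>d. a * X d + b * Y d) = (\<lambda>d. a * \<phi> X d + b * \<phi> Y d))
     \<and> (\<forall>X\<in>G. \<forall>Y\<in>G. \<phi> (br X Y) = (\<lambda>d. br (\<phi> X) Y d + br X (\<phi> Y) d))"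

lemma derD:
  assumes "der \<phi>" "X \<in> G" "Y \<in> G"
  shows "\<phi> X \<in> G" "\<phi> (\<lambda>d. a * X d + b * Y d) = (\<lambda>d. a * \<phi> X d + b * \<phi> Y d)"
    "\<phi> (br X Y) = (\<lambda>d. br (\<phi> X) Y d + br X (\<phi> Y) d)"
  using assms unfolding der_def by blast+

lemma der_G: "der \<phi> \<Longrightarrow> X \<in> G \<Longrightarrow> \<phi> X \<in> G"
  by (simp add: der_def)

lemma der_zero: "der \<phi> \<Longrightarrow> \<phi> (\<lambda>d. 0) = (\<lambda>d. 0)"
  using derD(2)[of \<phi> "\<lambda>d. 0" "\<lambda>d. 0" 0 0] by simp

lemma der_scale: "der \<phi> \<Longrightarrow> X \<in> G \<Longrightarrow> \<phi> (\<lambda>d. a * X d) = (\<lambda>d. a * \<phi> X d)"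
  using derD(2)[of \<phi> X "\<lambda>d. 0" a 0] by simp

lemma der_diff: "der \<phi> \<Longrightarrow> X \<in> G \<Longrightarrow> Y \<in> G \<Longrightarrow> \<phi> (\<lambda>d. X d - Y d) = (\<lambda>d. \<phi> X d - \<phi> Y d)"
  using derD(2)[of \<phi> X Y 1 "-1"] by simp

lemma der_sum:
  assumes "der \<phi>" "\<And>i. i \<in> I \<Longrightarrow> h i \<in> G"
  shows "\<phi> (\<lambda>d. \<Sum>i\<in>I. k i * h i d) = (\<lambda>d. \<Sum>i\<in>I. k i * \<phi> (h i) d)"
  using assms(2)
proof (induction I rule: infinite_finite_induct)
  case (insert x I)
  then have "(\<lambda>d. \<Sum>i\<in>I. k i * h i d) \<in> G" by (intro G_sum) auto
  from derD(2)[OF assms(1) _ this, of "h x" "k x" 1] insert show ?case by simp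
qed (simp_all add: der_zero assms(1))

lemma der_ad: "E \<in> G \<Longrightarrow> der (br E)"
  unfolding der_def by (intro conjI ballI allI br_G br_lin2(2) br_derivation)

lemma der_minus:
  assumes "der \<phi>" "der \<psi>"
  shows "der (\<lambda>X d. \<phi> X d - \<psi> X d)"
  unfolding der_def
proof (intro conjI ballI allI)
  fix X Y :: "wmon \<Rightarrow> 'a" and a b assume X: "X \<in> G" and Y: "Y \<in> G"
  have br_minus: "br (\<lambda>d. X d - X' d) Z = (\<lambda>d. br X Z d - br X' Z d)" "br Z (\<lambda>d. X d - X' d) = (\<lambda>d. br Z X d - br Z X' d)" for X X' Z
    using br_lin2[where a = 1 and b = "-1" and X = X and Y = X' and Z = Z] by simp_all
  show "(\<lambda>d. \<phi> (\<lambda>d. a * X d + b * Y d) d - \<psi> (\<lambda>d. a * X d + b * Y d) d) = (\<lambda>d. a * (\<phi> X d - \<psi> X d) + b * (\<phi> Y d - \<psi> Y d))"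
    by (simp add: derD(2)[OF assms(1) X Y] derD(2)[OF assms(2) X Y] algebra_simps)
  show "(\<lambda>d. \<phi> (br X Y) d - \<psi> (br X Y) d) = (\<lambda>d. br (\<lambda>d. \<phi> X d - \<psi> X d) Y d + br X (\<lambda>d. \<phi> Y d - \<psi> Y d) d)"
    by (simp add: derD(3)[OF assms(1) X Y] derD(3)[OF assms(2) X Y] br_minus algebra_simps)
qed (intro G_diff der_G[OF assms(1)] der_G[OF assms(2)])

lemma der_comb:
  assumes "\<And>i. i \<in> I \<Longrightarrow> der (\<psi> i)"
  shows "der (\<lambda>X d. \<Sum>i\<in>I. k i * \<psi> i X d)"
  unfolding der_def
proof (intro conjI ballI allI)
  fix X Y :: "wmon \<Rightarrow> 'a" and a b assume X: "X \<in> G" and Y: "Y \<in> G"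
  show "(\<lambda>d. \<Sum>i\<in>I. k i * \<psi> i X d) \<in> G"
    by (rule G_sum, rule der_G[OF assms X])
  have "(\<Sum>i\<in>I. k i * \<psi> i (\<lambda>d. a * X d + b * Y d) d) = (\<Sum>i\<in>I. a * (k i * \<psi> i X d) + b * (k i * \<psi> i Y d))" for d
    by (intro sum.cong refl) (simp add: derD(2)[OF assms X Y] algebra_simps)
  then show "(\<lambda>d. \<Sum>i\<in>I. k i * \<psi> i (\<lambda>d. a * X d + b * Y d) d) = (\<lambda>d. a * (\<Sum>i\<in>I. k i * \<psi> i X d) + b * (\<Sum>i\<in>I. k i * \<psi> i Y d))"
    by (simp add: sum.distrib sum_distrib_left)
  have "(\<Sum>i\<in>I. k i * \<psi> i (br X Y) d) = (\<Sum>i\<in>I. k i * br (\<psi> i X) Y d + k i * br X (\<psi> i Y) d)" for d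
    by (intro sum.cong refl) (simp add: derD(3)[OF assms X Y] algebra_simps)
  then show "(\<lambda>d. \<Sum>i\<in>I. k i * \<psi> i (br X Y) d) = (\<lambda>d. br (\<lambda>d. \<Sum>i\<in>I. k i * \<psi> i X d) Y d + br X (\<lambda>d. \<Sum>i\<in>I. k i * \<psi> i Y d) d)"
    by (simp add: sum.distrib br_lin_left br_lin_right)
qed

section \<open>Powers of a derivation and the outer derivations\<close>

lemma binomial_shift:
  fixes b :: "nat \<Rightarrow> nat \<Rightarrow> 'a"
  shows "(\<Sum>l\<le>k. of_nat (k choose l) * (b (Suc l) (k - l) + b l (Suc (k - l))))
    = (\<Sum>l\<le>Suc k. of_nat (Suc k choose l) * b l (Suc k - l))"
proof -
  have "(\<Sum>l\<le>Suc k. of_nat (k choose l) * b l (Suc k - l)) = b 0 (Suc k) + (\<Sum>l\<le>k. of_nat (k choose Suc l) * b (Suc l) (k - l))"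
    unfolding sum.atMost_Suc_shift by simp
  moreover have "(\<Sum>l\<le>Suc k. of_nat (k choose l) * b l (Suc k - l)) = (\<Sum>l\<le>k. of_nat (k choose l) * b l (Suc (k - l)))"
    by (simp add: binomial_eq_0 Suc_diff_le)
  ultimately show ?thesis
    unfolding sum.atMost_Suc_shift[of _ k] by (simp add: algebra_simps sum.distrib)
qed

lemma der_funpow_G: "der \<phi> \<Longrightarrow> X \<in> G \<Longrightarrow> (\<phi> ^^ k) X \<in> G"
  by (induction k) (auto simp: der_G)

lemma der_funpow_br:
  assumes "der \<phi>" "X \<in> G" "Y \<in> G"
  shows "(\<phi> ^^ k) (br X Y) = (\<lambda>d. \<Sum>l\<le>k. of_nat (k choose l) * br ((\<phi> ^^ l) X) ((\<phi> ^^ (k - l)) Y) d)"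
proof (induction k)
  case (Suc k)
  let ?X = "\<lambda>l. (\<phi> ^^ l) X" and ?Y = "\<lambda>l. (\<phi> ^^ l) Y"
  have G: "?X l \<in> G" "?Y l \<in> G" for l using assms der_funpow_G by auto
  have "(\<phi> ^^ Suc k) (br X Y) = \<phi> (\<lambda>d. \<Sum>l\<le>k. of_nat (k choose l) * br (?X l) (?Y (k - l)) d)"
    using Suc by simp
  also have "\<dots> = (\<lambda>d. \<Sum>l\<le>k. of_nat (k choose l) * \<phi> (br (?X l) (?Y (k - l))) d)"
    using G by (intro der_sum[OF assms(1)] br_G)
  also have "\<dots> = (\<lambda>d. \<Sum>l\<le>k. of_nat (k choose l) * (br (?X (Suc l)) (?Y (k - l)) d + br (?X l) (?Y (Suc (k - l))) d))"
    using derD(3)[OF assms(1) G] by simp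
  also have "\<dots> = (\<lambda>d. \<Sum>l\<le>Suc k. of_nat (Suc k choose l) * br (?X l) (?Y (Suc k - l)) d)"
    using binomial_shift[of k "\<lambda>l j. br (?X l) (?Y j) _"] by (intro ext)
  finally show ?case .
qed simp

text \<open>In the Leibniz formula of order p the middle binomial coefficients vanish in
  characteristic p. Iterating gives the exponents p^r, hence the outer derivations.\<close>

lemma der_funpow_p:
  assumes "der \<phi>"
  shows "der (\<phi> ^^ p)"
  unfolding der_def
proof (intro conjI ballI allI)
  fix X Y :: "wmon \<Rightarrow> 'a" and a b assume X: "X \<in> G" and Y: "Y \<in> G"
  show "(\<phi> ^^ k) (\<lambda>d. a * X d + b * Y d) = (\<lambda>d. a * (\<phi> ^^ k) X d + b * (\<phi> ^^ k) Y d)" for k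
  proof (induction k)
    case (Suc k)
    then show ?case
      using derD(2)[OF assms der_funpow_G[OF assms X] der_funpow_G[OF assms Y]] by simp
  qed simp
  show "(\<phi> ^^ p) (br X Y) = (\<lambda>d. br ((\<phi> ^^ p) X) Y d + br X ((\<phi> ^^ p) Y) d)"
  proof
    fix d
    let ?b = "\<lambda>l. br ((\<phi> ^^ l) X) ((\<phi> ^^ (p - l)) Y) d"
    have "(\<Sum>l\<le>p. of_nat (p choose l) * ?b l) = (\<Sum>l\<in>{0, p}. of_nat (p choose l) * ?b l)"
    proof (rule sum.mono_neutral_right)
      show "\<forall>l\<in>{..p} - {0, p}. of_nat (p choose l) * ?b l = 0"
        using prime_dvd_prime_power_choose[OF prime_p, of _ 1] of_nat_eq_0_iff_p by auto
    qed auto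
    also have "\<dots> = ?b p + ?b 0" using p_gt by simp
    finally show "(\<phi> ^^ p) (br X Y) d = br ((\<phi> ^^ p) X) Y d + br X ((\<phi> ^^ p) Y) d"
      unfolding der_funpow_br[OF assms X Y] by simp
  qed
qed (use assms der_funpow_G in auto)

lemma der_funpow_p_power: "der \<phi> \<Longrightarrow> der (\<phi> ^^ (p ^ r))"
  by (induction r) (auto simp: mult.commute[of p] funpow_mult[symmetric] dest: der_funpow_p)

definition sp :: "nat \<Rightarrow> nat \<Rightarrow> nat \<Rightarrow> nat" where
  "sp i c = (\<lambda>_. 0)(i := c)"

lemma sp_0 [simp]: "sp i 0 = (\<lambda>_. 0)"
  by (auto simp: sp_def)

lemma sp_apply: "sp i c j = (if j = i then c else 0)"
  by (simp add: sp_def)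

lemma sp_AI: "i \<in> Y0 m \<Longrightarrow> c < p ^ t i \<Longrightarrow> sp i c \<in> AI"
  using prime_p by (auto simp: AI_iff sp_def prime_gt_0_nat)

lemma p_le_power: "i \<in> Y0 m \<Longrightarrow> p \<le> p ^ t i"
  using t_ge[of i] power_increasing[of 1 "t i" p] p_gt by simp

lemma sp1_AI: "i \<in> Y0 m \<Longrightarrow> sp i 1 \<in> AI" "i \<in> Y0 m \<Longrightarrow> sp i (Suc 0) \<in> AI" "i \<in> Y0 m \<Longrightarrow> sp i 2 \<in> AI"
  using sp_AI[of i 1] sp_AI[of i 2] p_le_power[of i] p_gt by simp_all

lemma bin_single: "i \<in> Y0 m \<Longrightarrow> bin (sp i c) \<beta> = of_nat ((c + \<beta> i) choose c)"
  unfolding bin_def by (subst prod.remove[of _ i]) (simp_all add: sp_apply)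

lemma bin_zero [simp]: "bin (\<lambda>_. 0) \<beta> = 1" "bin \<alpha> (\<lambda>_. 0) = 1"
  by (simp_all add: bin_def)

definition one :: "amon \<Rightarrow> 'a" where "one = unitv (\<lambda>_. 0, {})"

lemma one_mul [simp]: "inA f \<Longrightarrow> one \<star> f = f" "inA f \<Longrightarrow> f \<star> one = f"
proof -
  assume f: "inA f"
  have "one \<star> unitv a = unitv a" "unitv a \<star> one = unitv a" if "a \<in> A" for a
    using that mul_unitv[of "\<lambda>_. 0" "{}" "fst a" "snd a"] mul_unitv[of "fst a" "snd a" "\<lambda>_. 0" "{}"]
    by (cases a, simp add: one_def A_iff)+
  then show "one \<star> f = f" "f \<star> one = f"
    unfolding amul_expand_right[of one f] amul_expand_left[of f one] using inA_expand[OF f, symmetric]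
    by (simp_all cong: sum.cong)
qed

lemma one_simps: "inA one" "parity 0 one" "r \<in> Ya \<Longrightarrow> D r one = (\<lambda>c. 0)"
proof -
  have A: "(\<lambda>_. 0, {}) \<in> A" by (simp add: A_iff)
  show "inA one" "parity 0 one" using A by (auto simp: one_def parity_def unitv_apply intro: inA_unitv)
  show "D r one = (\<lambda>c. 0)" if "r \<in> Ya"
    using that unfolding Yall_iff one_def by (auto simp: D_unitv_Y0[OF A] D_unitv_Y1[OF A])
qed

lemma Dvec_El: "Dvec i = El one i"
  by (simp add: Dvec_def one_def El_unitv)

lemma Ya_I: "i \<in> Y0 m \<Longrightarrow> i \<in> Ya" "i \<in> Y1 m n \<Longrightarrow> i \<in> Ya"
  by (auto simp: Yall_iff)

lemma Dvec_G: "i \<in> Y0 m \<Longrightarrow> Dvec i \<in> G"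
  unfolding Dvec_El by (rule El_G) (auto simp: one_simps tau_simps Ya_I)

lemma act_one: "act X one = (\<lambda>c. 0)"
  by (simp add: act_def one_simps cong: sum.cong)

text \<open>D_i has a constant coefficient, which X annihilates by \<open>act_one\<close>; so the
  bracket only differentiates the coefficients of X. Iterates are shifts by k, with no binomial
  coefficients.\<close>

lemma br_Dvec:
  assumes i: "i \<in> Y0 m" and X: "X \<in> G"
  shows "br (Dvec i) X (\<alpha>, u, q) = X (\<alpha>(i := Suc (\<alpha> i)), u, q)"
proof -
  have "cf (br (Dvec i) X) q = D i (cf X q)"
    unfolding cf_br[OF Dvec_G[OF i] X]
    using i X by (auto simp: Dvec_El act_El Ya_I cf_El act_one inA_D)
  from fun_cong[OF this, of "(\<alpha>, u)"] show ?thesis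
    using D_Y0[OF G_cfD(1)[OF X] i, of q \<alpha> u] by (simp add: cf_def)
qed

lemma br_Dvec_funpow:
  assumes i: "i \<in> Y0 m" and X: "X \<in> G"
  shows "(br (Dvec i) ^^ k) X (\<alpha>, u, q) = X (\<alpha>(i := \<alpha> i + k), u, q)"
proof (induction k arbitrary: \<alpha>)
  case (Suc k)
  have 1: "(br (Dvec i) ^^ k) X \<in> G" using der_funpow_G[OF der_ad[OF Dvec_G[OF i]] X] .
  have 2: "(\<alpha>(i := Suc (\<alpha> i)))(i := (\<alpha>(i := Suc (\<alpha> i))) i + k) = \<alpha>(i := \<alpha> i + Suc k)"
    by (simp add: fun_eq_iff)
  show ?case unfolding funpow.simps o_apply br_Dvec[OF i 1] Suc 2 ..
qed simp

lemma der_adDpow: "i \<in> Y0 m \<Longrightarrow> der (adDpow p m n t i r)"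
  unfolding adDpow_def by (intro der_funpow_p_power der_ad Dvec_G)

lemma finite_Jset [simp]: "finite (Jset m t)"
proof -
  have "Jset m t \<subseteq> (\<Union>i\<in>Y0 m. {i} \<times> {..<t i})" by (auto simp: Jset_def)
  then show ?thesis by (rule finite_subset) auto
qed

lemma der_spanop: "der (spanop p m n t c)"
proof -
  have "der (\<lambda>X d. \<Sum>x\<in>Jset m t. c x * (case x of (i, r) \<Rightarrow> adDpow p m n t i r) X d)"
    by (rule der_comb) (auto simp: Jset_def der_adDpow)
  moreover have "(\<lambda>X d. \<Sum>x\<in>Jset m t. c x * (case x of (i, r) \<Rightarrow> adDpow p m n t i r) X d) = spanop p m n t c"
    by (auto simp: spanop_def fun_eq_iff intro!: sum.cong)
  ultimately show ?thesis by simp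
qed

lemma spanop_apply:
  assumes "X \<in> G"
  shows "spanop p m n t c X (\<alpha>, u, q) = (\<Sum>(i, r)\<in>Jset m t. c (i, r) * X (\<alpha>(i := \<alpha> i + p ^ r), u, q))"
  unfolding spanop_def adDpow_def using assms
  by (intro sum.cong refl) (auto simp: Jset_def br_Dvec_funpow)

section \<open>Coordinate functions, torus and weights\<close>

definition xf :: "nat \<Rightarrow> amon \<Rightarrow> 'a" where
  "xf s = (if s \<in> Y0 m then unitv (sp s 1, {}) else unitv (\<lambda>_. 0, {s}))"

definition h :: "nat \<Rightarrow> wmon \<Rightarrow> 'a" where "h s = El (xf s) s"

definition wtA :: "nat \<Rightarrow> amon \<Rightarrow> 'a" where
  "wtA s c = (if s \<in> Y0 m then of_nat (fst c s) else of_bool (s \<in> snd c))"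

text \<open>The eigenvalue of ad h_s on the basis vector d. It lies in the field, so an even
  exponent is seen only modulo p, whereas the odd weights 0, 1, -1 remain distinct because p >
  2.\<close>

definition wt :: "nat \<Rightarrow> wmon \<Rightarrow> 'a" where
  "wt s d = wtA s (fst d, fst (snd d)) - of_bool (s = snd (snd d))"

lemma xf_A: "s \<in> Y0 m \<Longrightarrow> (sp s 1, {}) \<in> A" "s \<in> Y1 m n \<Longrightarrow> (\<lambda>_. 0, {s}) \<in> A"
  using sp1_AI by (auto simp: A_iff)

lemma h_G: "s \<in> Ya \<Longrightarrow> h s \<in> G"
  unfolding h_def using xf_A[of s] Y0_Y1_disj
  by (intro El_G) (auto simp: xf_def inA_unitv parity_def unitv_apply Yall_iff tau_simps)

lemma D_xf: "r \<in> Ya \<Longrightarrow> s \<in> Ya \<Longrightarrow> D r (xf s) = (if r = s then one else (\<lambda>c. 0))"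
proof -
  assume r: "r \<in> Ya" and s: "s \<in> Ya"
  have z: "(sp s (Suc 0))(r := sp s (Suc 0) r - 1) = (\<lambda>_. 0)" if "r = s" using that by (auto simp: sp_def)
  consider "s \<in> Y0 m" "s \<notin> Y1 m n" | "s \<in> Y1 m n" "s \<notin> Y0 m" using s Y0_Y1_disj by (auto simp: Yall_iff)
  then show ?thesis
  proof cases
    case 1
    from xf_A(1)[OF 1(1)] r 1 z show ?thesis
      unfolding Yall_iff by (auto simp: xf_def D_unitv_Y0 D_unitv_Y1 sp_apply one_def)
  next
    case 2
    from xf_A(2)[OF 2(1)] r 2 show ?thesis
      unfolding Yall_iff by (auto simp: xf_def D_unitv_Y0 D_unitv_Y1 one_def)
  qed
qed

lemma act_xf:
  assumes X: "X \<in> G" and s: "s \<in> Ya"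
  shows "act X (xf s) = cf X s"
proof -
  have "act X (xf s) c = (\<Sum>r\<in>Ya. if r = s then cf X s c else 0)" for c
    unfolding act_def using s by (intro sum.cong refl) (auto simp: D_xf G_cfD[OF X])
  then show ?thesis using s by (auto simp: fun_eq_iff)
qed

text \<open>x_s D_s is an Euler operator. For even s the factor \<open>\<alpha> s\<close> is the
  binomial coefficient of multiplying x_s back onto the lowered power; for odd s the signs of
  removing and restoring x_s coincide and square to 1.\<close>

lemma mul_xf_D:
  assumes s: "s \<in> Ya" and f: "inA f"
  shows "xf s \<star> D s f = (\<lambda>c. wtA s c * f c)"
proof -
  have 1: "xf s \<star> D s (unitv (\<alpha>, u)) = (\<lambda>c. wtA s (\<alpha>, u) * unitv (\<alpha>, u) c)" if a: "(\<alpha>, u) \<in> A" for \<alpha> u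
  proof (cases "s \<in> Y0 m")
    case True
    show ?thesis
    proof (cases "\<alpha> s = 0")
      case False
      then have e: "(\<lambda>i. sp s 1 i + (\<alpha>(s := \<alpha> s - 1)) i) = \<alpha>" by (auto simp: sp_apply fun_eq_iff)
      show ?thesis using True False mul_unitv[OF xf_A(1)[OF True] sub_A[OF a, of s 1]]
        unfolding e by (simp add: xf_def D_unitv_Y0[OF a] wtA_def bin_single fun_eq_iff)
    qed (use True in \<open>simp add: D_unitv_Y0[OF a] wtA_def\<close>)
  next
    case False
    then have s1: "s \<in> Y1 m n" using s by (simp add: Yall_iff)
    have a': "(\<alpha>, u - {s}) \<in> A" using a by (auto simp: A_iff)
    show ?thesis using False mul_unitv[OF xf_A(2)[OF s1] a']
      by (auto simp: xf_def D_unitv_Y1[OF a s1] wtA_def fun_eq_iff sg_square insert_absorb mult.assoc[symmetric])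
  qed
  have "xf s \<star> D s f = (\<lambda>c. \<Sum>a\<in>A. f a * (xf s \<star> D s (unitv a)) c)"
    unfolding dapply_expand[of s f] amul_lin_right ..
  also have "\<dots> = (\<lambda>c. \<Sum>a\<in>A. wtA s c * (f a * unitv a c))"
  proof (intro ext sum.cong refl)
    fix c a assume "a \<in> A"
    then show "f a * (xf s \<star> D s (unitv a)) c = wtA s c * (f a * unitv a c)"
      using 1[of "fst a" "snd a"] by (cases a) (auto simp: unitv_apply)
  qed
  also have "\<dots> = (\<lambda>c. wtA s c * (\<Sum>a\<in>A. f a * unitv a c))"
    by (simp add: sum_distrib_left)
  also have "\<dots> = (\<lambda>c. wtA s c * f c)"
    using inA_expand[OF f, symmetric] by (simp add: fun_eq_iff)
  finally show ?thesis .
qed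

lemma br_h:
  assumes s: "s \<in> Ya" and X: "X \<in> G"
  shows "br (h s) X = (\<lambda>d. wt s d * X d)"
proof (rule cf_eqI)
  fix q
  have "cf (br (h s) X) q = (\<lambda>c. (xf s \<star> D s (cf X q)) c - act X (if q = s then xf s else (\<lambda>c. 0)) c)"
    unfolding cf_br[OF h_G[OF s] X] using s by (simp add: h_def act_El cf_El)
  also have "\<dots> = (\<lambda>c. wtA s c * cf X q c - (if q = s then cf X q c else 0))"
    unfolding mul_xf_D[OF s G_cfD(1)[OF X]] by (auto simp: act_xf[OF X s])
  also have "\<dots> = cf (\<lambda>d. wt s d * X d) q"
    by (auto simp: cf_def wt_def algebra_simps)
  finally show "cf (br (h s) X) q = cf (\<lambda>d. wt s d * X d) q" .
qed

section \<open>Reduction on the torus and on the partial derivatives\<close>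

lemma two_neq_0: "(2 :: 'a) \<noteq> 0"
  using of_nat_eq_0_iff_p[of 2] p_gt by (auto dest: dvd_imp_le)

lemma Y1_third: 
  obtains q where "q \<in> Y1 m n" "q \<noteq> k" "q \<noteq> l"
proof -
  have "\<exists>q \<in> {m + 1, m + 2, m + 3}. q \<noteq> k \<and> q \<noteq> l" by auto
  moreover have "{m + 1, m + 2, m + 3} \<subseteq> Y1 m n" using n_ge by (auto simp: Y1_def)
  ultimately show thesis using that by blast
qed

lemma Y0_other: 
  obtains j where "j \<in> Y0 m" "j \<noteq> i"
proof -
  have "\<exists>j \<in> {1, 2}. j \<noteq> i" by auto
  moreover have "{1, 2} \<subseteq> Y0 m" using m_ge by (auto simp: Y0_def)
  ultimately show thesis using that by blast
qed

text \<open>2 z_k = (z_k + z_l) + (z_k + z_q) - (z_l + z_q), with a third odd index q and 2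
  invertible. This turns tests against x_k x_l D_j into information on single coefficients.\<close>

lemma pairwise_sums_zero:
  fixes z :: "nat \<Rightarrow> 'a"
  assumes "\<And>k l. k \<in> Y1 m n \<Longrightarrow> l \<in> Y1 m n \<Longrightarrow> k \<noteq> l \<Longrightarrow> z k + z l = 0" and k: "k \<in> Y1 m n"
  shows "z k = 0"
proof -
  obtain l where l: "l \<in> Y1 m n" "l \<noteq> k" using Y1_third[of k k] by blast
  obtain q where q: "q \<in> Y1 m n" "q \<noteq> k" "q \<noteq> l" using Y1_third[of k l] by blast
  have "2 * z k = (z k + z l) + (z k + z q) - (z l + z q)" by (simp add: algebra_simps)
  then show ?thesis using assms(1)[OF k l(1)] assms(1)[OF k q(1)] assms(1)[OF l(1) q(1)] l q two_neq_0 by auto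
qed

lemma h_unitv: "s \<in> Y0 m \<Longrightarrow> h s = e (sp s 1) {} s" "s \<in> Y1 m n \<Longrightarrow> h s = e (\<lambda>_. 0) {s} s"
  using Y0_Y1_disj by (auto simp: h_def xf_def El_unitv)

lemma zero_A: "u \<subseteq> Y1 m n \<Longrightarrow> (\<lambda>_. 0, u) \<in> A"
  by (simp add: A_iff)

lemma pair_G: "k \<in> Y1 m n \<Longrightarrow> l \<in> Y1 m n \<Longrightarrow> k \<noteq> l \<Longrightarrow> i \<in> Y0 m \<Longrightarrow> e (\<lambda>_. 0) {k, l} i \<in> G"
  by (intro unitv_G zero_A) (auto simp: ev_def tau_simps Ya_I)

lemma wt_simps:
  "s \<in> Y0 m \<Longrightarrow> wt s (\<alpha>, u, r) = of_nat (\<alpha> s) - of_bool (s = r)"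
  "s \<in> Y1 m n \<Longrightarrow> wt s (\<alpha>, u, r) = of_bool (s \<in> u) - of_bool (s = r)"
  using Y0_Y1_disj by (auto simp: wt_def wtA_def)

lemma of_bool_diff_eq_0: "(of_bool a - of_bool b :: 'a) = 0 \<longleftrightarrow> (a \<longleftrightarrow> b)"
  by auto

lemma G_Y1_weight_0:
  assumes "X \<in> G" "X (\<alpha>, u, r) \<noteq> 0" "\<And>s. s \<in> Y1 m n \<Longrightarrow> wt s (\<alpha>, u, r) = 0"
  shows "u = (if r \<in> Y1 m n then {r} else {})"
proof -
  have "s \<in> u \<longleftrightarrow> s = r" if "s \<in> Y1 m n" for s
    using assms(3)[OF that] wt_simps(2)[OF that] of_bool_diff_eq_0 by auto
  then show ?thesis using G_D(3)[OF assms(1,2)] by auto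
qed

lemma torus_expand:
  assumes "\<And>d. Z d \<noteq> 0 \<Longrightarrow> \<exists>k\<in>Y1 m n. d = (\<lambda>_. 0, {k}, k)"
  shows "Z = (\<lambda>d. \<Sum>r\<in>Y1 m n. Z (\<lambda>_. 0, {r}, r) * h r d)"
proof
  fix d
  have "(\<Sum>r\<in>Y1 m n. Z (\<lambda>_. 0, {r}, r) * h r d) = (\<Sum>r\<in>Y1 m n. if d = (\<lambda>_. 0, {r}, r) then Z d else 0)"
    by (intro sum.cong refl) (auto simp: h_unitv unitv_apply)
  also have "\<dots> = Z d"
  proof (cases "\<exists>k\<in>Y1 m n. d = (\<lambda>_. 0, {k}, k)")
    case True
    then obtain k where k: "k \<in> Y1 m n" "d = (\<lambda>_. 0, {k}, k)" by blast
    have "(\<Sum>r\<in>Y1 m n. if d = (\<lambda>_. 0, {r}, r) then Z d else 0) = (\<Sum>r\<in>Y1 m n. if r = k then Z d else 0)"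
      by (intro sum.cong refl) (auto simp: k)
    then show ?thesis using k(1) by simp
  next
    case False
    then have "Z d = 0" using assms by blast
    moreover have "(\<Sum>r\<in>Y1 m n. if d = (\<lambda>_. 0, {r}, r) then Z d else 0) = 0"
      using False by (intro sum.neutral) auto
    ultimately show ?thesis by simp
  qed
  finally show "Z d = (\<Sum>r\<in>Y1 m n. Z (\<lambda>_. 0, {r}, r) * h r d)" ..
qed

lemma br_torus: "X \<in> G \<Longrightarrow> I \<subseteq> Ya \<Longrightarrow> br (\<lambda>d. \<Sum>r\<in>I. z r * h r d) X = (\<lambda>d. (\<Sum>r\<in>I. z r * wt r d) * X d)"
  unfolding br_lin_left by (auto simp: br_h sum_distrib_right mult.assoc subset_iff fun_eq_iff intro!: sum.cong)

text \<open>The coefficient of [D_i, Z] at \<alpha> - \<epsilon>_i is that of Z at \<alpha>, so no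
  exponent can be nonzero.\<close>

lemma constant_supp:
  assumes Z: "Z \<in> G" and D: "\<And>i. i \<in> Y0 m \<Longrightarrow> br (Dvec i) Z = (\<lambda>d. 0)" and nz: "Z (\<alpha>, u, r) \<noteq> 0"
  shows "\<alpha> = (\<lambda>_. 0)"
proof (rule ccontr)
  assume "\<alpha> \<noteq> (\<lambda>_. 0)"
  then obtain i where i: "\<alpha> i \<noteq> 0" by auto
  then have i0: "i \<in> Y0 m" using G_D(2)[OF Z nz] by (auto simp: AI_iff)
  have "Z ((\<alpha>(i := \<alpha> i - 1))(i := Suc ((\<alpha>(i := \<alpha> i - 1)) i)), u, r) = 0"
    using br_Dvec[OF i0 Z, of "\<alpha>(i := \<alpha> i - 1)" u r] D[OF i0] by simp
  then show False using i nz by (simp add: fun_upd_idem)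
qed

text \<open>A constant field x^u D_r with r even has h_r-weight -1, so r is odd; then odd weight 0
  leaves only x_r D_r.\<close>

lemma constant_weight_0:
  assumes Z: "Z \<in> G" and D: "\<And>i. i \<in> Y0 m \<Longrightarrow> br (Dvec i) Z = (\<lambda>d. 0)"
    and w: "\<And>d s. Z d \<noteq> 0 \<Longrightarrow> s \<in> Ya \<Longrightarrow> wt s d = 0"
  shows "Z = (\<lambda>d. \<Sum>r\<in>Y1 m n. Z (\<lambda>_. 0, {r}, r) * h r d)"
proof (rule torus_expand)
  fix d assume nz: "Z d \<noteq> 0"
  obtain \<alpha> u r where d: "d = (\<alpha>, u, r)" by (cases d)
  note nz = nz[unfolded d]
  have a: "\<alpha> = (\<lambda>_. 0)" by (rule constant_supp[OF Z D nz])
  have "r \<notin> Y0 m"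
    using w[OF nz, of r] wt_simps(1)[of r \<alpha> u r] a by (auto simp: Ya_I)
  then have r: "r \<in> Y1 m n" using G_D(4)[OF Z nz] by (simp add: Yall_iff)
  moreover have "u = {r}" using G_Y1_weight_0[OF Z nz] w[OF nz] r by (auto simp: Ya_I)
  ultimately show "\<exists>k\<in>Y1 m n. d = (\<lambda>_. 0, {k}, k)" using d a by auto
qed

lemma torus_pair_zero:
  assumes "\<And>k l. k \<in> Y1 m n \<Longrightarrow> l \<in> Y1 m n \<Longrightarrow> k \<noteq> l \<Longrightarrow> 
     br (\<lambda>d. \<Sum>r\<in>Y1 m n. z r * h r d) (e (\<lambda>_. 0) {k, l} 1) = (\<lambda>d. 0)"
   and k: "k \<in> Y1 m n"
  shows "z k = 0"
proof (rule pairwise_sums_zero[of z, OF _ k])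
  fix k l assume kl: "k \<in> Y1 m n" "l \<in> Y1 m n" "k \<noteq> l"
  have 1: "1 \<in> Y0 m" using m_ge by (simp add: Y0_def)
  have "(\<Sum>r\<in>Y1 m n. z r * wt r (\<lambda>_. 0, {k, l}, 1)) = 0"
    using fun_cong[OF br_torus[OF pair_G[OF kl 1], of "Y1 m n" z], of "(\<lambda>_. 0, {k, l}, 1)"] assms(1)[OF kl]
    by (simp add: unitv_apply Yall_def)
  moreover have "(\<Sum>r\<in>Y1 m n. z r * wt r (\<lambda>_. 0, {k, l}, 1)) = (\<Sum>r\<in>{k, l}. z r)"
    using kl Y0_Y1_disj[OF 1] by (intro sum.mono_neutral_cong_right) (auto simp: wt_simps)
  ultimately show "z k + z l = 0" using kl by simp
qed

text \<open>Commuting with the D_i puts Z into the odd torus, and commuting with the x_k x_l D_1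
  makes all sums z_k + z_l vanish.\<close>

lemma weight_0_central:
  assumes Z: "Z \<in> G" and w: "\<And>d s. Z d \<noteq> 0 \<Longrightarrow> s \<in> Ya \<Longrightarrow> wt s d = 0"
    and c: "\<And>\<alpha> u r. e \<alpha> u r \<in> G \<Longrightarrow> br Z (e \<alpha> u r) = (\<lambda>d. 0)"
  shows "Z = (\<lambda>d. 0)"
proof -
  have D: "br (Dvec i) Z = (\<lambda>d. 0)" if "i \<in> Y0 m" for i
    using c[of "\<lambda>_. 0" "{}" i] Dvec_G[OF that] br_skew[OF Dvec_G[OF that] Z]
    by (simp add: Dvec_def fun_eq_iff)
  let ?z = "\<lambda>r. Z (\<lambda>_. 0, {r}, r)"
  have Z_eq: "Z = (\<lambda>d. \<Sum>r\<in>Y1 m n. ?z r * h r d)" by (rule constant_weight_0[OF Z D w])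
  have 1: "1 \<in> Y0 m" using m_ge by (simp add: Y0_def)
  have "?z k = 0" if "k \<in> Y1 m n" for k
  proof (rule torus_pair_zero[OF _ that])
    fix k l assume kl: "k \<in> Y1 m n" "l \<in> Y1 m n" "k \<noteq> l"
    show "br (\<lambda>d. \<Sum>r\<in>Y1 m n. ?z r * h r d) (e (\<lambda>_. 0) {k, l} 1) = (\<lambda>d. 0)"
      unfolding Z_eq[symmetric] by (rule c[OF pair_G[OF kl 1]])
  qed
  then show ?thesis by (subst Z_eq) simp
qed

lemma br_h_unitv: "e \<alpha> u r \<in> G \<Longrightarrow> s \<in> Ya \<Longrightarrow> br (h s) (e \<alpha> u r) = (\<lambda>d. wt s (\<alpha>, u, r) * e \<alpha> u r d)"
proof
  fix d assume "e \<alpha> u r \<in> G" "s \<in> Ya"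
  then show "br (h s) (e \<alpha> u r) d = wt s (\<alpha>, u, r) * e \<alpha> u r d"
    by (cases "d = (\<alpha>, u, r)") (simp_all add: br_h unitv_apply)
qed

text \<open>Once \<phi>(h_s) = 0, \<phi> commutes with ad h_s and hence preserves its
  eigenspaces.\<close>

lemma der_weight:
  assumes der: "der \<phi>" and s: "s \<in> Ya" and h0: "\<phi> (h s) = (\<lambda>d. 0)" and X: "e \<alpha> u r \<in> G" and nz: "\<phi> (e \<alpha> u r) d \<noteq> 0"
  shows "wt s d = wt s (\<alpha>, u, r)"
proof -
  have "\<phi> (br (h s) (e \<alpha> u r)) d = wt s d * \<phi> (e \<alpha> u r) d"
    unfolding derD(3)[OF der h_G[OF s] X] h0 by (simp add: br_h[OF s der_G[OF der X]])
  moreover have "\<phi> (br (h s) (e \<alpha> u r)) d = wt s (\<alpha>, u, r) * \<phi> (e \<alpha> u r) d"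
    unfolding br_h_unitv[OF X s] by (simp add: der_scale[OF der X])
  ultimately show ?thesis using nz by simp
qed

definition kills_h :: "((wmon \<Rightarrow> 'a) \<Rightarrow> (wmon \<Rightarrow> 'a)) \<Rightarrow> bool" where
  "kills_h \<phi> \<longleftrightarrow> (\<forall>s\<in>Ya. \<phi> (h s) = (\<lambda>d. 0))"

definition kills_D :: "((wmon \<Rightarrow> 'a) \<Rightarrow> (wmon \<Rightarrow> 'a)) \<Rightarrow> bool" where
  "kills_D \<phi> \<longleftrightarrow> (\<forall>i\<in>Y0 m. \<phi> (Dvec i) = (\<lambda>d. 0))"

lemma reduce_torus:
  assumes der: "der \<phi>"
  obtains E where "E \<in> G" "kills_h (\<lambda>X d. \<phi> X d - br E X d)"
proof -
  \<comment> \<open>E has to satisfy wt s d * E d = - \<phi>(h_s) d for all s at once. In each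
    coordinate some s of nonzero weight is chosen to divide by; \<open>comm\<close>, a consequence
    of [h_s, h_q] = 0, makes the quotient independent of that choice.\<close>
  define E where "E = (\<lambda>d. if \<exists>s\<in>Ya. wt s d \<noteq> 0 then - (\<phi> (h (SOME s. s \<in> Ya \<and> wt s d \<noteq> 0)) d / wt (SOME s. s \<in> Ya \<and> wt s d \<noteq> 0) d) else 0)"
  have comm: "wt s d * \<phi> (h q) d = wt q d * \<phi> (h s) d" if s: "s \<in> Ya" and q: "q \<in> Ya" for s q d
  proof -
    have 0: "br (h s) (h q) = (\<lambda>d. 0)"
    proof (cases "q \<in> Y0 m")
      case True
      have "wt s (sp q 1, {}, q) = 0"
        using s True Y0_Y1_disj unfolding Yall_iff by (auto simp: wt_simps sp_apply)
      then show ?thesis using br_h_unitv[of "sp q 1" "{}" q s] h_G[OF q] s by (simp add: h_unitv(1)[OF True])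
    next
      case False
      then have q1: "q \<in> Y1 m n" using q by (simp add: Yall_iff)
      have "wt s (\<lambda>_. 0, {q}, q) = 0"
        using s q1 Y0_Y1_disj unfolding Yall_iff by (auto simp: wt_simps)
      then show ?thesis using br_h_unitv[of "\<lambda>_. 0" "{q}" q s] h_G[OF q] s by (simp add: h_unitv(2)[OF q1])
    qed
    have "br (\<phi> (h s)) (h q) d + br (h s) (\<phi> (h q)) d = 0"
      using fun_cong[OF derD(3)[OF der h_G[OF s] h_G[OF q]], of d] by (simp add: 0 der_zero[OF der])
    moreover have "br (\<phi> (h s)) (h q) d = - (wt q d * \<phi> (h s) d)"
      using br_skew[OF der_G[OF der h_G[OF s]] h_G[OF q]] by (simp add: br_h[OF q der_G[OF der h_G[OF s]]])
    ultimately show ?thesis by (simp add: br_h[OF s der_G[OF der h_G[OF q]]] eq_neg_iff_add_eq_0)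
  qed
  have E: "E \<in> G"
    unfolding Weven_def
  proof (intro CollectI allI impI)
    fix d assume nz: "E d \<noteq> 0"
    then have ex: "\<exists>s. s \<in> Ya \<and> wt s d \<noteq> 0" by (auto simp: E_def split: if_splits)
    let ?s = "SOME s. s \<in> Ya \<and> wt s d \<noteq> 0"
    have s: "?s \<in> Ya" using someI_ex[OF ex] by blast
    have "\<phi> (h ?s) d \<noteq> 0" using nz by (auto simp: E_def split: if_splits)
    then show "d \<in> B \<and> wpar m d = 0" using der_G[OF der h_G[OF s]] unfolding Weven_def by blast
  qed
  let ?\<psi> = "\<lambda>X d. \<phi> X d - br E X d"
  have der': "der ?\<psi>" by (intro der_minus der der_ad E)
  have \<psi>h: "?\<psi> (h s) d = \<phi> (h s) d + wt s d * E d" if "s \<in> Ya" for s d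
    using br_skew[OF E h_G[OF that]] by (simp add: br_h[OF that E])
  have w0: "wt q d = 0" if nz: "?\<psi> (h s) d \<noteq> 0" and s: "s \<in> Ya" and q: "q \<in> Ya" for s q d
  proof (rule ccontr)
    assume "wt q d \<noteq> 0"
    then have ex: "\<exists>s. s \<in> Ya \<and> wt s d \<noteq> 0" using q by blast
    let ?s = "SOME s. s \<in> Ya \<and> wt s d \<noteq> 0"
    have s': "?s \<in> Ya" "wt ?s d \<noteq> 0" using someI_ex[OF ex] by blast+
    have Ed: "E d = - (\<phi> (h ?s) d / wt ?s d)" using ex by (auto simp: E_def)
    have "\<phi> (h s) d + wt s d * E d = 0"
      using comm[OF s s'(1), of d] s'(2) unfolding Ed by (simp add: field_simps)
    then show False using nz \<psi>h[OF s] by simp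
  qed
  have "?\<psi> (h s) = (\<lambda>d. 0)" if s: "s \<in> Ya" for s
  proof (rule weight_0_central)
    show ZG: "?\<psi> (h s) \<in> G" by (rule der_G[OF der' h_G[OF s]])
    show "wt q d = 0" if "?\<psi> (h s) d \<noteq> 0" "q \<in> Ya" for q d by (rule w0[OF that(1) s that(2)])
    fix \<alpha> u r assume X: "e \<alpha> u r \<in> G"
    let ?X = "e \<alpha> u r" and ?w = "wt s (\<alpha>, u, r)"
    \<comment> \<open>Two complementary facts about Z = \<psi>(h_s). Since Z has weight 0, [Z, X]
      lives in coordinates of weight w (fact \<open>a\<close>). Applying \<psi> to [h_s, X] = w X
      gives (w - wt s d) \<psi>(X) d = [Z, X] d, so [Z, X] vanishes in those coordinates too (fact
      \<open>b\<close>).\<close>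
    have "br (h s) (?\<psi> (h s)) = (\<lambda>d. 0)"
      using w0[OF _ s s] by (auto simp: br_h[OF s ZG] fun_eq_iff)
    then have a: "br (h s) (br (?\<psi> (h s)) ?X) = (\<lambda>d. ?w * br (?\<psi> (h s)) ?X d)"
      unfolding br_derivation[OF h_G[OF s] ZG X] br_h_unitv[OF X s] br_scale by simp
    have b: "?w * ?\<psi> ?X d = br (?\<psi> (h s)) ?X d + wt s d * ?\<psi> ?X d" for d
      using derD(3)[OF der' h_G[OF s] X] unfolding br_h_unitv[OF X s] br_h[OF s der_G[OF der' X]] der_scale[OF der' X]
      by (rule fun_cong)
    show "br (?\<psi> (h s)) ?X = (\<lambda>d. 0)"
    proof
      fix d
      have "wt s d * br (?\<psi> (h s)) ?X d = ?w * br (?\<psi> (h s)) ?X d"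
        using fun_cong[OF a, of d] unfolding br_h[OF s br_G[OF ZG X]] .
      then show "br (?\<psi> (h s)) ?X d = 0" using b[of d] by (cases "wt s d = ?w") simp_all
    qed
  qed
  then show thesis using E that by (auto simp: kills_h_def)
qed

lemma mul_unitv0:
  assumes f: "inA f" and v: "v \<subseteq> Y1 m n"
  shows "(f \<star> unitv (\<lambda>_. 0, v)) (\<gamma>, w) = (if v \<subseteq> w then sg (w - v) v * f (\<gamma>, w - v) else 0)"
    "(unitv (\<lambda>_. 0, v) \<star> f) (\<gamma>, w) = (if v \<subseteq> w then sg v (w - v) * f (\<gamma>, w - v) else 0)"
proof -
  have *: "(unitv a \<star> unitv (\<lambda>_. 0, v)) (\<gamma>, w) = (if a = (\<gamma>, w - v) then if v \<subseteq> w then sg (w - v) v else 0 else 0)"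
    "(unitv (\<lambda>_. 0, v) \<star> unitv a) (\<gamma>, w) = (if a = (\<gamma>, w - v) then if v \<subseteq> w then sg v (w - v) else 0 else 0)" if "a \<in> A" for a
  proof -
    obtain \<alpha> u where a: "a = (\<alpha>, u)" by (cases a)
    have "u \<inter> v = {} \<and> w = u \<union> v \<longleftrightarrow> u = w - v \<and> v \<subseteq> w" "v \<inter> u = {} \<and> w = v \<union> u \<longleftrightarrow> u = w - v \<and> v \<subseteq> w" by auto
    then show "(unitv a \<star> unitv (\<lambda>_. 0, v)) (\<gamma>, w) = (if a = (\<gamma>, w - v) then if v \<subseteq> w then sg (w - v) v else 0 else 0)"
      "(unitv (\<lambda>_. 0, v) \<star> unitv a) (\<gamma>, w) = (if a = (\<gamma>, w - v) then if v \<subseteq> w then sg v (w - v) else 0 else 0)"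
      using mul_unitv[OF that[unfolded a] zero_A[OF v]] mul_unitv[OF zero_A[OF v] that[unfolded a]]
      by (auto simp: a unitv_apply)
  qed
  have "(f \<star> unitv (\<lambda>_. 0, v)) (\<gamma>, w) = (\<Sum>a\<in>A. if a = (\<gamma>, w - v) then f a * (if v \<subseteq> w then sg (w - v) v else 0) else 0)"
    unfolding amul_expand_left[of f] by (intro sum.cong refl) (simp add: *)
  also have "\<dots> = (if v \<subseteq> w then sg (w - v) v * f (\<gamma>, w - v) else 0)"
    using f by (auto simp: inA_def)
  finally show "(f \<star> unitv (\<lambda>_. 0, v)) (\<gamma>, w) = (if v \<subseteq> w then sg (w - v) v * f (\<gamma>, w - v) else 0)" .
  have "(unitv (\<lambda>_. 0, v) \<star> f) (\<gamma>, w) = (\<Sum>a\<in>A. if a = (\<gamma>, w - v) then f a * (if v \<subseteq> w then sg v (w - v) else 0) else 0)"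
    unfolding amul_expand_right[of _ f] by (intro sum.cong refl) (simp add: *)
  also have "\<dots> = (if v \<subseteq> w then sg v (w - v) * f (\<gamma>, w - v) else 0)"
    using f by (auto simp: inA_def)
  finally show "(unitv (\<lambda>_. 0, v) \<star> f) (\<gamma>, w) = (if v \<subseteq> w then sg v (w - v) * f (\<gamma>, w - v) else 0)" .
qed

lemma br_Dvec_unitv:
  assumes "e \<alpha> u r \<in> G" "i \<in> Y0 m"
  shows "br (Dvec i) (e \<alpha> u r) = (\<lambda>d. of_bool (\<alpha> i \<noteq> 0) * e (\<alpha>(i := \<alpha> i - 1)) u r d)"
proof
  fix d :: wmon
  obtain \<beta> v q where d: "d = (\<beta>, v, q)" by (cases d)
  have "\<beta>(i := Suc (\<beta> i)) = \<alpha> \<longleftrightarrow> \<alpha> i \<noteq> 0 \<and> \<beta> = \<alpha>(i := \<alpha> i - 1)"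
    by (auto simp: fun_eq_iff)
  then show "br (Dvec i) (e \<alpha> u r) d = of_bool (\<alpha> i \<noteq> 0) * e (\<alpha>(i := \<alpha> i - 1)) u r d"
    unfolding d br_Dvec[OF assms(2,1)] by (auto simp: unitv_apply)
qed

lemma Dvec_unitv: "Dvec i = e (\<lambda>_. 0) {} i"
  by (simp add: Dvec_def)

text \<open>Tests Z against a substitute for the odd derivatives: the coefficient at x_k x_l D_j
  collects the diagonal parts x_k D_k and x_l D_l of Z, corrected by what D_j does to the
  D_j-component. The signs of removing and restoring an odd variable cancel.\<close>

lemma br_pair_coeff:
  assumes Z: "Z \<in> G" and kl: "k \<in> Y1 m n" "l \<in> Y1 m n" "k \<noteq> l" and j: "j \<in> Y0 m"
  shows "br Z (e (\<lambda>_. 0) {k, l} j) (\<gamma>, {k, l}, j) = Z (\<gamma>, {k}, k) + Z (\<gamma>, {l}, l) - Z (\<gamma>(j := Suc (\<gamma> j)), {}, j)"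
proof -
  have A: "(\<lambda>_. 0, {k, l}) \<in> A" using kl by (simp add: zero_A)
  note X = pair_G[OF kl j]
  have i: "inA (cf Z r)" for r using G_cfD(1)[OF Z] .
  have D0: "D r (unitv (\<lambda>_. 0, {k, l})) = (\<lambda>c. 0)" if "r \<in> Y0 m" for r
    using D_unitv_Y0[OF A that] by simp
  have D1: "D r (unitv (\<lambda>_. 0, {k, l})) = (\<lambda>c. of_bool (r \<in> {k, l}) * sg {r} ({k, l} - {r}) * unitv (\<lambda>_. 0, {k, l} - {r}) c)" if "r \<in> Y1 m n" for r
    using D_unitv_Y1[OF A that] .
  have "(cf Z r \<star> D r (unitv (\<lambda>_. 0, {k, l}))) (\<gamma>, {k, l}) = (if r \<in> {k, l} then Z (\<gamma>, {r}, r) else 0)" if r: "r \<in> Ya" for r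
  proof (cases "r \<in> Y0 m")
    case True
    then show ?thesis using D0 kl Y0_Y1_disj by auto
  next
    case False
    then have r1: "r \<in> Y1 m n" using r by (simp add: Yall_iff)
    show ?thesis
    proof (cases "r \<in> {k, l}")
      case True
      have s: "{k, l} - {r} \<subseteq> Y1 m n" "{k, l} - ({k, l} - {r}) = {r}" using kl True by auto
      show ?thesis unfolding D1[OF r1] amul_scale_right mul_unitv0(1)[OF i s(1)] s(2)
        using True by (simp add: cf_def mult.assoc[symmetric] sg_square)
    next
      case False
      then show ?thesis by (simp add: D1[OF r1])
    qed
  qed
  then have "act Z (unitv (\<lambda>_. 0, {k, l})) (\<gamma>, {k, l}) = (\<Sum>r\<in>Ya. if r \<in> {k, l} then Z (\<gamma>, {r}, r) else 0)"
    by (simp add: act_def cong: sum.cong)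
  also have "\<dots> = (\<Sum>r\<in>{k, l}. Z (\<gamma>, {r}, r))"
    using kl by (intro sum.mono_neutral_cong_right) (auto simp: Ya_I)
  finally have 1: "act Z (unitv (\<lambda>_. 0, {k, l})) (\<gamma>, {k, l}) = Z (\<gamma>, {k}, k) + Z (\<gamma>, {l}, l)"
    using kl by simp
  have 2: "act (e (\<lambda>_. 0) {k, l} j) (cf Z j) (\<gamma>, {k, l}) = Z (\<gamma>(j := Suc (\<gamma> j)), {}, j)"
    unfolding El_unitv[symmetric] act_El[OF Ya_I(1)[OF j]]
    using mul_unitv0(2)[OF inA_D[OF Ya_I(1)[OF j]], of "{k, l}" "cf Z j" \<gamma> "{k, l}"] kl D_Y0[OF i j]
    by (simp add: cf_def)
  have "br Z (e (\<lambda>_. 0) {k, l} j) (\<gamma>, {k, l}, j) = cf (br Z (e (\<lambda>_. 0) {k, l} j)) j (\<gamma>, {k, l})"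
    by (simp add: cf_def)
  also have "\<dots> = act Z (unitv (\<lambda>_. 0, {k, l})) (\<gamma>, {k, l}) - act (e (\<lambda>_. 0) {k, l} j) (cf Z j) (\<gamma>, {k, l})"
    unfolding cf_br[OF Z X] by (simp add: cf_El flip: El_unitv)
  finally show ?thesis unfolding 1 2 .
qed

lemma reduce_D:
  assumes der: "der \<phi>" and kh: "kills_h \<phi>"
  obtains E where "E \<in> G" "kills_h (\<lambda>X d. \<phi> X d - br E X d)" "kills_D (\<lambda>X d. \<phi> X d - br E X d)"
proof -
  define Z where "Z i = \<phi> (Dvec i)" for i
  have ZG: "Z i \<in> G" if "i \<in> Y0 m" for i unfolding Z_def by (rule der_G[OF der Dvec_G[OF that]])
  have Zw: "wt s d = wt s (\<lambda>_. 0, {}, i)" if "Z i d \<noteq> 0" "i \<in> Y0 m" "s \<in> Ya" for i d s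
    using der_weight[OF der that(3) _ Dvec_G[OF that(2), unfolded Dvec_unitv]] that kh
    by (simp add: Z_def Dvec_unitv kills_h_def)
  \<comment> \<open>The closedness condition of a Poincare lemma, from [D_i, D_j] = 0.\<close>
  have closed: "Z i (\<alpha>(j := Suc (\<alpha> j)), u, r) = Z j (\<alpha>(i := Suc (\<alpha> i)), u, r)"
    if ij: "i \<in> Y0 m" "j \<in> Y0 m" for i j \<alpha> u r
  proof -
    have "br (Dvec i) (Dvec j) = (\<lambda>d. 0)"
      using br_Dvec_unitv[OF Dvec_G[OF ij(2), unfolded Dvec_unitv] ij(1)] by (simp add: Dvec_unitv)
    then have "br (Z i) (Dvec j) (\<alpha>, u, r) + br (Dvec i) (Z j) (\<alpha>, u, r) = 0"
      using fun_cong[OF derD(3)[OF der Dvec_G[OF ij(1)] Dvec_G[OF ij(2)]]] by (simp add: Z_def der_zero[OF der])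
    then show ?thesis
      unfolding br_skew[OF ZG[OF ij(1)] Dvec_G[OF ij(2)]] br_Dvec[OF ij(1) ZG[OF ij(2)]] br_Dvec[OF ij(2) ZG[OF ij(1)]]
      by simp
  qed
  have overflow: "X (\<alpha>, u, r) = 0" if "X \<in> G" "i \<in> Y0 m" "\<alpha> i \<ge> p ^ t i" for X \<alpha> u r i
    using G_D(2)[OF that(1), of \<alpha> u r] AI_less[OF _ that(2), of \<alpha>] that(3) by (meson not_less)
  \<comment> \<open>If \<alpha>_i is maximal and some other exponent is positive, closedness moves
    the coefficient to an index whose i-th exponent is p^(t_i), outside the basis.\<close>
  have top1: "\<alpha> j = 0" if i: "i \<in> Y0 m" and nz: "Z i (\<alpha>, u, r) \<noteq> 0" and ai: "\<alpha> i = p ^ t i - 1" and j: "j \<noteq> i" for i j \<alpha> u r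
  proof (rule ccontr)
    assume aj: "\<alpha> j \<noteq> 0"
    then have j0: "j \<in> Y0 m" using G_D(2)[OF ZG[OF i] nz] by (auto simp: AI_iff)
    let ?\<beta> = "\<alpha>(j := \<alpha> j - 1)"
    have e: "?\<beta>(j := Suc (?\<beta> j)) = \<alpha>" using aj by (simp add: fun_upd_idem)
    have "Z i (\<alpha>, u, r) = Z j (?\<beta>(i := Suc (?\<beta> i)), u, r)" using closed[OF i j0, of ?\<beta> u r] unfolding e .
    also have "\<dots> = 0" by (rule overflow[OF ZG[OF j0] i]) (use ai j in simp)
    finally show False using nz by simp
  qed
  \<comment> \<open>The antiderivative of a top power of x_i would leave the truncated range, so
    these coefficients must vanish. What \<open>top1\<close> leaves are pure top powers; weights
    reduce them to multiples of x_r D_r with r odd, as p^(t_i) - 1 is -1 and not 0 in the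
    field.\<close>
  have top: "Z i (\<alpha>, u, r) = 0" if i: "i \<in> Y0 m" and ai: "\<alpha> i = p ^ t i - 1" for i \<alpha> u r
  proof (rule ccontr)
    assume nz: "Z i (\<alpha>, u, r) \<noteq> 0"
    have a0: "\<alpha> j = 0" if "j \<noteq> i" for j using top1[OF i nz ai that] .
    have r: "r \<in> Y1 m n"
    proof (rule ccontr)
      assume "r \<notin> Y1 m n"
      then have r0: "r \<in> Y0 m" using G_D(4)[OF ZG[OF i] nz] by (simp add: Yall_iff)
      have w: "of_nat (\<alpha> r) - 1 = (- of_bool (r = i) :: 'a)"
        using Zw[OF nz i, of r] wt_simps(1)[OF r0] r0 by (simp add: Ya_I)
      show False
      proof (cases "r = i")
        case True
        then have "(of_nat (p ^ t i - 1) :: 'a) = 0" using w ai by simp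
        then have "p dvd p ^ t i - 1" using of_nat_eq_0_iff_p by blast
        moreover have "p dvd p ^ t i" using t_ge[OF i] by (simp add: dvd_power)
        ultimately have "p dvd 1" using p_le_power[OF i] p_gt dvd_diff_nat[of p "p ^ t i" "p ^ t i - 1"] by simp
        then show False using p_gt by simp
      next
        case False
        then show False using w a0[of r] by simp
      qed
    qed
    have "wt s (\<alpha>, u, r) = 0" if "s \<in> Y1 m n" for s
      using Zw[OF nz i, of s] wt_simps(2)[OF that] that i Y0_Y1_disj by (auto simp: Ya_I)
    then have u: "u = {r}" using G_Y1_weight_0[OF ZG[OF i] nz] r by simp
    \<comment> \<open>With j different from i, D_i commutes with x_k x_l D_j. At this index [D_i, _]
      has no coefficient, because it would come from the exponent p^(t_i), and the correction term
      of \<open>br_pair_coeff\<close> vanishes by \<open>top1\<close>.\<close>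
    obtain j where j: "j \<in> Y0 m" "j \<noteq> i" using Y0_other by blast
    have "Z i (\<alpha>, {k}, k) + Z i (\<alpha>, {l}, l) = 0" if kl: "k \<in> Y1 m n" "l \<in> Y1 m n" "k \<noteq> l" for k l
    proof -
      note X = pair_G[OF kl j(1)]
      have "br (Dvec i) (e (\<lambda>_. 0) {k, l} j) = (\<lambda>d. 0)"
        using br_Dvec_unitv[OF X i] by simp
      then have "br (Z i) (e (\<lambda>_. 0) {k, l} j) (\<alpha>, {k, l}, j) + br (Dvec i) (\<phi> (e (\<lambda>_. 0) {k, l} j)) (\<alpha>, {k, l}, j) = 0"
        using fun_cong[OF derD(3)[OF der Dvec_G[OF i] X]] by (simp add: Z_def der_zero[OF der])
      moreover have "br (Dvec i) (\<phi> (e (\<lambda>_. 0) {k, l} j)) (\<alpha>, {k, l}, j) = 0"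
        unfolding br_Dvec[OF i der_G[OF der X]] by (rule overflow[OF der_G[OF der X] i]) (simp add: ai)
      moreover have "Z i (\<alpha>(j := Suc (\<alpha> j)), {}, j) = 0"
        using top1[OF i _ _ j(2), of "\<alpha>(j := Suc (\<alpha> j))" "{}" j] ai j(2) by auto
      ultimately show ?thesis using br_pair_coeff[OF ZG[OF i] kl j(1), of \<alpha>] by simp
    qed
    from pairwise_sums_zero[of "\<lambda>k. Z i (\<alpha>, {k}, k)", OF this r] show False using nz u by simp
  qed
  \<comment> \<open>Integration along any one variable that occurs; closedness makes the result
    independent of it (\<open>E_eq\<close>). The minus sign reflects [E, D_i] = -[D_i, E].\<close>
  define E where "E = (\<lambda>(\<alpha>, u, r). if \<exists>i\<in>Y0 m. \<alpha> i \<noteq> 0 then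
     - Z (SOME i. i \<in> Y0 m \<and> \<alpha> i \<noteq> 0) (\<alpha>((SOME i. i \<in> Y0 m \<and> \<alpha> i \<noteq> 0) := \<alpha> (SOME i. i \<in> Y0 m \<and> \<alpha> i \<noteq> 0) - 1), u, r) else 0)"
  have E_eq: "E (\<alpha>, u, r) = - Z i (\<alpha>(i := \<alpha> i - 1), u, r)" if i: "i \<in> Y0 m" "\<alpha> i \<noteq> 0" for i \<alpha> u r
  proof -
    let ?j = "SOME i. i \<in> Y0 m \<and> \<alpha> i \<noteq> 0"
    have j: "?j \<in> Y0 m \<and> \<alpha> ?j \<noteq> 0" by (rule someI[of "\<lambda>i. i \<in> Y0 m \<and> \<alpha> i \<noteq> 0" i]) (use i in simp)
    have "Z ?j (\<alpha>(?j := \<alpha> ?j - 1), u, r) = Z i (\<alpha>(i := \<alpha> i - 1), u, r)"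
    proof (cases "?j = i")
      case False
      let ?\<beta> = "\<alpha>(i := \<alpha> i - 1, ?j := \<alpha> ?j - 1)"
      have "?\<beta>(i := Suc (?\<beta> i)) = \<alpha>(?j := \<alpha> ?j - 1)" "?\<beta>(?j := Suc (?\<beta> ?j)) = \<alpha>(i := \<alpha> i - 1)"
        using False i(2) j by (auto simp: fun_eq_iff)
      then show ?thesis using closed[of ?j i ?\<beta> u r] i(1) j by simp
    qed simp
    then show ?thesis using i by (auto simp: E_def)
  qed
  have Enz: "\<exists>i\<in>Y0 m. \<alpha> i \<noteq> 0 \<and> Z i (\<alpha>(i := \<alpha> i - 1), u, r) \<noteq> 0" if "E (\<alpha>, u, r) \<noteq> 0" for \<alpha> u r
  proof -
    obtain i where "i \<in> Y0 m" "\<alpha> i \<noteq> 0" using \<open>E (\<alpha>, u, r) \<noteq> 0\<close> by (auto simp: E_def split: if_splits)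
    then show ?thesis using E_eq[of i \<alpha> u r] that by auto
  qed
  have EG: "E \<in> G"
    unfolding Weven_def
  proof (intro CollectI allI impI)
    fix d assume nz: "E d \<noteq> 0"
    obtain \<alpha> u r where d: "d = (\<alpha>, u, r)" by (cases d)
    obtain i where i: "i \<in> Y0 m" "\<alpha> i \<noteq> 0" and nz: "Z i (\<alpha>(i := \<alpha> i - 1), u, r) \<noteq> 0" using Enz nz d by blast
    note G = G_D[OF ZG[OF i(1)] nz]
    have "\<alpha> i - 1 \<noteq> p ^ t i - 1" using top[OF i(1), of "\<alpha>(i := \<alpha> i - 1)" u r] nz by auto
    moreover have "\<alpha> i - 1 < p ^ t i" using AI_less[OF G(2) i(1)] by simp
    ultimately have "\<alpha> i < p ^ t i" using i(2) by linarith
    have "\<alpha> \<in> AI"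
    proof (rule AI_I)
      fix j
      show "\<alpha> j = 0" if "j \<notin> Y0 m" using G(2) that i(1) unfolding AI_iff by (metis fun_upd_other)
      show "\<alpha> j < p ^ t j" if "j \<in> Y0 m"
        using AI_less[OF G(2) that] \<open>\<alpha> i < p ^ t i\<close> by (cases "j = i") auto
    qed
    then show "d \<in> B \<and> wpar m d = 0" using G by (simp add: d mem_B A_iff wpar_def ev_def)
  qed
  \<comment> \<open>Raising the i-th exponent offsets the weight of D_i exactly, so E has weight 0
    and subtracting ad E keeps the torus killed.\<close>
  have Ew: "wt s d = 0" if nz: "E d \<noteq> 0" and s: "s \<in> Ya" for s d
  proof -
    obtain \<alpha> u r where d: "d = (\<alpha>, u, r)" by (cases d)
    obtain i where i: "i \<in> Y0 m" "\<alpha> i \<noteq> 0" and nz: "Z i (\<alpha>(i := \<alpha> i - 1), u, r) \<noteq> 0" using Enz nz d by blast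
    have *: "wt s (\<alpha>(i := \<alpha> i - 1), u, r) = wt s (\<lambda>_. 0, {}, i)" using Zw[OF nz i(1) s] .
    show ?thesis
    proof (cases "s \<in> Y0 m")
      case True
      have "of_nat (\<alpha> i - Suc 0) = (of_nat (\<alpha> i) - 1 :: 'a)" using i(2) by (simp add: of_nat_diff)
      then show ?thesis using * True unfolding d by (cases "s = i") (auto simp: wt_simps)
    next
      case False
      then have "s \<in> Y1 m n" using s by (simp add: Yall_iff)
      then show ?thesis using * i(1) False unfolding d by (auto simp: wt_simps)
    qed
  qed
  show thesis
  proof (rule that[OF EG])
    show "kills_h (\<lambda>X d. \<phi> X d - br E X d)"
      unfolding kills_h_def
    proof (intro ballI ext)
      fix s d assume s: "s \<in> Ya"
      have "br E (h s) d = - (wt s d * E d)" using br_skew[OF EG h_G[OF s]] br_h[OF s EG] by simp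
      also have "\<dots> = 0" using Ew[OF _ s, of d] by auto
      finally show "\<phi> (h s) d - br E (h s) d = 0" using kh s by (simp add: kills_h_def)
    qed
    show "kills_D (\<lambda>X d. \<phi> X d - br E X d)"
      unfolding kills_D_def
    proof (intro ballI ext)
      fix i and d :: wmon assume i: "i \<in> Y0 m"
      obtain \<alpha> u r where d: "d = (\<alpha>, u, r)" by (cases d)
      have "br E (Dvec i) d = - E (\<alpha>(i := Suc (\<alpha> i)), u, r)"
        unfolding br_skew[OF EG Dvec_G[OF i]] d br_Dvec[OF i EG] ..
      also have "\<dots> = Z i (\<alpha>, u, r)" using E_eq[OF i, of "\<alpha>(i := Suc (\<alpha> i))" u r] by simp
      finally show "\<phi> (Dvec i) d - br E (Dvec i) d = 0" by (simp add: d Z_def)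
    qed
  qed
qed

section \<open>Reduction on the polynomial vector fields\<close>

definition kills_pure :: "((wmon \<Rightarrow> 'a) \<Rightarrow> (wmon \<Rightarrow> 'a)) \<Rightarrow> bool" where
  "kills_pure \<phi> \<longleftrightarrow> (\<forall>\<alpha>\<in>AI. \<forall>j\<in>Y0 m. \<phi> (e \<alpha> {} j) = (\<lambda>d. 0))"

lemma pure_G: "\<alpha> \<in> AI \<Longrightarrow> j \<in> Y0 m \<Longrightarrow> e \<alpha> {} j \<in> G"
  by (intro unitv_G) (auto simp: A_iff Ya_I ev_def tau_simps)

lemma pure_A: "\<alpha> \<in> AI \<Longrightarrow> (\<alpha>, {}) \<in> A"
  by (simp add: A_iff)

lemma br_pure:
  assumes "\<alpha> \<in> AI" "\<beta> \<in> AI" "j \<in> Y0 m" "s \<in> Y0 m"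
  shows "br (e \<alpha> {} j) (e \<beta> {} s) = (\<lambda>d.
    of_bool (\<beta> j \<noteq> 0) * bin \<alpha> (\<beta>(j := \<beta> j - 1)) * e (\<lambda>i. \<alpha> i + (\<beta>(j := \<beta> j - 1)) i) {} s d
    - of_bool (\<alpha> s \<noteq> 0) * bin \<beta> (\<alpha>(s := \<alpha> s - 1)) * e (\<lambda>i. \<beta> i + (\<alpha>(s := \<alpha> s - 1)) i) {} j d)"
proof -
  note A = pure_A[OF assms(1)] pure_A[OF assms(2)]
  have G: "El (unitv (\<alpha>, {})) j \<in> G" "El (unitv (\<beta>, {})) s \<in> G"
    using assms pure_G by (simp_all add: El_unitv)
  show ?thesis
    using br_El[OF G Ya_I(1)[OF assms(3)] Ya_I(1)[OF assms(4)]]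
    unfolding D_unitv_Y0[OF A(1) assms(4)] D_unitv_Y0[OF A(2) assms(3)] amul_scale_right
      mul_unitv[OF A(1) sub_A[OF A(2)]] mul_unitv[OF A(2) sub_A[OF A(1)]] El_scale El_unitv
    by (simp add: mult.assoc)
qed

text \<open>By the hypothesis on lower exponents [D_i, \<phi>(X)] = \<phi>([D_i, X]) = 0, so the
  image is constant; odd weight 0 then leaves D_q and x_k D_k. The even weights give, modulo p,
  \<alpha> = \<epsilon>_j - \<epsilon>_q in the first branch and \<alpha> = \<epsilon>_j in the
  second.\<close>

lemma pure_image_supp:
  assumes der: "der \<phi>" and kh: "kills_h \<phi>" and kD: "kills_D \<phi>" and \<alpha>: "\<alpha> \<in> AI" and j: "j \<in> Y0 m"
    and IH: "\<forall>i\<in>Y0 m. \<alpha> i \<noteq> 0 \<longrightarrow> \<phi> (e (\<alpha>(i := \<alpha> i - 1)) {} j) = (\<lambda>d. 0)"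
    and nz: "\<phi> (e \<alpha> {} j) d \<noteq> 0"
  obtains q where "q \<in> Y0 m" "d = (\<lambda>_. 0, {}, q)" "\<And>s. s \<in> Y0 m \<Longrightarrow> (of_nat (\<alpha> s) - of_bool (s = j) :: 'a) = - of_bool (s = q)"
  | k where "k \<in> Y1 m n" "\<And>s. s \<in> Y0 m \<Longrightarrow> (of_nat (\<alpha> s) :: 'a) = of_bool (s = j)"
proof -
  note X = pure_G[OF \<alpha> j]
  let ?Z = "\<phi> (e \<alpha> {} j)"
  have ZG: "?Z \<in> G" by (rule der_G[OF der X])
  have D: "br (Dvec i) ?Z = (\<lambda>d. 0)" if i: "i \<in> Y0 m" for i
  proof -
    have "\<phi> (br (Dvec i) (e \<alpha> {} j)) = (\<lambda>d. 0)"
      unfolding br_Dvec_unitv[OF X i] using bspec[OF IH i] der_scale[OF der pure_G[OF AI_mono[OF \<alpha>] j], of "\<alpha>(i := \<alpha> i - 1)" 1]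
      by (cases "\<alpha> i = 0") (simp_all add: der_zero[OF der])
    then show ?thesis
      using derD(3)[OF der Dvec_G[OF i] X] kD i by (simp add: kills_D_def)
  qed
  obtain \<beta> u q where d: "d = (\<beta>, u, q)" by (cases d)
  note nz' = nz[unfolded d]
  have b: "\<beta> = (\<lambda>_. 0)" using constant_supp[OF ZG D nz'] by blast
  have w: "wt s (\<beta>, u, q) = wt s (\<alpha>, {}, j)" if "s \<in> Ya" for s
    using der_weight[OF der that _ X nz'] kh that by (simp add: kills_h_def)
  have "wt s (\<beta>, u, q) = 0" if "s \<in> Y1 m n" for s
    using w[OF Ya_I(2)[OF that]] that j Y0_Y1_disj by (auto simp: wt_simps)
  then have u: "u = (if q \<in> Y1 m n then {q} else {})" using G_Y1_weight_0[OF ZG nz'] by blast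
  have w0: "(of_nat (\<alpha> s) - of_bool (s = j) :: 'a) = - of_bool (s = q)" if "s \<in> Y0 m" for s
    using w[OF Ya_I(1)[OF that]] that b by (simp add: wt_simps)
  show thesis
  proof (cases "q \<in> Y0 m")
    case True
    then show thesis using that(1)[OF True] w0 u b d Y0_Y1_disj by (metis (full_types))
  next
    case False
    then have q: "q \<in> Y1 m n" using G_D(4)[OF ZG nz'] by (simp add: Yall_iff)
    show thesis
    proof (rule that(2)[OF q])
      fix s assume s: "s \<in> Y0 m"
      then have "s \<noteq> q" using False by auto
      then show "(of_nat (\<alpha> s) :: 'a) = of_bool (s = j)" using w0[OF s] by simp
    qed
  qed
qed

text \<open>Take b = p^v, the exact power of p in c: by the counting fact behind Sylow's theorem
  (\<open>const_p_fac\<close>), c choose p^v has the same p-multiplicity as c / p^v, namely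
  0.\<close>

lemma not_dvd_choose:
  fixes c :: nat
  assumes "0 < c" "p dvd c" "\<And>r. c \<noteq> p ^ r"
  obtains b where "0 < b" "b < c" "p dvd b" "\<not> p dvd (c choose b)"
proof -
  define v where "v = multiplicity p c"
  have nu: "\<not> is_unit p" using p_gt by simp
  obtain c' where c': "c = p ^ v * c'" "\<not> p dvd c'"
    using multiplicity_decompose'[of c p] assms(1) nu unfolding v_def by blast
  have c'0: "0 < c'" using c' assms(1) by (cases c') auto
  have "multiplicity p (p ^ v * c' choose p ^ v) = 0"
    unfolding const_p_fac[OF c'0 prime_p] using c'(2) by (rule not_dvd_imp_multiplicity_0)
  moreover have pv: "0 < p ^ v" using p_gt by simp
  then have "p ^ v \<le> c" using c'0 by (simp add: c'(1))
  then have "c choose p ^ v \<noteq> 0" by simp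
  ultimately have "\<not> p dvd (c choose p ^ v)"
    using nu c'(1) by (simp add: multiplicity_eq_zero_iff)
  moreover have "v \<noteq> 0" using assms(2) c' by (metis mult_1 power_0)
  then have "p dvd p ^ v" by simp
  moreover have "p ^ v < c" using \<open>p ^ v \<le> c\<close> assms(3)[of v] by simp
  ultimately show thesis using that pv by blast
qed

text \<open>If two coordinates are nonzero, one of them is split off and the binomial coefficient is
  1. With a single nonzero coordinate, \<open>not_dvd_choose\<close> splits its value, unless that
  is a power of p.\<close>

lemma split_exponent:
  assumes \<alpha>: "\<alpha> \<in> AI" and nz: "\<alpha> \<noteq> (\<lambda>_. 0)" and p: "\<And>s. s \<in> Y0 m \<Longrightarrow> p dvd \<alpha> s"
    and np: "\<And>i r. i \<in> Y0 m \<Longrightarrow> \<alpha> \<noteq> sp i (p ^ r)"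
  obtains \<alpha>' \<alpha>'' where "\<alpha> = (\<lambda>i. \<alpha>' i + \<alpha>'' i)" "\<alpha>' \<noteq> (\<lambda>_. 0)" "\<alpha>'' \<noteq> (\<lambda>_. 0)"
    "\<And>s. p dvd \<alpha>' s" "\<And>s. p dvd \<alpha>'' s" "bin \<alpha>' \<alpha>'' \<noteq> 0"
proof -
  obtain i where i: "\<alpha> i \<noteq> 0" using nz by auto
  then have i0: "i \<in> Y0 m" using \<alpha> by (auto simp: AI_iff)
  have ps: "p dvd \<alpha> s" for s using p[of s] \<alpha> by (cases "s \<in> Y0 m") (auto simp: AI_iff)
  show thesis
  proof (cases "\<alpha> = sp i (\<alpha> i)")
    case False
    then obtain x where "\<alpha> x \<noteq> sp i (\<alpha> i) x" by auto
    then have x: "x \<noteq> i" "\<alpha> x \<noteq> 0" by (auto simp: sp_apply split: if_splits)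
    show thesis
    proof (rule that[of "sp i (\<alpha> i)" "\<alpha>(i := 0)"])
      show "\<alpha>(i := 0) \<noteq> (\<lambda>_. 0)" using x by (metis fun_upd_other)
      show "bin (sp i (\<alpha> i)) (\<alpha>(i := 0)) \<noteq> 0" by (simp add: bin_single[OF i0])
    qed (use i ps in \<open>auto simp: sp_apply fun_eq_iff\<close>)
  next
    case True
    have "\<alpha> i \<noteq> p ^ r" for r using np[OF i0, of r] True by auto
    then obtain b where b: "0 < b" "b < \<alpha> i" "p dvd b" "\<not> p dvd (\<alpha> i choose b)"
      using not_dvd_choose[of "\<alpha> i"] i ps[of i] by auto
    show thesis
    proof (rule that[of "sp i b" "sp i (\<alpha> i - b)"])
      show "\<alpha> = (\<lambda>j. sp i b j + sp i (\<alpha> i - b) j)"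
        by (subst True) (use b in \<open>auto simp: sp_apply fun_eq_iff\<close>)
      show "bin (sp i b) (sp i (\<alpha> i - b)) \<noteq> 0"
        using b by (simp add: bin_single[OF i0] sp_apply of_nat_eq_0_iff_p)
    qed (use b ps[of i] in \<open>auto simp: sp_apply fun_eq_iff\<close>)
  qed
qed

abbreviation deg :: "(nat \<Rightarrow> nat) \<Rightarrow> nat" where "deg \<alpha> \<equiv> sum \<alpha> (Y0 m)"

lemma deg_sp: "i \<in> Y0 m \<Longrightarrow> deg (sp i c) = c"
  by (simp add: sp_apply sum.delta)

lemma le_deg: "i \<in> Y0 m \<Longrightarrow> \<alpha> i \<le> deg \<alpha>"
  by (rule member_le_sum) auto

lemma deg_pos: "\<alpha> \<in> AI \<Longrightarrow> \<alpha> \<noteq> (\<lambda>_. 0) \<Longrightarrow> (\<And>s. p dvd \<alpha> s) \<Longrightarrow> p \<le> deg \<alpha>"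
proof -
  assume a: "\<alpha> \<in> AI" "\<alpha> \<noteq> (\<lambda>_. 0)" "\<And>s. p dvd \<alpha> s"
  then obtain i where i: "\<alpha> i \<noteq> 0" by auto
  then have "i \<in> Y0 m" using a by (auto simp: AI_iff)
  then show ?thesis using le_deg[of i \<alpha>] a(3)[of i] i by (meson dvd_imp_le gr0I le_trans)
qed

lemma deg_sub: "i \<in> Y0 m \<Longrightarrow> \<alpha> i \<noteq> 0 \<Longrightarrow> deg (\<alpha>(i := \<alpha> i - 1)) < deg \<alpha>"
  by (rule sum_strict_mono_ex1) auto

lemma of_nat_choose_2: "p dvd a \<Longrightarrow> (of_nat ((a + 1) choose 2) :: 'a) = 0"
proof -
  assume a: "p dvd a"
  have "2 * ((a + 1) choose 2) = (a + 1) * a" by (simp add: choose_two)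
  then have "(2 :: 'a) * of_nat ((a + 1) choose 2) = of_nat ((a + 1) * a)"
    by (metis of_nat_mult of_nat_numeral)
  also have "\<dots> = 0" unfolding of_nat_eq_0_iff_p using a by (rule dvd_mult)
  finally show ?thesis using two_neq_0 by simp
qed

text \<open>(a+1) times (a+b choose a+1) equals b times (a+b choose a), and a+1 is invertible modulo
  p. It removes the unwanted second term of a bracket below.\<close>

lemma of_nat_choose_Suc: "p dvd a \<Longrightarrow> p dvd b \<Longrightarrow> (of_nat ((a + b) choose Suc a) :: 'a) = 0"
proof -
  assume a: "p dvd a" and b: "p dvd b"
  have "Suc a * ((a + b) choose Suc a) = b * ((a + b) choose a)"
    using binomial_absorb_comp[of "a + b" a] binomial_absorption[of a "a + b"] by simp
  then have "p dvd Suc a * ((a + b) choose Suc a)" using b by simp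
  moreover have "\<not> p dvd Suc a" using dvd_add_right_iff[OF a, of 1] p_gt by simp
  ultimately show ?thesis unfolding of_nat_eq_0_iff_p using prime_dvd_multD[OF prime_p] by blast
qed

text \<open>Converts a weight congruence into a lower bound on the exponent, which makes room for
  the induction on the degree.\<close>

lemma of_nat_of_bool_cong: "(of_nat a :: 'a) = of_bool b \<Longrightarrow> a \<noteq> of_bool b \<Longrightarrow> p \<le> a \<and> p dvd (a - of_bool b)"
proof -
  assume *: "(of_nat a :: 'a) = of_bool b" "a \<noteq> of_bool b"
  have a0: "a \<noteq> 0" if b using * that by (cases "a = 0") auto
  then have "of_bool b \<le> a" by (cases b) auto
  then have "(of_nat (a - of_bool b) :: 'a) = 0" using * by (simp add: of_nat_diff)
  then have d: "p dvd (a - of_bool b)" by (simp add: of_nat_eq_0_iff_p)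
  moreover have "a - of_bool b > 0" using * \<open>of_bool b \<le> a\<close> by simp
  ultimately show ?thesis by (meson diff_le_self dvd_imp_le le_trans)
qed

lemma mul_sp_0: "i \<in> Y0 m \<Longrightarrow> inA g \<Longrightarrow> (unitv (sp i 1, {}) \<star> g) (\<lambda>_. 0, w) = 0"
proof -
  assume i: "i \<in> Y0 m" and g: "inA g"
  have "(unitv (sp i 1, {}) \<star> unitv a) (\<lambda>_. 0, w) = 0" if "a \<in> A" for a
  proof -
    obtain \<beta> v where a: "a = (\<beta>, v)" by (cases a)
    have "(\<lambda>j. sp i 1 j + \<beta> j) \<noteq> (\<lambda>_. 0)" by (auto simp: fun_eq_iff sp_apply intro!: exI[of _ i])
    then show ?thesis using mul_unitv[OF xf_A(1)[OF i] that[unfolded a]] by (auto simp: a unitv_apply)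
  qed
  then show ?thesis unfolding amul_expand_right[of _ g] by (simp cong: sum.cong)
qed

text \<open>Each candidate left by \<open>pure_image_supp\<close> is refuted either by writing
  x^(\<alpha>) D_j as a bracket of killed fields or by a commutation relation. Only \<alpha> = p^r
  \<epsilon>_i with j = i resists, and there \<open>norm\<close> is needed.\<close>

lemma kills_pure_if_normalised:
  assumes der: "der \<phi>" and kh: "kills_h \<phi>" and kD: "kills_D \<phi>"
    and norm: "\<And>i r. (i, r) \<in> Jset m t \<Longrightarrow> \<phi> (e (sp i (p ^ r)) {} i) (\<lambda>_. 0, {}, i) = 0"
  shows "\<alpha> \<in> AI \<Longrightarrow> j \<in> Y0 m \<Longrightarrow> \<phi> (e \<alpha> {} j) = (\<lambda>d. 0)"
proof (induction "deg \<alpha>" arbitrary: \<alpha> j rule: less_induct)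
  case less
  note \<alpha> = less.prems(1)
  have IH: "\<phi> (e \<beta> {} q) = (\<lambda>d. 0)" if "deg \<beta> < deg \<alpha>" "\<beta> \<in> AI" "q \<in> Y0 m" for \<beta> q
    using less.hyps that by blast
  have bracket: "\<phi> (br (e \<beta> {} q) (e \<gamma> {} s)) = (\<lambda>d. 0)"
    if "\<phi> (e \<beta> {} q) = (\<lambda>d. 0)" "\<phi> (e \<gamma> {} s) = (\<lambda>d. 0)" "\<beta> \<in> AI" "\<gamma> \<in> AI" "q \<in> Y0 m" "s \<in> Y0 m" for \<beta> \<gamma> q s
    using derD(3)[OF der pure_G[OF that(3,5)] pure_G[OF that(4,6)]] that(1,2) by simp
  \<comment> \<open>For \<alpha> = p^r \<epsilon>_i and j \<noteq> i the argument uses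
    [x^(\<alpha>) D_i, x_i D_j] = x^(\<alpha>) D_j, whose first factor has the same degree. So the
    case j = i has to be available first, through \<open>other\<close>.\<close>
  have main: "\<phi> (e \<alpha> {} j) = (\<lambda>d. 0)" if j: "j \<in> Y0 m"
    and other: "\<And>i r. i \<in> Y0 m \<Longrightarrow> \<alpha> = sp i (p ^ r) \<Longrightarrow> i \<noteq> j \<Longrightarrow> \<phi> (e \<alpha> {} i) = (\<lambda>d. 0)" for j
  proof (rule ccontr)
    assume contr: "\<phi> (e \<alpha> {} j) \<noteq> (\<lambda>d. 0)"
    then obtain d where nz: "\<phi> (e \<alpha> {} j) d \<noteq> 0" by (meson ext)
    have \<alpha>0: "\<alpha> \<noteq> (\<lambda>_. 0)" using contr kD j by (auto simp: kills_D_def Dvec_unitv)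
    have "\<phi> (h j) = (\<lambda>d. 0)" using kh j by (simp add: kills_h_def Ya_I)
    then have \<alpha>1: "\<alpha> \<noteq> sp j 1" unfolding h_unitv(1)[OF j] using contr by blast
    have sub: "\<phi> (e (\<alpha>(i := \<alpha> i - 1)) {} j) = (\<lambda>d. 0)" if "i \<in> Y0 m" "\<alpha> i \<noteq> 0" for i
      by (rule IH[OF deg_sub[where \<alpha> = \<alpha>, OF that] AI_mono[OF \<alpha>] j]) simp
    then have "\<forall>i\<in>Y0 m. \<alpha> i \<noteq> 0 \<longrightarrow> \<phi> (e (\<alpha>(i := \<alpha> i - 1)) {} j) = (\<lambda>d. 0)" by blast
    from pure_image_supp[OF der kh kD \<alpha> j this nz] show False
    proof cases
      case (2 k)
      \<comment> \<open>Here \<alpha> = \<epsilon>_j modulo p, and x^(\<alpha>) D_j =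
        [x^(\<alpha>-\<epsilon>_j) D_j, x_j^(2) D_j]: the first term has coefficient \<alpha>_j = 1,
        the second vanishes as a binomial (a+1 choose 2) with p dividing a. As h_j is killed,
        \<alpha> is not \<epsilon>_j itself, so both factors have smaller degree.\<close>
      have aj: "\<alpha> j \<noteq> 0" using 2(2)[OF j] by (cases "\<alpha> j = 0") auto
      let ?\<beta> = "\<alpha>(j := \<alpha> j - 1)"
      have \<beta>: "?\<beta> \<in> AI" by (rule AI_mono[OF \<alpha>]) simp
      have "p dvd ?\<beta> j"
        using 2(2)[OF j] of_nat_of_bool_cong[of "\<alpha> j" True] by (cases "\<alpha> j = 1") auto
      moreover obtain s where s: "s \<in> Y0 m" "p \<le> \<alpha> s"
      proof -
        obtain s where "\<alpha> s \<noteq> sp j 1 s" using \<alpha>1 by auto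
        then have s: "\<alpha> s \<noteq> of_bool (s = j)" by (auto simp: sp_apply)
        then have "s \<in> Y0 m" using \<alpha> j by (cases "s = j") (auto simp: AI_iff)
        then show thesis using that of_nat_of_bool_cong[OF 2(2) s] by blast
      qed
      then have "2 < deg \<alpha>" using le_deg[of s \<alpha>] p_gt by linarith
      then have "\<phi> (br (e ?\<beta> {} j) (e (sp j 2) {} j)) = (\<lambda>d. 0)"
        using IH[of "sp j 2" j] sub[OF j aj] sp1_AI(3)[OF j] \<beta> j by (intro bracket) (auto simp: deg_sp)
      moreover have "br (e ?\<beta> {} j) (e (sp j 2) {} j) = e \<alpha> {} j"
      proof -
        have e1: "(sp j 2)(j := sp j 2 j - 1) = sp j 1" by (auto simp: sp_def)
        have e2: "(\<lambda>i. ?\<beta> i + sp j 1 i) = \<alpha>" using aj by (auto simp: sp_apply fun_eq_iff)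
        have c1: "bin ?\<beta> (sp j 1) = 1"
          unfolding bin_commute[of ?\<beta>] bin_single[OF j] using \<open>p dvd ?\<beta> j\<close> by (simp add: of_nat_eq_0_iff_p)
        have c2: "of_bool (?\<beta> j \<noteq> 0) * bin (sp j 2) (?\<beta>(j := ?\<beta> j - 1)) = 0"
        proof (cases "?\<beta> j = 0")
          case False
          then have e3: "2 + (?\<beta>(j := ?\<beta> j - 1)) j = ?\<beta> j + 1" by simp
          show ?thesis unfolding bin_single[OF j] e3 of_nat_choose_2[OF \<open>p dvd ?\<beta> j\<close>] by (rule mult_zero_right)
        qed simp
        show ?thesis unfolding br_pure[OF \<beta> sp1_AI(3)[OF j] j j] e1 e2 c1 c2 by (simp add: sp_apply)
      qed
      ultimately show False using contr by simp
    next
      case (1 q)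
      show False
      proof (cases "q = j")
        case False
        \<comment> \<open>Here \<alpha>_q = -1 modulo p, so x_q x^(\<alpha>-\<epsilon>_j) has
          coefficient \<alpha>_q + 1 = 0 and [x^(\<alpha>) D_j, x_q D_j] = 0. Applying \<phi> and
          comparing constant D_j-terms shows that the D_q-coefficient of the image is 0.\<close>
        have "(of_nat (Suc (\<alpha> q)) :: 'a) = 0" using 1(3)[OF 1(1)] False by simp
        then have pd: "p dvd Suc (\<alpha> q)" by (simp only: of_nat_eq_0_iff_p)
        then have "p \<le> Suc (\<alpha> q)" by (rule dvd_imp_le) simp
        then have "1 < deg \<alpha>" using le_deg[OF 1(1), of \<alpha>] p_gt by linarith
        then have k: "\<phi> (e (sp q 1) {} j) = (\<lambda>d. 0)" 
          using IH[of "sp q 1" j] sp1_AI(1)[OF 1(1)] j 1(1) by (simp add: deg_sp)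
        note qG = pure_G[OF sp1_AI(1)[OF 1(1)] j]
        have b0: "br (e \<alpha> {} j) (e (sp q 1) {} j) = (\<lambda>d. 0)"
        proof -
          have "bin (sp q 1) (\<alpha>(j := \<alpha> j - 1)) = 0"
            unfolding bin_single[OF 1(1)] using pd False by (simp add: of_nat_eq_0_iff_p flip: of_nat_Suc)
          then show ?thesis unfolding br_pure[OF \<alpha> sp1_AI(1)[OF 1(1)] j j] using False by (simp add: sp_apply)
        qed
        let ?Z = "\<phi> (e \<alpha> {} j)"
        have ZG: "?Z \<in> G" by (rule der_G[OF der pure_G[OF \<alpha> j]])
        have "br ?Z (e (sp q 1) {} j) = (\<lambda>d. 0)"
          using derD(3)[OF der pure_G[OF \<alpha> j] qG] unfolding b0 k by (simp add: der_zero[OF der])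
        then have "cf (br ?Z (e (sp q 1) {} j)) j (\<lambda>_. 0, {}) = 0" by (simp add: cf_def)
        moreover have "cf (br ?Z (e (sp q 1) {} j)) j (\<lambda>_. 0, {}) = ?Z (\<lambda>_. 0, {}, q)"
        proof -
          have x: "unitv (sp q 1, {}) = xf q" using 1(1) by (simp add: xf_def)
          have "act ?Z (xf q) (\<lambda>_. 0, {}) = ?Z (\<lambda>_. 0, {}, q)"
            unfolding act_xf[OF ZG Ya_I(1)[OF 1(1)]] by (simp add: cf_def)
          moreover have "act (El (xf q) j) (cf ?Z j) (\<lambda>_. 0, {}) = 0"
            unfolding act_El[OF Ya_I(1)[OF j]] x[symmetric]
            by (rule mul_sp_0[OF 1(1) inA_D[OF Ya_I(1)[OF j]]])
          ultimately show ?thesis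
            unfolding cf_br[OF ZG qG] unfolding El_unitv[symmetric] x by (simp add: cf_El)
        qed
        ultimately show False using nz 1(2) by simp
      next
        case True
        have pd: "p dvd \<alpha> s" if "s \<in> Y0 m" for s
          using 1(3)[OF that] True by (auto simp: of_nat_eq_0_iff_p)
        show False
        proof (cases "\<exists>i\<in>Y0 m. \<exists>r. \<alpha> = sp i (p ^ r)")
          case True
          then obtain i r where ir: "i \<in> Y0 m" "\<alpha> = sp i (p ^ r)" by blast
          have "p dvd p ^ r" using pd[OF ir(1)] by (simp add: ir sp_apply)
          then have r0: "r \<noteq> 0" using p_gt by (cases r) auto
          have "p ^ r < p ^ t i" using AI_less[OF \<alpha> ir(1)] by (simp add: ir sp_apply)
          then have "r < t i" using p_gt by (simp add: power_less_imp_less_exp)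
          then have J: "(i, r) \<in> Jset m t" using ir r0 by (simp add: Jset_def)
          show False
          proof (cases "i = j")
            case True
            then show False using norm[OF J] nz 1(2) \<open>q = j\<close> ir(2) by simp
          next
            case False
            have "p ^ 1 \<le> p ^ r" using r0 p_gt by (intro power_increasing) auto
            then have "1 < deg \<alpha>" using p_gt by (simp add: ir(2) deg_sp[OF ir(1)])
            then have "\<phi> (e (sp i 1) {} j) = (\<lambda>d. 0)"
              using IH[of "sp i 1" j] sp1_AI(1)[OF ir(1)] j ir(1) by (simp add: deg_sp)
            then have "\<phi> (br (e \<alpha> {} i) (e (sp i 1) {} j)) = (\<lambda>d. 0)"
              using other[OF ir False] \<alpha> sp1_AI(1)[OF ir(1)] ir(1) j by (intro bracket) auto
            moreover have "br (e \<alpha> {} i) (e (sp i 1) {} j) = e \<alpha> {} j"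
            proof -
              have e1: "(sp i 1)(i := sp i 1 i - 1) = (\<lambda>_. 0)" by (auto simp: sp_def)
              have a: "\<alpha> j = 0" using False by (simp add: ir(2) sp_apply)
              show ?thesis unfolding br_pure[OF \<alpha> sp1_AI(1)[OF ir(1)] ir(1) j] e1 a by (simp add: sp_apply)
            qed
            ultimately show False using contr by simp
          qed
        next
          case False
          then have np: "\<And>i r. i \<in> Y0 m \<Longrightarrow> \<alpha> \<noteq> sp i (p ^ r)" by blast
          obtain \<alpha>' \<alpha>'' where sp: "\<alpha> = (\<lambda>i. \<alpha>' i + \<alpha>'' i)" "\<alpha>' \<noteq> (\<lambda>_. 0)" "\<alpha>'' \<noteq> (\<lambda>_. 0)"
            "\<And>s. p dvd \<alpha>' s" "\<And>s. p dvd \<alpha>'' s" "bin \<alpha>' \<alpha>'' \<noteq> 0"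
            using split_exponent[OF \<alpha> \<alpha>0 pd np] by blast
          have A': "\<alpha>' \<in> AI" "\<alpha>'' \<in> AI" by (auto intro: AI_mono[OF \<alpha>] simp: sp(1))
          have dg: "deg \<alpha> = deg \<alpha>' + deg \<alpha>''" unfolding sp(1) by (rule sum.distrib)
          have dp: "p \<le> deg \<alpha>'" "p \<le> deg \<alpha>''" using deg_pos A' sp by auto
          \<comment> \<open>Up to the factor \<open>bin \<alpha>' \<alpha>''\<close>, x^(\<alpha>)
            D_j is the bracket of x^(\<alpha>') D_j and x^(\<alpha>''+\<epsilon>_j) D_j. The raised
            exponent stays in range, since p divides both \<alpha>''_j and p^(t_j) but not
            \<alpha>''_j + 1.\<close>
          let ?\<beta> = "\<alpha>''(j := Suc (\<alpha>'' j))"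
          have "Suc (\<alpha>'' j) \<noteq> p ^ t j"
          proof
            assume *: "Suc (\<alpha>'' j) = p ^ t j"
            have "p dvd p ^ t j" using t_ge[OF j] by (simp add: dvd_power)
            then have "p dvd 1" using sp(5)[of j] * by (metis dvd_add_right_iff Suc_eq_plus1)
            then show False using p_gt by simp
          qed
          then have "Suc (\<alpha>'' j) < p ^ t j" using AI_less[OF A'(2) j] by linarith
          then have \<beta>: "?\<beta> \<in> AI" using A'(2) j by (auto simp: AI_iff)
          have "deg ?\<beta> = Suc (deg \<alpha>'')" using j by (simp add: sum.remove[of _ j])
          then have "\<phi> (br (e \<alpha>' {} j) (e ?\<beta> {} j)) = (\<lambda>d. 0)"
            using dg dp p_gt A' \<beta> j by (intro bracket IH) auto
          moreover have "br (e \<alpha>' {} j) (e ?\<beta> {} j) = (\<lambda>d. bin \<alpha>' \<alpha>'' * e \<alpha> {} j d)"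
          proof -
            have e1: "?\<beta>(j := ?\<beta> j - 1) = \<alpha>''" by simp
            have c: "of_bool (\<alpha>' j \<noteq> 0) * bin ?\<beta> (\<alpha>'(j := \<alpha>' j - 1)) = 0"
            proof (cases "\<alpha>' j = 0")
              case False
              then have "?\<beta> j + (\<alpha>'(j := \<alpha>' j - 1)) j = \<alpha>'' j + \<alpha>' j" "?\<beta> j = Suc (\<alpha>'' j)" by simp_all
              then have "of_nat ((?\<beta> j + (\<alpha>'(j := \<alpha>' j - 1)) j) choose ?\<beta> j) = (0 :: 'a)"
                using of_nat_choose_Suc[OF sp(5)[of j] sp(4)[of j]] by metis
              then show ?thesis unfolding bin_def using j by (auto intro: prod_zero)
            qed simp
            show ?thesis unfolding br_pure[OF A'(1) \<beta> j j] e1 c sp(1)[symmetric] by simp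
          qed
          ultimately have "(\<lambda>d. bin \<alpha>' \<alpha>'' * \<phi> (e \<alpha> {} j) d) = (\<lambda>d. 0)"
            using der_scale[OF der pure_G[OF \<alpha> j]] by simp
          from fun_cong[OF this, of d] show False using sp(6) nz by simp
        qed
      qed
    qed
  qed
  show ?case
  proof (rule main[OF less.prems(2)])
    fix i r assume i: "i \<in> Y0 m" "\<alpha> = sp i (p ^ r)"
    show "\<phi> (e \<alpha> {} i) = (\<lambda>d. 0)"
    proof (rule main[OF i(1)])
      \<comment> \<open>\<open>other\<close> is vacuous here: p^r is positive, so \<alpha>
        determines i.\<close>
      fix i' r' assume "\<alpha> = sp i' (p ^ r')" "i' \<noteq> i"
      then have "sp i (p ^ r) i = sp i' (p ^ r') i" using i(2) by simp
      then show "\<phi> (e \<alpha> {} i') = (\<lambda>d. 0)" using \<open>i' \<noteq> i\<close> p_gt by (simp add: sp_apply)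
    qed
  qed
qed

text \<open>In \<open>Jset\<close> r is at least 1, so each summand lowers some exponent by at least
  p. Hence subtracting outer derivations leaves the values on the D_i and on the torus
  untouched.\<close>

lemma spanop_small:
  assumes "e \<alpha> u q \<in> G" "\<And>i. i \<in> Y0 m \<Longrightarrow> \<alpha> i < p"
  shows "spanop p m n t c (e \<alpha> u q) = (\<lambda>d. 0)"
proof
  fix d :: wmon
  obtain \<beta> v s where d: "d = (\<beta>, v, s)" by (cases d)
  have "e \<alpha> u q (\<beta>(i := \<beta> i + p ^ r), v, s) = 0" if "(i, r) \<in> Jset m t" for i r
  proof -
    have ir: "i \<in> Y0 m" "r \<ge> 1" using that by (auto simp: Jset_def)
    have "p ^ 1 \<le> p ^ r" using ir p_gt by (intro power_increasing) auto
    then have "\<alpha> i < \<beta> i + p ^ r" using assms(2)[OF ir(1)] by simp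
    then have "\<beta>(i := \<beta> i + p ^ r) \<noteq> \<alpha>" by (metis fun_upd_same less_irrefl)
    then show ?thesis by (simp add: unitv_apply)
  qed
  then show "spanop p m n t c (e \<alpha> u q) d = 0"
    unfolding d spanop_apply[OF assms(1)] by (intro sum.neutral) auto
qed

lemma spanop_h: "s \<in> Ya \<Longrightarrow> spanop p m n t c (h s) = (\<lambda>d. 0)"
proof -
  assume s: "s \<in> Ya"
  show ?thesis
  proof (cases "s \<in> Y0 m")
    case True
    then show ?thesis unfolding h_unitv(1)[OF True] using h_G[OF s] p_gt
      by (intro spanop_small) (auto simp: h_unitv sp_apply)
  next
    case False
    then have s1: "s \<in> Y1 m n" using s by (simp add: Yall_iff)
    then show ?thesis unfolding h_unitv(2)[OF s1] using h_G[OF s] p_gt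
      by (intro spanop_small) (auto simp: h_unitv)
  qed
qed

text \<open>p^r \<epsilon>_i determines the pair (i, r), so the fields x_i^(p^r) D_j separate the
  outer derivations. This serves to choose the coefficients and, later, to show that the sum is
  direct.\<close>

lemma spanop_power:
  assumes J: "(i, r) \<in> Jset m t" and j: "j \<in> Y0 m"
  shows "spanop p m n t c (e (sp i (p ^ r)) {} j) (\<lambda>_. 0, {}, j) = c (i, r)"
proof -
  have i: "i \<in> Y0 m" "r < t i" using J by (auto simp: Jset_def)
  have G: "e (sp i (p ^ r)) {} j \<in> G" using i p_gt j by (intro pure_G sp_AI) auto
  have eq: "(\<lambda>_. 0)(i' := (0::nat) + p ^ r') = sp i (p ^ r) \<longleftrightarrow> (i', r') = (i, r)" for i' r'
  proof
    assume *: "(\<lambda>_. 0)(i' := (0::nat) + p ^ r') = sp i (p ^ r)"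
    have "i' = i" using fun_cong[OF *, of i'] p_gt by (auto simp: sp_apply split: if_splits)
    then show "(i', r') = (i, r)" using fun_cong[OF *, of i'] p_gt by (simp add: sp_apply)
  qed (simp add: sp_def)
  have "spanop p m n t c (e (sp i (p ^ r)) {} j) (\<lambda>_. 0, {}, j) = (\<Sum>x\<in>Jset m t. if x = (i, r) then c x else 0)"
    unfolding spanop_apply[OF G]
  proof (rule sum.cong[OF refl])
    fix x assume "x \<in> Jset m t"
    obtain i' r' where x: "x = (i', r')" by (cases x)
    show "(case x of (i', r') \<Rightarrow> c (i', r') * e (sp i (p ^ r)) {} j ((\<lambda>_. 0)(i' := 0 + p ^ r'), {}, j)) = (if x = (i, r) then c x else 0)"
      unfolding x prod.case unitv_apply prod.inject eq by simp
  qed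
  then show ?thesis using J by simp
qed

lemma reduce_pure:
  assumes der: "der \<phi>" and kh: "kills_h \<phi>" and kD: "kills_D \<phi>"
  obtains c where "kills_h (\<lambda>X d. \<phi> X d - spanop p m n t c X d)" "kills_pure (\<lambda>X d. \<phi> X d - spanop p m n t c X d)"
proof -
  \<comment> \<open>Only the D_i-coefficient of the image of x_i^(p^r) D_i is normalised; all other
    coefficients vanish by the induction in \<open>kills_pure_if_normalised\<close>.\<close>
  define c where "c = (\<lambda>(i, r). \<phi> (e (sp i (p ^ r)) {} i) (\<lambda>_. 0, {}, i))"
  let ?\<psi> = "\<lambda>X d. \<phi> X d - spanop p m n t c X d"
  have der': "der ?\<psi>" by (intro der_minus der der_spanop)
  have kh': "kills_h ?\<psi>" using kh by (simp add: kills_h_def spanop_h)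
  have kD': "kills_D ?\<psi>"
    unfolding kills_D_def
  proof (intro ballI ext)
    fix i d assume i: "i \<in> Y0 m"
    show "?\<psi> (Dvec i) d = 0"
      using kD i spanop_small[OF Dvec_G[OF i, unfolded Dvec_unitv], of c] p_gt by (simp add: kills_D_def Dvec_unitv)
  qed
  have "?\<psi> (e (sp i (p ^ r)) {} i) (\<lambda>_. 0, {}, i) = 0" if J: "(i, r) \<in> Jset m t" for i r
    using spanop_power[OF J, of i c] J by (simp add: c_def Jset_def)
  then have "kills_pure ?\<psi>"
    unfolding kills_pure_def using kills_pure_if_normalised[OF der' kh' kD'] by blast
  then show thesis using that kh' by blast
qed

section \<open>Reduction on the odd variables and generation\<close>

lemma unitv_G_iff: "e \<alpha> u r \<in> G \<longleftrightarrow> (\<alpha>, u) \<in> A \<and> r \<in> Ya \<and> ev u r"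
proof
  assume "e \<alpha> u r \<in> G"
  from G_D[OF this, of \<alpha> u r] show "(\<alpha>, u) \<in> A \<and> r \<in> Ya \<and> ev u r"
    by (simp add: unitv_apply)
qed (use unitv_G in blast)

lemma gl_G: "k \<in> Y1 m n \<Longrightarrow> l \<in> Y1 m n \<Longrightarrow> e (\<lambda>_. 0) {k} l \<in> G"
  by (intro unitv_G zero_A) (auto simp: ev_def tau_simps Ya_I)

lemma gl_eq_El: "k \<in> Y1 m n \<Longrightarrow> e (\<lambda>_. 0) {k} l = El (xf k) l"
  using Y0_Y1_disj by (auto simp: xf_def El_unitv)

lemma inA_xf: "k \<in> Ya \<Longrightarrow> inA (xf k)"
  using xf_A[of k] unfolding Yall_iff xf_def by (auto intro: inA_unitv)

lemma br_gl_gl: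
  assumes "k \<in> Y1 m n" "l \<in> Y1 m n" "q \<in> Y1 m n"
  shows "br (e (\<lambda>_. 0) {k} l) (e (\<lambda>_. 0) {l} q) = (\<lambda>d. e (\<lambda>_. 0) {k} q d - of_bool (q = k) * h l d)"
proof -
  have "br (El (xf k) l) (El (xf l) q) = (\<lambda>d. El (xf k \<star> D l (xf l)) q d - El (xf l \<star> D q (xf k)) l d)"
    using gl_G assms by (intro br_El) (auto simp: gl_eq_El[symmetric] Ya_I)
  then show ?thesis
    using assms by (auto simp: gl_eq_El D_xf Ya_I inA_xf h_def)
qed

lemma br_gl_pair:
  assumes "k \<in> Y1 m n" "l \<in> Y1 m n" "q \<in> Y1 m n" "k \<noteq> q" "l \<noteq> q" "i \<in> Y0 m"
  shows "br (e (\<lambda>_. 0) {k} l) (e (\<lambda>_. 0) {l, q} i) = (\<lambda>d. (sg {l} {q} * sg {k} {q}) * e (\<lambda>_. 0) {k, q} i d)"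
proof -
  have A: "(\<lambda>_. 0, {l, q}) \<in> A" "(\<lambda>_. 0, {q}) \<in> A" "(\<lambda>_. 0, {k}) \<in> A" using assms by (auto simp: zero_A)
  have 0: "D i (xf k) = (\<lambda>c. 0)" using assms Y0_Y1_disj D_xf[of i k] by (auto simp: Ya_I)
  have x: "xf k = unitv (\<lambda>_. 0, {k})" using assms(1) Y0_Y1_disj by (auto simp: xf_def)
  have s: "{l, q} - {l} = {q}" "{k} \<union> {q} = {k, q}" using assms by auto
  have G: "El (xf k) l \<in> G" "El (unitv (\<lambda>_. 0, {l, q})) i \<in> G"
    using gl_G[OF assms(1,2)] pair_G[OF assms(2,3,5,6)] by (simp_all only: gl_eq_El[OF assms(1)] El_unitv)
  have 1: "xf k \<star> D l (unitv (\<lambda>_. 0, {l, q})) = (\<lambda>c. (sg {l} {q} * sg {k} {q}) * unitv (\<lambda>_. 0, {k, q}) c)"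
    unfolding D_unitv_Y1[OF A(1) assms(2)] x s(1) amul_scale_right mul_unitv[OF A(3,2)] s(2)
    using assms(4) by (simp add: mult.assoc)
  show ?thesis
    using br_El[OF G Ya_I(2)[OF assms(2)] Ya_I(1)[OF assms(6)]]
    unfolding 0 1 gl_eq_El[OF assms(1)] by (simp add: El_unitv El_scale)
qed

lemma br_pair_gl0:
  assumes "k \<in> Y1 m n" "l \<in> Y1 m n" "k \<noteq> l" "i \<in> Y0 m" "j \<in> Y0 m"
  shows "br (e (\<lambda>_. 0) {k, l} i) (e (sp i 1) {} j) = e (\<lambda>_. 0) {k, l} j"
proof -
  have A: "(\<lambda>_. 0, {k, l}) \<in> A" using assms by (auto simp: zero_A)
  have x: "e (sp i 1) {} j = El (xf i) j" using assms(4) by (simp add: xf_def El_unitv)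
  have "br (El (unitv (\<lambda>_. 0, {k, l})) i) (El (xf i) j) = (\<lambda>d. El (unitv (\<lambda>_. 0, {k, l}) \<star> D i (xf i)) j d - El (xf i \<star> D j (unitv (\<lambda>_. 0, {k, l}))) i d)"
    using pair_G[OF assms(1-4)] pure_G[OF sp1_AI(1)[OF assms(4)] assms(5)] Ya_I(1) assms(4,5) unfolding x
    by (intro br_El) (simp_all add: El_unitv)
  then show ?thesis
    unfolding x El_unitv using D_unitv_Y0[OF A assms(5)] assms inA_unitv[OF A] by (simp add: D_xf Ya_I El_unitv)
qed

lemma kills_pureD: "kills_pure \<phi> \<Longrightarrow> \<alpha> \<in> AI \<Longrightarrow> j \<in> Y0 m \<Longrightarrow> \<phi> (e \<alpha> {} j) = (\<lambda>d. 0)"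
  by (simp add: kills_pure_def)

lemma kills_pure_D: "kills_pure \<phi> \<Longrightarrow> i \<in> Y0 m \<Longrightarrow> \<phi> (Dvec i) = (\<lambda>d. 0)"
  by (simp add: Dvec_unitv kills_pureD)

lemma image_constant:
  assumes der: "der \<phi>" and kp: "kills_pure \<phi>" and X: "X \<in> G"
    and DX: "\<And>i. i \<in> Y0 m \<Longrightarrow> \<phi> (br (Dvec i) X) = (\<lambda>d. 0)" and nz: "\<phi> X (\<beta>, u, q) \<noteq> 0"
  shows "\<beta> = (\<lambda>_. 0)"
proof (rule constant_supp[OF der_G[OF der X] _ nz])
  fix i assume i: "i \<in> Y0 m"
  show "br (Dvec i) (\<phi> X) = (\<lambda>d. 0)"
    using derD(3)[OF der Dvec_G[OF i] X] DX[OF i] kills_pure_D[OF kp i] by simp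
qed

lemma image_constant_unitv:
  assumes der: "der \<phi>" and kp: "kills_pure \<phi>" and X: "e (\<lambda>_. 0) v r \<in> G" and nz: "\<phi> (e (\<lambda>_. 0) v r) (\<beta>, u, q) \<noteq> 0"
  shows "\<beta> = (\<lambda>_. 0)"
  by (rule image_constant[OF der kp X _ nz]) (simp add: br_Dvec_unitv[OF X] der_zero[OF der])

lemma one_neq_minus_one: "(1 :: 'a) \<noteq> - 1"
proof
  assume "(1 :: 'a) = - 1"
  then have "(1 :: 'a) + 1 = 0" by (simp only: eq_neg_iff_add_eq_0)
  then show False using two_neq_0 by simp
qed

lemma single_support:
  fixes Z :: "wmon \<Rightarrow> 'a"
  assumes "\<And>d. Z d \<noteq> 0 \<Longrightarrow> d = d0"
  shows "Z = (\<lambda>d. Z d0 * unitv d0 d)"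
proof
  fix d show "Z d = Z d0 * unitv d0 d" using assms[of d] by (cases "d = d0") (auto simp: unitv_apply)
qed

lemma gl_eigen:
  assumes der: "der \<phi>" and kh: "kills_h \<phi>" and kp: "kills_pure \<phi>" and k: "k \<in> Y1 m n" and l: "l \<in> Y1 m n"
  shows "\<phi> (e (\<lambda>_. 0) {k} l) = (\<lambda>d. \<phi> (e (\<lambda>_. 0) {k} l) (\<lambda>_. 0, {k}, l) * e (\<lambda>_. 0) {k} l d)"
proof (cases "k = l")
  case True
  have "\<phi> (h l) = (\<lambda>d. 0)" using kh l by (simp add: kills_h_def Ya_I)
  then show ?thesis unfolding h_unitv(2)[OF l] True by simp
next
  case False
  note X = gl_G[OF k l]
  have "d = (\<lambda>_. 0, {k}, l)" if nz: "\<phi> (e (\<lambda>_. 0) {k} l) d \<noteq> 0" for d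
  proof -
    obtain \<beta> v q where d: "d = (\<beta>, v, q)" by (cases d)
    note nz = nz[unfolded d]
    have b: "\<beta> = (\<lambda>_. 0)" by (rule image_constant_unitv[OF der kp X nz])
    have w: "wt s (\<beta>, v, q) = wt s (\<lambda>_. 0, {k}, l)" if "s \<in> Ya" for s
      using der_weight[OF der that _ X nz] kh that by (simp add: kills_h_def)
    \<comment> \<open>The h_l-weight is -1. It differs from 0 and 1 since p > 2, so only fields
      along D_l attain it.\<close>
    have ql: "q = l"
      using w[OF Ya_I(2)[OF l]] l False one_neq_minus_one by (auto simp: wt_simps split: if_splits simp: of_bool_def)
    have "s \<in> v \<longleftrightarrow> s = k" if "s \<in> Y1 m n" for s
      using w[OF Ya_I(2)[OF that]] that by (simp add: wt_simps ql of_bool_eq_iff)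
    then have "v = {k}" using G_D(3)[OF der_G[OF der X] nz] k by auto
    then show ?thesis by (simp add: d b ql)
  qed
  then show ?thesis by (rule single_support)
qed

text \<open>The image is constant, so among even weights only D_i has h_i-weight -1; the odd weights
  then fix the exterior factor.\<close>

lemma pair_eigen:
  assumes der: "der \<phi>" and kh: "kills_h \<phi>" and kp: "kills_pure \<phi>"
    and kl: "k \<in> Y1 m n" "l \<in> Y1 m n" "k \<noteq> l" and i: "i \<in> Y0 m"
  shows "\<phi> (e (\<lambda>_. 0) {k, l} i) = (\<lambda>d. \<phi> (e (\<lambda>_. 0) {k, l} i) (\<lambda>_. 0, {k, l}, i) * e (\<lambda>_. 0) {k, l} i d)"
proof -
  note X = pair_G[OF kl i]
  have "d = (\<lambda>_. 0, {k, l}, i)" if nz: "\<phi> (e (\<lambda>_. 0) {k, l} i) d \<noteq> 0" for d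
  proof -
    obtain \<beta> v q where d: "d = (\<beta>, v, q)" by (cases d)
    note nz = nz[unfolded d]
    have b: "\<beta> = (\<lambda>_. 0)" by (rule image_constant_unitv[OF der kp X nz])
    have w: "wt s (\<beta>, v, q) = wt s (\<lambda>_. 0, {k, l}, i)" if "s \<in> Ya" for s
      using der_weight[OF der that _ X nz] kh that by (simp add: kills_h_def)
    have qi: "q = i"
      using w[OF Ya_I(1)[OF i]] i by (auto simp: wt_simps b split: if_splits simp: of_bool_def)
    have "s \<in> v \<longleftrightarrow> s \<in> {k, l}" if "s \<in> Y1 m n" for s
      using w[OF Ya_I(2)[OF that]] that by (simp add: wt_simps qi of_bool_eq_iff)
    then have "v = {k, l}" using G_D(3)[OF der_G[OF der X] nz] kl by blast
    then show ?thesis by (simp add: d b qi)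
  qed
  then show ?thesis by (rule single_support)
qed

text \<open>Eigenvalues add under brackets; bracket relations thus become linear relations between
  the eigenvalues \<open>lam\<close> and \<open>mu\<close> below.\<close>

lemma der_br_eigen:
  assumes der: "der \<phi>" and X: "X \<in> G" "\<phi> X = (\<lambda>d. a * X d)" and Y: "Y \<in> G" "\<phi> Y = (\<lambda>d. b * Y d)"
  shows "\<phi> (br X Y) = (\<lambda>d. (a + b) * br X Y d)"
  unfolding derD(3)[OF der X(1) Y(1)] X(2) Y(2) br_scale by (simp add: algebra_simps)

lemma br_torus_unitv:
  assumes "e \<alpha> u q \<in> G"
  shows "br (\<lambda>d. \<Sum>r\<in>Y1 m n. a r * h r d) (e \<alpha> u q) = (\<lambda>d. (\<Sum>r\<in>Y1 m n. a r * wt r (\<alpha>, u, q)) * e \<alpha> u q d)"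
proof
  fix d
  show "br (\<lambda>d. \<Sum>r\<in>Y1 m n. a r * h r d) (e \<alpha> u q) d = (\<Sum>r\<in>Y1 m n. a r * wt r (\<alpha>, u, q)) * e \<alpha> u q d"
    using br_torus[OF assms, of "Y1 m n" a] by (cases "d = (\<alpha>, u, q)") (auto simp: Yall_def unitv_apply)
qed

lemma torus_G: "(\<lambda>d. \<Sum>r\<in>Y1 m n. a r * h r d) \<in> G"
  by (intro G_sum h_G) (simp add: Ya_I)

lemma br_torus_kills:
  "s \<in> Ya \<Longrightarrow> br (\<lambda>d. \<Sum>r\<in>Y1 m n. a r * h r d) (h s) = (\<lambda>d. 0)"
  "\<alpha> \<in> AI \<Longrightarrow> j \<in> Y0 m \<Longrightarrow> br (\<lambda>d. \<Sum>r\<in>Y1 m n. a r * h r d) (e \<alpha> {} j) = (\<lambda>d. 0)"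
proof -
  show pure: "br (\<lambda>d. \<Sum>r\<in>Y1 m n. a r * h r d) (e \<alpha> {} j) = (\<lambda>d. 0)" if "\<alpha> \<in> AI" "j \<in> Y0 m" for \<alpha> j
  proof -
    have "(\<Sum>r\<in>Y1 m n. a r * wt r (\<alpha>, {}, j)) = 0"
      using that Y0_Y1_disj by (intro sum.neutral) (auto simp: wt_simps)
    then show ?thesis unfolding br_torus_unitv[OF pure_G[OF that]] by simp
  qed
  show "br (\<lambda>d. \<Sum>r\<in>Y1 m n. a r * h r d) (h s) = (\<lambda>d. 0)" if s: "s \<in> Ya"
  proof (cases "s \<in> Y0 m")
    case True
    then show ?thesis using pure[OF sp1_AI(1)[OF True] True] by (simp add: h_unitv)
  next
    case False
    then have s1: "s \<in> Y1 m n" using s by (simp add: Yall_iff)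
    have "(\<Sum>r\<in>Y1 m n. a r * wt r (\<lambda>_. 0, {s}, s)) = 0"
      by (intro sum.neutral) (auto simp: wt_simps)
    then show ?thesis unfolding h_unitv(2)[OF s1] br_torus_unitv[OF gl_G[OF s1 s1]] by simp
  qed
qed

definition kills_gl :: "((wmon \<Rightarrow> 'a) \<Rightarrow> (wmon \<Rightarrow> 'a)) \<Rightarrow> bool" where
  "kills_gl \<phi> \<longleftrightarrow> (\<forall>k\<in>Y1 m n. \<forall>l\<in>Y1 m n. \<phi> (e (\<lambda>_. 0) {k} l) = (\<lambda>d. 0))"

definition kills_pairs :: "((wmon \<Rightarrow> 'a) \<Rightarrow> (wmon \<Rightarrow> 'a)) \<Rightarrow> bool" where
  "kills_pairs \<phi> \<longleftrightarrow> (\<forall>k\<in>Y1 m n. \<forall>l\<in>Y1 m n. \<forall>i\<in>Y0 m. k \<noteq> l \<longrightarrow> \<phi> (e (\<lambda>_. 0) {k, l} i) = (\<lambda>d. 0))"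

text \<open>The torus element with coefficients a_r has eigenvalue a_k - a_l on x_k D_l and a_k +
  a_l on x_k x_l D_i. These must equal \<open>lam k l\<close> and \<open>mu k l i\<close>; the
  bracket relations make this overdetermined system solvable.\<close>

lemma reduce_gl:
  assumes der: "der \<phi>" and kh: "kills_h \<phi>" and kp: "kills_pure \<phi>"
  obtains E where "E \<in> G" "kills_h (\<lambda>X d. \<phi> X d - br E X d)" "kills_pure (\<lambda>X d. \<phi> X d - br E X d)"
    "kills_gl (\<lambda>X d. \<phi> X d - br E X d)" "kills_pairs (\<lambda>X d. \<phi> X d - br E X d)"
proof -
  define lam where "lam k l = \<phi> (e (\<lambda>_. 0) {k} l) (\<lambda>_. 0, {k}, l)" for k l
  define mu where "mu k l i = \<phi> (e (\<lambda>_. 0) {k, l} i) (\<lambda>_. 0, {k, l}, i)" for k l i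
  have gl: "\<phi> (e (\<lambda>_. 0) {k} l) = (\<lambda>d. lam k l * e (\<lambda>_. 0) {k} l d)" if "k \<in> Y1 m n" "l \<in> Y1 m n" for k l
    unfolding lam_def by (rule gl_eigen[OF der kh kp that])
  have pr: "\<phi> (e (\<lambda>_. 0) {k, l} i) = (\<lambda>d. mu k l i * e (\<lambda>_. 0) {k, l} i d)"
    if "k \<in> Y1 m n" "l \<in> Y1 m n" "k \<noteq> l" "i \<in> Y0 m" for k l i
    unfolding mu_def by (rule pair_eigen[OF der kh kp that])
  have h0: "\<phi> (h s) = (\<lambda>d. 0)" if "s \<in> Ya" for s using kh that by (simp add: kills_h_def)
  have lam0: "lam k k = 0" if "k \<in> Y1 m n" for k
    using h0[OF Ya_I(2)[OF that]] h_unitv(2)[OF that] by (simp add: lam_def)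
  \<comment> \<open>[x_k D_l, x_l D_q] is x_k D_q, or h_k - h_l when q = k. The latter is killed,
    which gives the antisymmetry of \<open>lam\<close>.\<close>
  have lam_add: "lam k l + lam l q = lam k q" if kl: "k \<in> Y1 m n" "l \<in> Y1 m n" "q \<in> Y1 m n" for k l q
  proof (cases "k = l \<or> l = q")
    case True
    then show ?thesis using kl lam0 by auto
  next
    case False
    have "\<phi> (br (e (\<lambda>_. 0) {k} l) (e (\<lambda>_. 0) {l} q)) = (\<lambda>d. (lam k l + lam l q) * br (e (\<lambda>_. 0) {k} l) (e (\<lambda>_. 0) {l} q) d)"
      by (rule der_br_eigen[OF der gl_G[OF kl(1,2)] gl[OF kl(1,2)] gl_G[OF kl(2,3)] gl[OF kl(2,3)]])
    moreover have "\<phi> (br (e (\<lambda>_. 0) {k} l) (e (\<lambda>_. 0) {l} q)) = (\<lambda>d. lam k q * e (\<lambda>_. 0) {k} q d)"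
    proof (cases "q = k")
      case True
      have "\<phi> (\<lambda>d. h k d - h l d) = (\<lambda>d. 0)"
        using der_diff[OF der h_G[OF Ya_I(2)[OF kl(1)]] h_G[OF Ya_I(2)[OF kl(2)]]] h0 kl by (simp add: Ya_I)
      then show ?thesis unfolding br_gl_gl[OF kl] using True kl lam0 by (simp add: h_unitv)
    next
      case False
      then show ?thesis unfolding br_gl_gl[OF kl] using gl[OF kl(1,3)] by simp
    qed
    ultimately have "(lam k l + lam l q) * br (e (\<lambda>_. 0) {k} l) (e (\<lambda>_. 0) {l} q) (\<lambda>_. 0, {k}, q) = lam k q"
      by (metis (no_types, lifting) mult_1_right unitv_apply)
    moreover have "br (e (\<lambda>_. 0) {k} l) (e (\<lambda>_. 0) {l} q) (\<lambda>_. 0, {k}, q) = 1"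
      unfolding br_gl_gl[OF kl] using False kl by (auto simp: h_unitv unitv_apply)
    ultimately show ?thesis by simp
  qed
  have mu_sym: "mu k l i = mu l k i" for k l i by (simp add: mu_def insert_commute)
  have mu_add: "lam k l + mu l q i = mu k q i"
    if kl: "k \<in> Y1 m n" "l \<in> Y1 m n" "q \<in> Y1 m n" "k \<noteq> q" "l \<noteq> q" "i \<in> Y0 m" for k l q i
  proof -
    have "\<phi> (br (e (\<lambda>_. 0) {k} l) (e (\<lambda>_. 0) {l, q} i)) = (\<lambda>d. (lam k l + mu l q i) * br (e (\<lambda>_. 0) {k} l) (e (\<lambda>_. 0) {l, q} i) d)"
      by (rule der_br_eigen[OF der gl_G[OF kl(1,2)] gl[OF kl(1,2)] pair_G[OF kl(2,3,5,6)] pr[OF kl(2,3,5,6)]])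
    then have "(sg {l} {q} * sg {k} {q}) * mu k q i = (lam k l + mu l q i) * (sg {l} {q} * sg {k} {q} :: 'a)"
      unfolding br_gl_pair[OF kl] der_scale[OF der pair_G[OF kl(1,3,4,6)]] pr[OF kl(1,3,4,6)]
      by (auto dest: fun_cong[of _ _ "(\<lambda>_. 0, {k, q}, i)"] simp: unitv_apply)
    then show ?thesis by (simp add: mult.commute)
  qed
  have mu_i: "mu k l i = mu k l j" if kl: "k \<in> Y1 m n" "l \<in> Y1 m n" "k \<noteq> l" "i \<in> Y0 m" "j \<in> Y0 m" for k l i j
  proof -
    note P = sp1_AI(1)[OF kl(4)]
    have "\<phi> (br (e (\<lambda>_. 0) {k, l} i) (e (sp i 1) {} j)) = (\<lambda>d. (mu k l i + 0) * br (e (\<lambda>_. 0) {k, l} i) (e (sp i 1) {} j) d)"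
      by (rule der_br_eigen[OF der pair_G[OF kl(1-4)] pr[OF kl(1-4)] pure_G[OF P kl(5)]]) (simp add: kills_pureD[OF kp P kl(5), simplified])
    then show ?thesis
      unfolding br_pair_gl0[OF kl] pr[OF kl(1-3,5)]
      by (auto dest: fun_cong[of _ _ "(\<lambda>_. 0, {k, l}, j)"] simp: unitv_apply)
  qed
  define o1 where "o1 = m + 1"
  define o2 where "o2 = m + 2"
  have o: "o1 \<in> Y1 m n" "o2 \<in> Y1 m n" "o1 \<noteq> o2" "1 \<in> Y0 m"
    using n_ge m_ge by (auto simp: o1_def o2_def Y1_def Y0_def)
  \<comment> \<open>The additivity of \<open>lam\<close> suggests a_k = \<open>lam k o1\<close>,
    which has the right differences; \<open>nu\<close> is the error in the sums. It does not depend
    on k and l, so adding half of it to every a_k corrects the sums and keeps the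
    differences.\<close>
  define nu where "nu k l = mu k l 1 - lam k o1 - lam l o1" for k l
  have nu_step: "nu k q = nu l q" if "k \<in> Y1 m n" "l \<in> Y1 m n" "q \<in> Y1 m n" "k \<noteq> q" "l \<noteq> q" for k l q
    unfolding nu_def mu_add[OF that o(4), symmetric] lam_add[OF that(1,2) o(1), symmetric] by simp
  have nu_sym: "nu k l = nu l k" for k l by (simp add: nu_def mu_sym algebra_simps)
  have nu_const: "nu k l = nu o1 o2" if kl: "k \<in> Y1 m n" "l \<in> Y1 m n" "k \<noteq> l" for k l
  proof (cases "l = o1")
    case True
    then have "nu k l = nu o2 o1" using nu_step[of k o2 o1] kl o by auto
    then show ?thesis using nu_sym by simp
  next
    case False
    have "nu k l = nu o1 l" using nu_step[of k o1 l] kl o False by auto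
    also have "\<dots> = nu l o1" by (rule nu_sym)
    also have "\<dots> = nu o2 o1" using nu_step[of l o2 o1] kl o False by auto
    finally show ?thesis using nu_sym by simp
  qed
  define a where "a k = lam k o1 + nu o1 o2 / 2" for k
  define E where "E = (\<lambda>d. \<Sum>r\<in>Y1 m n. a r * h r d)"
  have a_gl: "a k - a l = lam k l" if "k \<in> Y1 m n" "l \<in> Y1 m n" for k l
    using lam_add[OF that o(1)] by (simp add: a_def algebra_simps)
  have a_pair: "a k + a l = mu k l i" if "k \<in> Y1 m n" "l \<in> Y1 m n" "k \<noteq> l" "i \<in> Y0 m" for k l i
  proof -
    have "a k + a l = lam k o1 + lam l o1 + (nu o1 o2 / 2 + nu o1 o2 / 2)" by (simp add: a_def)
    also have "nu o1 o2 / 2 + nu o1 o2 / 2 = nu k l"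
      unfolding nu_const[OF that(1-3)] using two_neq_0 by (simp add: field_simps)
    finally show ?thesis using mu_i[OF that(1-4) o(4)] by (simp add: nu_def)
  qed
  show thesis
  proof (rule that[of E])
    show "E \<in> G" unfolding E_def by (rule torus_G)
    show "kills_h (\<lambda>X d. \<phi> X d - br E X d)"
      using kh unfolding kills_h_def E_def by (simp add: br_torus_kills)
    show "kills_pure (\<lambda>X d. \<phi> X d - br E X d)"
      using kp unfolding kills_pure_def E_def by (simp add: br_torus_kills)
    show "kills_gl (\<lambda>X d. \<phi> X d - br E X d)"
      unfolding kills_gl_def
    proof (intro ballI)
      fix k l assume kl: "k \<in> Y1 m n" "l \<in> Y1 m n"
      have "(\<Sum>r\<in>Y1 m n. a r * wt r (\<lambda>_. 0, {k}, l)) = (\<Sum>r\<in>Y1 m n. (if r = k then a r else 0) - (if r = l then a r else 0))"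
        by (intro sum.cong refl) (auto simp: wt_simps)
      also have "\<dots> = a k - a l" using kl by (simp add: sum_subtractf)
      finally show "(\<lambda>d. \<phi> (e (\<lambda>_. 0) {k} l) d - br E (e (\<lambda>_. 0) {k} l) d) = (\<lambda>d. 0)"
        unfolding E_def br_torus_unitv[OF gl_G[OF kl]] gl[OF kl] by (simp add: a_gl[OF kl])
    qed
    show "kills_pairs (\<lambda>X d. \<phi> X d - br E X d)"
      unfolding kills_pairs_def
    proof (intro ballI impI)
      fix k l i assume kl: "k \<in> Y1 m n" "l \<in> Y1 m n" "i \<in> Y0 m" "k \<noteq> l"
      have "(\<Sum>r\<in>Y1 m n. a r * wt r (\<lambda>_. 0, {k, l}, i)) = (\<Sum>r\<in>Y1 m n. (if r = k then a r else 0) + (if r = l then a r else 0))"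
        using kl Y0_Y1_disj[OF kl(3)] by (intro sum.cong refl) (auto simp: wt_simps)
      also have "\<dots> = a k + a l" using kl by (simp add: sum.distrib)
      finally show "(\<lambda>d. \<phi> (e (\<lambda>_. 0) {k, l} i) d - br E (e (\<lambda>_. 0) {k, l} i) d) = (\<lambda>d. 0)"
        unfolding E_def br_torus_unitv[OF pair_G[OF kl(1,2,4,3)]] pr[OF kl(1,2,4,3)] by (simp add: a_pair[OF kl(1,2,4,3)])
    qed
  qed
qed

section \<open>Generation by the killed elements\<close>

lemma kernel_br:
  assumes "der \<phi>" "X \<in> G" "Y \<in> G" "\<phi> X = (\<lambda>d. 0)" "\<phi> Y = (\<lambda>d. 0)"
  shows "\<phi> (br X Y) = (\<lambda>d. 0)"
  using derD(3)[OF assms(1-3)] assms(4,5) by simp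

lemma kernel_cancel:
  assumes "der \<phi>" "X \<in> G" "k \<noteq> 0" "\<phi> (\<lambda>d. k * X d) = (\<lambda>d. 0)"
  shows "\<phi> X = (\<lambda>d. 0)"
  using der_scale[OF assms(1,2), of k] assms(3,4) by (auto simp: fun_eq_iff)

lemma sp1_gl_G: "i \<in> Y0 m \<Longrightarrow> k \<in> Y1 m n \<Longrightarrow> l \<in> Y1 m n \<Longrightarrow> e (sp i 1) {k} l \<in> G"
  using sp1_AI(1) by (intro unitv_G) (auto simp: A_iff ev_def tau_simps Ya_I)

text \<open>Lowering x_i leads to killed elements, so the image is constant. A constant field has
  h_i-weight 0 or -1, but x_i x_k D_l has weight 1.\<close>

lemma kills_linear_gl:
  assumes der: "der \<phi>" and kh: "kills_h \<phi>" and kp: "kills_pure \<phi>" and kg: "kills_gl \<phi>"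
    and i: "i \<in> Y0 m" and k: "k \<in> Y1 m n" and l: "l \<in> Y1 m n"
  shows "\<phi> (e (sp i 1) {k} l) = (\<lambda>d. 0)"
proof (rule ccontr)
  note X = sp1_gl_G[OF i k l]
  assume "\<phi> (e (sp i 1) {k} l) \<noteq> (\<lambda>d. 0)"
  then obtain d where nz: "\<phi> (e (sp i 1) {k} l) d \<noteq> 0" by (meson ext)
  obtain \<beta> v q where d: "d = (\<beta>, v, q)" by (cases d)
  note nz = nz[unfolded d]
  have "\<phi> (br (Dvec j) (e (sp i 1) {k} l)) = (\<lambda>d. 0)" if j: "j \<in> Y0 m" for j
  proof (cases "j = i")
    case True
    have "(sp i 1)(j := sp i 1 j - 1) = (\<lambda>_. 0)" using True by (auto simp: sp_def)
    then show ?thesis unfolding br_Dvec_unitv[OF X j] using kg k l True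
      by (simp add: sp_apply kills_gl_def)
  next
    case False
    then show ?thesis unfolding br_Dvec_unitv[OF X j] by (simp add: sp_apply der_zero[OF der])
  qed
  from image_constant[OF der kp X this nz] have b: "\<beta> = (\<lambda>_. 0)" .
  have "wt i (\<beta>, v, q) = wt i (sp i 1, {k}, l)"
    using der_weight[OF der Ya_I(1)[OF i] _ X nz] kh i by (simp add: kills_h_def Ya_I)
  then have "- of_bool (i = q) = (1 :: 'a)"
    using i l Y0_Y1_disj by (auto simp: wt_simps b sp_apply)
  then show False using one_neq_minus_one by (cases "i = q") auto
qed

lemma D_Y1_pure: "\<alpha> \<in> AI \<Longrightarrow> s \<in> Y1 m n \<Longrightarrow> D s (unitv (\<alpha>, {})) = (\<lambda>c. 0)"
  using D_unitv_Y1[OF pure_A] by simp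

text \<open>Replaces the factor x_j by an arbitrary x^(\<alpha>). The unwanted term x_j x^u
  D_r(x^(\<alpha>)) vanishes for odd r, and for even r \<noteq> j when \<alpha>_j is maximal, since
  its coefficient \<alpha>_j + 1 = p^(t_j) is 0.\<close>

lemma br_pure_lin:
  assumes \<alpha>: "\<alpha> \<in> AI" and j: "j \<in> Y0 m" and X: "e (sp j 1) u r \<in> G"
    and r: "r \<in> Y1 m n \<or> (r \<in> Y0 m \<and> r \<noteq> j \<and> Suc (\<alpha> j) = p ^ t j)"
  shows "br (e \<alpha> {} j) (e (sp j 1) u r) = e \<alpha> u r"
proof -
  have G: "El (unitv (\<alpha>, {})) j \<in> G" "El (unitv (sp j 1, u)) r \<in> G"
    using pure_G[OF \<alpha> j] X by (simp_all add: El_unitv)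
  have A: "(sp j 1, u) \<in> A" and rY: "r \<in> Ya" using X unitv_G_iff by auto
  then have A0: "(\<lambda>_. 0, u) \<in> A" "(\<alpha>, u) \<in> A" using \<alpha> by (simp_all add: A_iff)
  have e1: "(sp j 1)(j := sp j 1 j - 1) = (\<lambda>_. 0)" by (auto simp: sp_def)
  have 1: "unitv (\<alpha>, {}) \<star> D j (unitv (sp j 1, u)) = unitv (\<alpha>, u)"
    unfolding D_unitv_Y0[OF A j] e1 amul_scale_right mul_unitv[OF pure_A[OF \<alpha>] A0(1)]
    by (simp add: sp_apply)
  have 2: "unitv (sp j 1, u) \<star> D r (unitv (\<alpha>, {})) = (\<lambda>c. 0)"
  proof (cases "r \<in> Y1 m n")
    case True
    then show ?thesis by (simp add: D_Y1_pure[OF \<alpha>])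
  next
    case False
    with r have r0: "r \<in> Y0 m" "r \<noteq> j" "Suc (\<alpha> j) = p ^ t j" by auto
    have "bin (sp j 1) (\<alpha>(r := \<alpha> r - 1)) = of_nat (p ^ t j)"
      unfolding bin_single[OF j] using r0 by simp
    also have "\<dots> = 0" unfolding of_nat_eq_0_iff_p using t_ge[OF j] by (simp add: dvd_power)
    finally have b: "bin (sp j 1) (\<alpha>(r := \<alpha> r - 1)) = 0" .
    show ?thesis
      unfolding D_unitv_Y0[OF pure_A[OF \<alpha>] r0(1)] amul_scale_right mul_unitv[OF A sub_A[OF pure_A[OF \<alpha>]]] b
      by simp
  qed
  show ?thesis
    using br_El[OF G Ya_I(1)[OF j] rY] unfolding 1 2 by (simp add: El_unitv)
qed

text \<open>Trades one factor x_j for x_k x_q, so |u| grows by 2. The last term can be nonzero only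
  if r is k or q.\<close>

lemma br_pair_lower:
  assumes k: "k \<in> Y1 m n" "q \<in> Y1 m n" "k \<noteq> q" and j: "j \<in> Y0 m" and X: "e \<beta> u r \<in> G" and bj: "\<beta> j \<noteq> 0"
  shows "br (e (\<lambda>_. 0) {k, q} j) (e \<beta> u r) = (\<lambda>d. (if {k, q} \<inter> u = {} then sg {k, q} u else 0) * e (\<beta>(j := \<beta> j - 1)) ({k, q} \<union> u) r d
     - El (unitv (\<beta>, u) \<star> D r (unitv (\<lambda>_. 0, {k, q}))) j d)"
proof -
  have G: "El (unitv (\<lambda>_. 0, {k, q})) j \<in> G" "El (unitv (\<beta>, u)) r \<in> G"
    using pair_G[OF k j] X by (simp_all add: El_unitv)
  have A: "(\<beta>, u) \<in> A" and rY: "r \<in> Ya" using X unitv_G_iff by auto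
  have A0: "(\<lambda>_. 0, {k, q}) \<in> A" using k by (simp add: zero_A)
  have "El (unitv (\<lambda>_. 0, {k, q}) \<star> D j (unitv (\<beta>, u))) r
      = (\<lambda>d. (if {k, q} \<inter> u = {} then sg {k, q} u else 0) * e (\<beta>(j := \<beta> j - 1)) ({k, q} \<union> u) r d)"
    unfolding D_unitv_Y0[OF A j] amul_scale_right mul_unitv[OF A0 sub_A[OF A]] El_scale add_0
    using bj by (simp add: El_scale El_unitv)
  then show ?thesis using br_El[OF G Ya_I(1)[OF j] rY] by (simp add: El_unitv)
qed

lemma two_elements:
  assumes "finite u" "2 \<le> card u"
  obtains k q u' where "u = {k, q} \<union> u'" "k \<noteq> q" "{k, q} \<inter> u' = {}" "card u = card u' + 2"
proof -
  have "u \<noteq> {}" using assms by auto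
  then obtain k where k: "k \<in> u" by blast
  then have c1: "card u = Suc (card (u - {k}))" using assms(1) by (simp only: card_Suc_Diff1)
  then have "card (u - {k}) \<noteq> 0" using assms(2) by simp
  then have "u - {k} \<noteq> {}" using assms(1) by auto
  then obtain q where q: "q \<in> u - {k}" by blast
  then have c2: "card (u - {k}) = Suc (card (u - {k} - {q}))"
    using assms(1) by (simp only: card_Suc_Diff1 finite_Diff)
  show thesis
  proof (rule that[of k q "u - {k} - {q}"])
    show "u = {k, q} \<union> (u - {k} - {q})" "k \<noteq> q" "{k, q} \<inter> (u - {k} - {q}) = {}"
      using k q by blast+
    show "card u = card (u - {k} - {q}) + 2" unfolding c1 c2 by simp
  qed
qed

text \<open>Induction on |u|, first for fields along even D_i, then along odd D_s, where the error
  terms of the brackets are of the first kind.\<close>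

lemma kills_all:
  assumes der: "der \<phi>" and kh: "kills_h \<phi>" and kp: "kills_pure \<phi>" and kg: "kills_gl \<phi>" and k2: "kills_pairs \<phi>"
  shows "X \<in> G \<Longrightarrow> \<phi> X = (\<lambda>d. 0)"
proof -
  have pairs: "\<phi> (e (\<lambda>_. 0) {k, q} j) = (\<lambda>d. 0)" if "k \<in> Y1 m n" "q \<in> Y1 m n" "k \<noteq> q" "j \<in> Y0 m" for k q j
    using k2 that by (simp add: kills_pairs_def)
  have sp1_less: "Suc (sp j 1 j) < p ^ t j" if "j \<in> Y0 m" for j
    using p_le_power[OF that] p_gt by (simp add: sp_apply)
  have up: "\<alpha>(j := Suc (\<alpha> j)) \<in> AI" if "\<alpha> \<in> AI" "j \<in> Y0 m" "Suc (\<alpha> j) < p ^ t j" for \<alpha> j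
    using that by (auto simp: AI_iff)
  have even: "\<phi> (e \<alpha> u i) = (\<lambda>d. 0)" if "e \<alpha> u i \<in> G" "i \<in> Y0 m" for \<alpha> u i
    using that(1)
  proof (induction "card u" arbitrary: \<alpha> u rule: less_induct)
    case less
    note i = \<open>i \<in> Y0 m\<close>
    have A: "\<alpha> \<in> AI" "u \<subseteq> Y1 m n" and evu: "even (card u)"
      using less.prems i by (auto simp: unitv_G_iff A_iff ev_def tau_simps even_iff_mod_2_eq_zero)
    show ?case
    proof (cases "u = {}")
      case True
      then show ?thesis using kills_pureD[OF kp A(1) i] by simp
    next
      case False
      then have "2 \<le> card u" using evu finite_sub_Y1[OF A(2)] by (metis card_0_eq dvd_imp_le not_gr0)
      from two_elements[OF finite_sub_Y1[OF A(2)] this]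
      obtain k q u' where u: "u = {k, q} \<union> u'" "k \<noteq> q" "{k, q} \<inter> u' = {}" "card u = card u' + 2" .
      have kq: "k \<in> Y1 m n" "q \<in> Y1 m n" using A(2) u(1) by auto
      \<comment> \<open>Obtained from x^(\<beta>+\<epsilon>_j) x^(u') D_i, provided \<beta>_j can be
        raised; there is no error term because D_i annihilates x_k x_q.\<close>
      have low: "\<phi> (e \<beta> u i) = (\<lambda>d. 0)" if \<beta>: "\<beta> \<in> AI" and j: "j \<in> Y0 m" "Suc (\<beta> j) < p ^ t j" for \<beta> j
      proof -
        let ?\<beta> = "\<beta>(j := Suc (\<beta> j))"
        have XG: "e ?\<beta> u' i \<in> G"
          using up[OF \<beta> j] A(2) u evu i by (auto simp: unitv_G_iff A_iff ev_def tau_simps Ya_I even_iff_mod_2_eq_zero[symmetric])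
        have YG: "e \<beta> u i \<in> G" using \<beta> A(2) evu i by (auto simp: unitv_G_iff A_iff ev_def tau_simps Ya_I)
        have "\<phi> (br (e (\<lambda>_. 0) {k, q} j) (e ?\<beta> u' i)) = (\<lambda>d. 0)"
          by (rule kernel_br[OF der pair_G[OF kq u(2) j(1)] XG pairs[OF kq u(2) j(1)] less.hyps[OF _ XG]]) (simp add: u(4))
        moreover have "D i (unitv (\<lambda>_. 0, {k, q})) = (\<lambda>c. 0)"
          using D_unitv_Y0[OF zero_A[of "{k, q}"] i] kq by simp
        ultimately have "\<phi> (\<lambda>d. sg {k, q} u' * e \<beta> u i d) = (\<lambda>d. 0)"
          using br_pair_lower[OF kq u(2) j(1) XG] u(1,3) by simp
        from kernel_cancel[OF der YG _ this] show ?thesis by simp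
      qed
      show ?thesis
      proof (cases "\<exists>j\<in>Y0 m. Suc (\<alpha> j) < p ^ t j")
        case True
        then show ?thesis using low[OF A(1)] by blast
      next
        case False
        \<comment> \<open>All exponents are maximal, so none can be raised. Instead x_j x^u D_i,
          covered by \<open>low\<close>, is bracketed with x^(\<alpha>) D_j; the maximality of
          \<alpha>_j kills the second term.\<close>
        obtain j where j: "j \<in> Y0 m" "j \<noteq> i" using Y0_other by blast
        have top: "Suc (\<alpha> j) = p ^ t j" using False j AI_less[OF A(1) j(1)] by (meson Suc_lessI)
        have XG: "e (sp j 1) u i \<in> G"
          using less.prems sp1_AI(1)[OF j(1)] by (simp add: unitv_G_iff A_iff)
        have "\<phi> (br (e \<alpha> {} j) (e (sp j 1) u i)) = (\<lambda>d. 0)"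
          by (rule kernel_br[OF der pure_G[OF A(1) j(1)] XG kills_pureD[OF kp A(1) j(1)] low[OF sp1_AI(1)[OF j(1)] j(1) sp1_less[OF j(1)]]])
        then show ?thesis using br_pure_lin[OF A(1) j(1) XG] i j top by simp
      qed
    qed
  qed
  have odd: "\<phi> (e \<alpha> u s) = (\<lambda>d. 0)" if "e \<alpha> u s \<in> G" "s \<in> Y1 m n" for \<alpha> u s
    using that(1)
  proof (induction "card u" arbitrary: \<alpha> u rule: less_induct)
    case less
    note s = \<open>s \<in> Y1 m n\<close>
    obtain j0 where j0: "j0 \<in> Y0 m" using Y0_other by blast
    have A: "\<alpha> \<in> AI" "u \<subseteq> Y1 m n" and oddu: "odd (card u)"
      using less.prems s by (auto simp: unitv_G_iff A_iff ev_def tau_simps even_iff_mod_2_eq_zero mod_Suc split: if_splits)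
    have XG: "e (sp j0 1) u s \<in> G"
      using less.prems sp1_AI(1)[OF j0] by (simp add: unitv_G_iff A_iff)
    \<comment> \<open>For odd s the bracket with x^(\<alpha>) D_j0 reaches every \<alpha> from
      \<epsilon>_j0, so only that exponent has to be treated.\<close>
    have lift: "\<phi> (e \<alpha> u s) = (\<lambda>d. 0)" if "\<phi> (e (sp j0 1) u s) = (\<lambda>d. 0)"
      using kernel_br[OF der pure_G[OF A(1) j0] XG kills_pureD[OF kp A(1) j0] that] br_pure_lin[OF A(1) j0 XG] s by simp
    show ?case
    proof (cases "card u = 1")
      case True
      then obtain k where k: "u = {k}" by (auto simp: card_1_singleton_iff)
      show ?thesis using lift kills_linear_gl[OF der kh kp kg j0 _ s, of k] A(2) k by simp
    next
      case False
      then have "2 \<le> card u" using oddu by (cases "card u") auto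
      from two_elements[OF finite_sub_Y1[OF A(2)] this]
      obtain k q u' where u: "u = {k, q} \<union> u'" "k \<noteq> q" "{k, q} \<inter> u' = {}" "card u = card u' + 2" .
      have kq: "k \<in> Y1 m n" "q \<in> Y1 m n" using A(2) u(1) by auto
      have \<beta>: "sp j0 1 \<in> AI" by (rule sp1_AI(1)[OF j0])
      \<comment> \<open>The exponent 2 \<epsilon>_j0: the bracket with x_k x_q D_j0 lowers it to
        \<epsilon>_j0.\<close>
      let ?\<beta> = "(sp j0 1)(j0 := Suc (sp j0 1 j0))"
      have \<beta>': "?\<beta> \<in> AI" by (rule up[OF \<beta> j0 sp1_less[OF j0]])
      have u'Y: "u' \<subseteq> Y1 m n" using A(2) u(1) by auto
      have odd': "odd (card u')" using oddu u(4) by simp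
      have YG: "e ?\<beta> u' s \<in> G"
        using \<beta>' u'Y odd' s by (auto simp: unitv_G_iff A_iff ev_def tau_simps Ya_I even_iff_mod_2_eq_zero[symmetric] simp del: fun_upd_apply)
      \<comment> \<open>The error term runs along the even D_j0; it is zero or a multiple of a basis
        vector covered by \<open>even\<close>.\<close>
      let ?R = "El (unitv (?\<beta>, u') \<star> D s (unitv (\<lambda>_. 0, {k, q}))) j0"
      have R: "?R \<in> G \<and> \<phi> ?R = (\<lambda>d. 0)"
      proof (cases "s \<in> {k, q}")
        case False
        then show ?thesis using D_unitv_Y1[OF zero_A[of "{k, q}"] s] kq by (simp add: der_zero[OF der])
      next
        case True
        then obtain l where l: "{k, q} - {s} = {l}" "l \<in> {k, q}" using u(2) by auto
        have A1: "(?\<beta>, u') \<in> A" "(\<lambda>_. 0, {l}) \<in> A" using \<beta>' u'Y l kq by (auto simp: A_iff simp del: fun_upd_apply)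
        have dis: "u' \<inter> {l} = {}" using l u(3) by auto
        have eG: "e ?\<beta> (u' \<union> {l}) j0 \<in> G"
          using \<beta>' u'Y l(2) kq odd' dis finite_sub_Y1[OF u'Y] j0
          by (auto simp: unitv_G_iff A_iff ev_def tau_simps Ya_I even_iff_mod_2_eq_zero[symmetric] simp del: fun_upd_apply)
        have "\<exists>c. unitv (?\<beta>, u') \<star> D s (unitv (\<lambda>_. 0, {k, q})) = (\<lambda>x. c * unitv (?\<beta>, u' \<union> {l}) x)"
          unfolding D_unitv_Y1[OF zero_A[of "{k, q}", OF insert_subsetI[OF kq(1) insert_subsetI[OF kq(2) empty_subsetI]]] s] l(1) amul_scale_right mul_unitv[OF A1] add_0_right
          by (intro exI[of _ "of_bool (s \<in> {k, q}) * sg {s} {l} * (bin ?\<beta> (\<lambda>_. 0) * sg u' {l})"]) (use dis in \<open>simp only: mult.assoc if_True simp_thms\<close>)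
        then obtain c where "?R = (\<lambda>d. c * e ?\<beta> (u' \<union> {l}) j0 d)" by (auto simp: El_scale El_unitv)
        then show ?thesis using G_scale[OF eG] der_scale[OF der eG] even[OF eG j0] by simp
      qed
      have "\<phi> (br (e (\<lambda>_. 0) {k, q} j0) (e ?\<beta> u' s)) = (\<lambda>d. 0)"
        by (rule kernel_br[OF der pair_G[OF kq u(2) j0] YG pairs[OF kq u(2) j0] less.hyps[OF _ YG]]) (simp add: u(4))
      moreover have "br (e (\<lambda>_. 0) {k, q} j0) (e ?\<beta> u' s) = (\<lambda>d. sg {k, q} u' * e (sp j0 1) u s d - ?R d)"
        using br_pair_lower[OF kq u(2) j0 YG] u(1,3) by (simp add: fun_upd_idem)
      moreover have "\<phi> (\<lambda>d. sg {k, q} u' * e (sp j0 1) u s d - ?R d) = (\<lambda>d. \<phi> (\<lambda>d. sg {k, q} u' * e (sp j0 1) u s d) d - \<phi> ?R d)"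
        using R by (intro der_diff[OF der G_scale[OF XG]]) simp
      ultimately have "\<phi> (\<lambda>d. sg {k, q} u' * e (sp j0 1) u s d) = (\<lambda>d. 0)"
        using R by simp
      from kernel_cancel[OF der XG _ this] show ?thesis by (intro lift) simp
    qed
  qed
  assume X: "X \<in> G"
  have basis: "unitv b \<in> G \<and> \<phi> (unitv b) = (\<lambda>d. 0)" if "b \<in> {b \<in> B. wpar m b = 0}" for b
  proof -
    obtain \<alpha> u r where b: "b = (\<alpha>, u, r)" by (cases b)
    have "e \<alpha> u r \<in> G" using that b by (auto simp: unitv_G_iff mem_B wpar_def ev_def)
    moreover have "r \<in> Y0 m \<or> r \<in> Y1 m n" using that b by (auto simp: mem_B Yall_iff)
    ultimately show ?thesis using even odd unfolding b by blast
  qed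
  then have "\<phi> (\<lambda>d. \<Sum>b\<in>{b \<in> B. wpar m b = 0}. X b * unitv b d) = (\<lambda>d. \<Sum>b\<in>{b \<in> B. wpar m b = 0}. X b * \<phi> (unitv b) d)"
    by (intro der_sum[OF der]) blast
  also have "\<dots> = (\<lambda>d. 0)"
    using basis by (intro ext sum.neutral) auto
  finally show "\<phi> X = (\<lambda>d. 0)" unfolding G_expand[OF X, symmetric] .
qed

text \<open>The order of the corrections matters: each one is built so as to vanish on what the
  previous steps have normalised.\<close>

lemma derivation_decomposition:
  assumes der: "der \<phi>"
  obtains E c where "E \<in> G" "\<forall>X\<in>G. \<phi> X = (\<lambda>d. br E X d + spanop p m n t c X d)"
proof -
  obtain E1 where E1: "E1 \<in> G" "kills_h (\<lambda>X d. \<phi> X d - br E1 X d)"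
    using reduce_torus[OF der] .
  let ?\<phi>1 = "\<lambda>X d. \<phi> X d - br E1 X d"
  have d1: "der ?\<phi>1" by (intro der_minus der der_ad E1(1))
  obtain E2 where E2: "E2 \<in> G" "kills_h (\<lambda>X d. ?\<phi>1 X d - br E2 X d)" "kills_D (\<lambda>X d. ?\<phi>1 X d - br E2 X d)"
    using reduce_D[OF d1 E1(2)] .
  let ?\<phi>2 = "\<lambda>X d. ?\<phi>1 X d - br E2 X d"
  have d2: "der ?\<phi>2" by (intro der_minus[OF d1] der_ad E2(1))
  obtain c where c: "kills_h (\<lambda>X d. ?\<phi>2 X d - spanop p m n t c X d)" "kills_pure (\<lambda>X d. ?\<phi>2 X d - spanop p m n t c X d)"
    using reduce_pure[OF d2 E2(2,3)] .
  let ?\<phi>3 = "\<lambda>X d. ?\<phi>2 X d - spanop p m n t c X d"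
  have d3: "der ?\<phi>3" by (intro der_minus[OF d2] der_spanop)
  obtain E3 where E3: "E3 \<in> G" "kills_h (\<lambda>X d. ?\<phi>3 X d - br E3 X d)" "kills_pure (\<lambda>X d. ?\<phi>3 X d - br E3 X d)"
    "kills_gl (\<lambda>X d. ?\<phi>3 X d - br E3 X d)" "kills_pairs (\<lambda>X d. ?\<phi>3 X d - br E3 X d)"
    using reduce_gl[OF d3 c] .
  let ?\<phi>4 = "\<lambda>X d. ?\<phi>3 X d - br E3 X d"
  have d4: "der ?\<phi>4" by (intro der_minus[OF d3] der_ad E3(1))
  let ?E = "\<lambda>d. E1 d + E2 d + E3 d"
  have E: "?E \<in> G" by (intro G_add E1 E2 E3)
  have "br ?E X d = br E1 X d + br E2 X d + br E3 X d" for X d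
    by (simp add: Wbr_def sum.distrib algebra_simps)
  moreover have "\<phi> X d - br E1 X d - br E2 X d - spanop p m n t c X d - br E3 X d = 0" if "X \<in> G" for X d
    using fun_cong[OF kills_all[OF d4 E3(2-5) that], of d] .
  ultimately have "\<phi> X = (\<lambda>d. br ?E X d + spanop p m n t c X d)" if "X \<in> G" for X
    using that by (simp add: fun_eq_iff algebra_simps)
  with E show thesis using that by blast
qed

section \<open>Equality of the two sets and directness of the sum\<close>

lemma DerW_iff: "\<phi> \<in> DerW p m n t \<longleftrightarrow> der \<phi> \<and> (\<forall>X. X \<notin> G \<longrightarrow> \<phi> X = (\<lambda>_. 0))"
  unfolding DerW_def der_def by blast

lemma der_cong:
  assumes \<psi>: "der \<psi>" and eq: "\<And>X. X \<in> G \<Longrightarrow> \<psi> X = \<phi> X"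
  shows "der \<phi>"
  unfolding der_def
proof (intro conjI ballI allI)
  fix X Y :: "wmon \<Rightarrow> 'a" and a b assume X: "X \<in> G" and Y: "Y \<in> G"
  show "\<phi> X \<in> G" using der_G[OF \<psi> X] by (simp only: eq[OF X])
  show "\<phi> (\<lambda>d. a * X d + b * Y d) = (\<lambda>d. a * \<phi> X d + b * \<phi> Y d)"
    using derD(2)[OF \<psi> X Y] by (simp only: eq[OF X] eq[OF Y] eq[OF G_lin[OF X Y]])
  show "\<phi> (br X Y) = (\<lambda>d. br (\<phi> X) Y d + br X (\<phi> Y) d)"
    using derD(3)[OF \<psi> X Y] by (simp only: eq[OF X] eq[OF Y] eq[OF br_G[OF X Y]])
qed

lemma der_combo:
  assumes E: "E \<in> G"
  shows "der (combo p m n t E c)"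
proof -
  \<comment> \<open>The sum of two derivations is written as a sum over the booleans, so that
    \<open>der_comb\<close> applies.\<close>
  let ?\<psi> = "\<lambda>X d. \<Sum>b\<in>UNIV. 1 * (if b then br E else spanop p m n t c) X d"
  have "der ?\<psi>" by (rule der_comb) (simp add: der_ad[OF E] der_spanop)
  moreover have "?\<psi> X = combo p m n t E c X" if "X \<in> G" for X
    using that by (simp add: combo_def UNIV_bool add.commute)
  ultimately show ?thesis by (rule der_cong)
qed

lemma DerW_eq: "DerW p m n t = {combo p m n t E c | E c. E \<in> G}"
proof (intro equalityI subsetI)
  fix \<phi> :: "(wmon \<Rightarrow> 'a) \<Rightarrow> (wmon \<Rightarrow> 'a)" assume "\<phi> \<in> DerW p m n t"
  then have der: "der \<phi>" and out: "\<And>X. X \<notin> G \<Longrightarrow> \<phi> X = (\<lambda>_. 0)" by (auto simp: DerW_iff)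
  obtain E c where E: "E \<in> G" "\<forall>X\<in>G. \<phi> X = (\<lambda>d. br E X d + spanop p m n t c X d)"
    using derivation_decomposition[OF der] .
  then have "\<phi> = combo p m n t E c" using out by (auto simp: combo_def)
  then show "\<phi> \<in> {combo p m n t E c | E c. E \<in> G}" using E(1) by blast
next
  fix \<phi> :: "(wmon \<Rightarrow> 'a) \<Rightarrow> (wmon \<Rightarrow> 'a)" assume "\<phi> \<in> {combo p m n t E c | E c. E \<in> G}"
  then show "\<phi> \<in> DerW p m n t" by (auto simp: DerW_iff der_combo) (auto simp: combo_def)
qed

text \<open>The outer derivations vanish on all D_i and h_s, so E commutes with them and lies in the
  odd torus. Then ad E kills every x_i^(p^r) D_i, where \<open>spanop\<close> shows the coefficient
  c (i, r); so all relevant coefficients are 0.\<close>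

lemma ad_inter_spanop:
  assumes E: "E \<in> G" and eq: "\<And>X. X \<in> G \<Longrightarrow> br E X = spanop p m n t c X" and X: "X \<in> G"
  shows "br E X = (\<lambda>_. 0)"
proof -
  have D: "br (Dvec i) E = (\<lambda>d. 0)" if i: "i \<in> Y0 m" for i
    using eq[OF Dvec_G[OF i]] br_skew[OF Dvec_G[OF i] E] spanop_small[OF Dvec_G[OF i, unfolded Dvec_unitv], of c] p_gt
    by (simp add: Dvec_unitv)
  have w: "wt s d = 0" if "E d \<noteq> 0" "s \<in> Ya" for d s
  proof -
    have "br (h s) E = (\<lambda>d. 0)"
      unfolding br_skew[OF h_G[OF that(2)] E] eq[OF h_G[OF that(2)]] spanop_h[OF that(2)] by simp
    from fun_cong[OF this, of d] show ?thesis unfolding br_h[OF that(2) E] using that(1) by simp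
  qed
  have E_eq: "E = (\<lambda>d. \<Sum>r\<in>Y1 m n. E (\<lambda>_. 0, {r}, r) * h r d)" by (rule constant_weight_0[OF E D w])
  have c0: "c (i, r) = 0" if J: "(i, r) \<in> Jset m t" for i r
  proof -
    have i: "i \<in> Y0 m" "r < t i" using J by (auto simp: Jset_def)
    have S: "sp i (p ^ r) \<in> AI" using i p_gt by (intro sp_AI) auto
    have "br E (e (sp i (p ^ r)) {} i) = (\<lambda>d. 0)"
      by (subst E_eq) (rule br_torus_kills(2)[OF S i(1)])
    then show ?thesis using eq[OF pure_G[OF S i(1)]] spanop_power[OF J i(1), of c] by simp
  qed
  have "spanop p m n t c X = (\<lambda>_. 0)"
    unfolding spanop_def by (intro ext sum.neutral) (auto simp: c0)
  then show ?thesis using eq[OF X] by simp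
qed

end

theorem theorem3p2p11:
  fixes p m n :: nat and t :: "nat \<Rightarrow> nat"
  assumes "prime p" and "p > 3" and "CHAR('a::field) = p"
    and "m \<ge> 3" and "n \<ge> 3" and "\<forall>i\<in>Y0 m. t i \<ge> 1"
  shows "DerW p m n t = {combo p m n t (E :: wmon \<Rightarrow> 'a) c | E c. E \<in> Weven p m n t}
       \<and> (\<forall>E \<in> Weven p m n t. \<forall>c :: nat \<times> nat \<Rightarrow> 'a.
            (\<forall>X\<in>Weven p m n t. Wbr p m n t E X = spanop p m n t c X)
            \<longrightarrow> (\<forall>X\<in>Weven p m n t. Wbr p m n t E X = (\<lambda>_. 0)))"
proof -
  interpret even_witt p m n t "TYPE('a)"
    by unfold_locales (use assms in auto)
  show ?thesis
    using DerW_eq ad_inter_spanop by blast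
qed

end
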